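(* Let $G$ be a connected finite-dimensional (real) Lie group with Lie algebra $\mathfrak{g}$, and let $\mathfrak{a} = \mathfrak{g}^{ab} = \mathfrak{g}/[\mathfrak{g},\mathfrak{g}]$ be the abelianisation of $\mathfrak{g}$. Then there is an isomorphism of vector spaces $\Omega^2_I(G) \xrightarrow{\simeq} \bigwedge^2 \mathfrak{a}^*$, where $\Omega^2_I(G)$ is the space of bi-invariant differential 2-forms on $G$. If moreover $G$ is compact, then $\mathfrak{a}$ is the largest abelian summand of $\mathfrak{g}$; that is, $\mathfrak{g}$ has a largest abelian direct summand (as a Lie algebra), and the quotient map $\mathfrak{g}\to\mathfrak{a}$ restricts to an isomorphism from this summand onto $\mathfrak{a}$.
   Context: Differential forms are smooth and real-valued. For $g\in G$, let $L_g, R_g\colon G\to G$ denote left and right translation by $g$. A differential $k$-form $\eta$ on $G$ is bi-invariant if $L_g^*\eta = \eta = R_g^*\eta$ for all $g\in G$; $\Omega^k_I(G)$ is the real vector space of bi-invariant $k$-forms. $[\mathfrak{g},\mathfrak{g}]$ is the linear span of all brackets, and $\bigwedge^2\mathfrak{a}^*$ is identified with the space of alternating bilinear forms $\mathfrak{a}\times\mathfrak{a}\to\mathbb{R}$. *)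

theory Defs
  imports "HOL-Analysis.Analysis" "HOL-Algebra.Group" "HOL-Library.Function_Algebras"
begin

section \<open>Function spaces as real vector spaces\<close>

instantiation "fun" :: (type, real_vector) real_vector
begin

definition scaleR_fun :: "real \<Rightarrow> ('a \<Rightarrow> 'b) \<Rightarrow> 'a \<Rightarrow> 'b"
  where "scaleR_fun c f = (\<lambda>x. c *\<^sub>R f x)"

instance
  by standard (auto simp: scaleR_fun_def fun_eq_iff algebra_simps)

end


section \<open>Smooth maps between open subsets of finite-dimensional spaces\<close>

text \<open>These two predicates are only meaningful for an open set \<open>S\<close>, because the derivatives are
  taken at interior points. On a finite-dimensional domain, continuity of all directional
  derivatives is continuity of the Frechet derivative, so this is the usual class of $k$-times
  continuously differentiable maps.\<close>

primrec Ck_on :: "nat \<Rightarrow> 'e::real_normed_vector set \<Rightarrow> ('e \<Rightarrow> 'f::real_normed_vector) \<Rightarrow> bool" where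
  "Ck_on 0 S f \<longleftrightarrow> continuous_on S f"
| "Ck_on (Suc k) S f \<longleftrightarrow>
     (\<forall>x\<in>S. f differentiable (at x)) \<and> (\<forall>v. Ck_on k S (\<lambda>x. frechet_derivative f (at x) v))"

definition smooth_on :: "'e::real_normed_vector set \<Rightarrow> ('e \<Rightarrow> 'f::real_normed_vector) \<Rightarrow> bool"
  where "smooth_on S f \<longleftrightarrow> (\<forall>k. Ck_on k S f)"


section \<open>Smooth manifolds given by an atlas\<close>

text \<open>A chart is a pair of an open domain and a coordinate map, whose values outside the domain
  are irrelevant. The underlying space of a manifold is the whole type. Atlases need not be
  maximal; compatible atlases give rise to the same notions below.\<close>

type_synonym ('a, 'e) chart = "'a set \<times> ('a \<Rightarrow> 'e)"

definition is_chart :: "('a::topological_space, 'e::real_normed_vector) chart \<Rightarrow> bool" where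
  "is_chart c \<longleftrightarrow> (case c of (U, \<phi>) \<Rightarrow>
     open U \<and> open (\<phi> ` U) \<and> homeomorphism U (\<phi> ` U) \<phi> (inv_into U \<phi>))"

definition atlas :: "('a::topological_space, 'e::real_normed_vector) chart set \<Rightarrow> bool" where
  "atlas A \<longleftrightarrow>
     (\<forall>c\<in>A. is_chart c) \<and> (\<Union>c\<in>A. fst c) = UNIV \<and>
     (\<forall>(U, \<phi>)\<in>A. \<forall>(V, \<psi>)\<in>A. smooth_on (\<phi> ` (U \<inter> V)) (\<psi> \<circ> inv_into U \<phi>))"

definition prod_atlas ::
  "('a, 'e) chart set \<Rightarrow> ('b, 'f) chart set \<Rightarrow> ('a \<times> 'b, 'e \<times> 'f) chart set" where
  "prod_atlas A B = {(U \<times> V, map_prod \<phi> \<psi>) | U \<phi> V \<psi>. (U, \<phi>) \<in> A \<and> (V, \<psi>) \<in> B}"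

definition smooth_map ::
  "('a::topological_space, 'e::real_normed_vector) chart set \<Rightarrow>
   ('b::topological_space, 'f::real_normed_vector) chart set \<Rightarrow> ('a \<Rightarrow> 'b) \<Rightarrow> bool" where
  "smooth_map A B F \<longleftrightarrow> continuous_on UNIV F \<and>
     (\<forall>(U, \<phi>)\<in>A. \<forall>(V, \<psi>)\<in>B. smooth_on (\<phi> ` (U \<inter> F -` V)) (\<psi> \<circ> F \<circ> inv_into U \<phi>))"

definition smooth_fun_on ::
  "('a::topological_space, 'e::real_normed_vector) chart set \<Rightarrow> 'a set \<Rightarrow> ('a \<Rightarrow> real) \<Rightarrow> bool" where
  "smooth_fun_on A W f \<longleftrightarrow> (\<forall>(U, \<phi>)\<in>A. smooth_on (\<phi> ` (U \<inter> W)) (f \<circ> inv_into U \<phi>))"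

definition smooth_near ::
  "('a::topological_space, 'e::real_normed_vector) chart set \<Rightarrow> 'a \<Rightarrow> ('a \<Rightarrow> real) \<Rightarrow> bool" where
  "smooth_near A p f \<longleftrightarrow> (\<exists>W. open W \<and> p \<in> W \<and> smooth_fun_on A W f)"


section \<open>Linear isomorphisms and alternating bilinear forms\<close>

text \<open>Vector spaces as structures, so that quotient spaces (whose elements are cosets) can be
  treated on the same footing as subspaces of a \<^class>\<open>real_vector\<close> type.\<close>

record 'v vspace =
  vcarrier :: "'v set"
  vadd :: "'v \<Rightarrow> 'v \<Rightarrow> 'v"
  vscale :: "real \<Rightarrow> 'v \<Rightarrow> 'v"

definition sub_vspace :: "'v::real_vector set \<Rightarrow> 'v vspace" where
  "sub_vspace V = \<lparr>vcarrier = V, vadd = (+), vscale = (*\<^sub>R)\<rparr>"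

definition linear_isos :: "('v, 'm) vspace_scheme \<Rightarrow> ('w, 'n) vspace_scheme \<Rightarrow> ('v \<Rightarrow> 'w) set" where
  "linear_isos V W = {\<Phi>. bij_betw \<Phi> (vcarrier V) (vcarrier W) \<and>
     (\<forall>x\<in>vcarrier V. \<forall>y\<in>vcarrier V. \<Phi> (vadd V x y) = vadd W (\<Phi> x) (\<Phi> y)) \<and>
     (\<forall>c. \<forall>x\<in>vcarrier V. \<Phi> (vscale V c x) = vscale W c (\<Phi> x))}"

text \<open>Alternating bilinear forms, set to 0 outside the carrier, so that equality of forms is
  equality of functions.\<close>

definition alt_forms2 :: "('v, 'm) vspace_scheme \<Rightarrow> ('v \<Rightarrow> 'v \<Rightarrow> real) set" where
  "alt_forms2 V = {\<beta>.
     (\<forall>x\<in>vcarrier V. \<forall>y\<in>vcarrier V. \<forall>z\<in>vcarrier V.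
        \<beta> (vadd V x y) z = \<beta> x z + \<beta> y z \<and> \<beta> z (vadd V x y) = \<beta> z x + \<beta> z y) \<and>
     (\<forall>c. \<forall>x\<in>vcarrier V. \<forall>y\<in>vcarrier V.
        \<beta> (vscale V c x) y = c * \<beta> x y \<and> \<beta> x (vscale V c y) = c * \<beta> x y) \<and>
     (\<forall>x\<in>vcarrier V. \<beta> x x = 0) \<and>
     (\<forall>x y. x \<notin> vcarrier V \<or> y \<notin> vcarrier V \<longrightarrow> \<beta> x y = 0)}"


section \<open>Tangent vectors, vector fields and 2-forms\<close>

text \<open>Tangent vectors at \<open>p\<close> are derivations of the functions that are smooth near \<open>p\<close>. They are
  set to 0 on all other functions, so that equality of tangent vectors is equality of functions.
  The Leibniz rule forces a derivation to depend only on the germ of its argument.\<close>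

type_synonym 'a tangent = "('a \<Rightarrow> real) \<Rightarrow> real"

definition tangent_space ::
  "('a::topological_space, 'e::real_normed_vector) chart set \<Rightarrow> 'a \<Rightarrow> 'a tangent set" where
  "tangent_space A p = {D.
     (\<forall>f h a b. smooth_near A p f \<and> smooth_near A p h \<longrightarrow>
        D (\<lambda>q. a * f q + b * h q) = a * D f + b * D h) \<and>
     (\<forall>f h. smooth_near A p f \<and> smooth_near A p h \<longrightarrow>
        D (\<lambda>q. f q * h q) = D f * h p + f p * D h) \<and>
     (\<forall>f. \<not> smooth_near A p f \<longrightarrow> D f = 0)}"

definition differential ::
  "('b::topological_space, 'f::real_normed_vector) chart set \<Rightarrow> ('a \<Rightarrow> 'b) \<Rightarrow> 'a \<Rightarrow>
   'a tangent \<Rightarrow> 'b tangent" where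
  "differential B F p D = (\<lambda>h. if smooth_near B (F p) h then D (h \<circ> F) else 0)"

type_synonym 'a vector_field = "'a \<Rightarrow> 'a tangent"

definition smooth_vector_field_on ::
  "('a::topological_space, 'e::real_normed_vector) chart set \<Rightarrow> 'a set \<Rightarrow> 'a vector_field \<Rightarrow> bool"
  where
  "smooth_vector_field_on A W X \<longleftrightarrow>
     (\<forall>p\<in>W. X p \<in> tangent_space A p) \<and>
     (\<forall>U f. open U \<and> U \<subseteq> W \<and> smooth_fun_on A U f \<longrightarrow> smooth_fun_on A U (\<lambda>p. X p f))"

definition vf_bracket ::
  "('a::topological_space, 'e::real_normed_vector) chart set \<Rightarrow>
   'a vector_field \<Rightarrow> 'a vector_field \<Rightarrow> 'a vector_field" where
  "vf_bracket A X Y = (\<lambda>p f.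
     if smooth_near A p f then X p (\<lambda>q. Y q f) - Y p (\<lambda>q. X q f) else 0)"

type_synonym 'a two_form = "'a \<Rightarrow> 'a tangent \<Rightarrow> 'a tangent \<Rightarrow> real"

definition two_forms ::
  "('a::topological_space, 'e::real_normed_vector) chart set \<Rightarrow> 'a two_form set" where
  "two_forms A = {\<eta>.
     (\<forall>p. \<eta> p \<in> alt_forms2 (sub_vspace (tangent_space A p))) \<and>
     (\<forall>W X Y. open W \<and> smooth_vector_field_on A W X \<and> smooth_vector_field_on A W Y \<longrightarrow>
        smooth_fun_on A W (\<lambda>p. \<eta> p (X p) (Y p)))}"

definition pullback2 ::
  "('a::topological_space, 'e::real_normed_vector) chart set \<Rightarrow>
   ('b::topological_space, 'f::real_normed_vector) chart set \<Rightarrow>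
   ('a \<Rightarrow> 'b) \<Rightarrow> 'b two_form \<Rightarrow> 'a two_form" where
  "pullback2 A B F \<eta> = (\<lambda>p u v.
     if u \<in> tangent_space A p \<and> v \<in> tangent_space A p
     then \<eta> (F p) (differential B F p u) (differential B F p v) else 0)"


section \<open>Lie algebras\<close>

text \<open>A Lie algebra is given by a subspace \<open>V\<close> of a \<^class>\<open>real_vector\<close> type and a bracket \<open>br\<close>.\<close>

record 'v lie_struct = "'v vspace" +
  lbracket :: "'v \<Rightarrow> 'v \<Rightarrow> 'v"

definition sub_lie :: "('v::real_vector \<Rightarrow> 'v \<Rightarrow> 'v) \<Rightarrow> 'v set \<Rightarrow> 'v lie_struct" where
  "sub_lie br V = \<lparr>vcarrier = V, vadd = (+), vscale = (*\<^sub>R), lbracket = br\<rparr>"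

definition lie_isos :: "'v lie_struct \<Rightarrow> 'w lie_struct \<Rightarrow> ('v \<Rightarrow> 'w) set" where
  "lie_isos V W = {\<Phi>\<in>linear_isos V W.
     \<forall>x\<in>vcarrier V. \<forall>y\<in>vcarrier V. \<Phi> (lbracket V x y) = lbracket W (\<Phi> x) (\<Phi> y)}"

definition derived_algebra :: "('v::real_vector \<Rightarrow> 'v \<Rightarrow> 'v) \<Rightarrow> 'v set \<Rightarrow> 'v set" where
  "derived_algebra br V = span {br x y | x y. x \<in> V \<and> y \<in> V}"

definition coset :: "'v::real_vector set \<Rightarrow> 'v \<Rightarrow> 'v set" where
  "coset N x = {x + n | n. n \<in> N}"

text \<open>In the scaling and the bracket, \<open>N\<close> has to be added to get full cosets again: for example,
  the set of all \<open>0 *\<^sub>R a\<close> is just \<open>{0}\<close>.\<close>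

definition lie_quotient ::
  "('v::real_vector \<Rightarrow> 'v \<Rightarrow> 'v) \<Rightarrow> 'v set \<Rightarrow> 'v set \<Rightarrow> 'v set lie_struct" where
  "lie_quotient br V N = \<lparr>
     vcarrier = coset N ` V,
     vadd = (\<lambda>S T. {a + b | a b. a \<in> S \<and> b \<in> T}),
     vscale = (\<lambda>c S. {c *\<^sub>R a + n | a n. a \<in> S \<and> n \<in> N}),
     lbracket = (\<lambda>S T. {br a b + n | a b n. a \<in> S \<and> b \<in> T \<and> n \<in> N})\<rparr>"

definition abelianisation :: "('v::real_vector \<Rightarrow> 'v \<Rightarrow> 'v) \<Rightarrow> 'v set \<Rightarrow> 'v set lie_struct" where
  "abelianisation br V = lie_quotient br V (derived_algebra br V)"

definition lie_ideal :: "('v::real_vector \<Rightarrow> 'v \<Rightarrow> 'v) \<Rightarrow> 'v set \<Rightarrow> 'v set \<Rightarrow> bool" where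
  "lie_ideal br V I \<longleftrightarrow> subspace I \<and> I \<subseteq> V \<and> (\<forall>x\<in>V. \<forall>y\<in>I. br x y \<in> I)"

definition direct_summand :: "('v::real_vector \<Rightarrow> 'v \<Rightarrow> 'v) \<Rightarrow> 'v set \<Rightarrow> 'v set \<Rightarrow> bool" where
  "direct_summand br V S \<longleftrightarrow> lie_ideal br V S \<and>
     (\<exists>T. lie_ideal br V T \<and> S \<inter> T = {0} \<and> V = {s + t | s t. s \<in> S \<and> t \<in> T})"

definition abelian_summand :: "('v::real_vector \<Rightarrow> 'v \<Rightarrow> 'v) \<Rightarrow> 'v set \<Rightarrow> 'v set \<Rightarrow> bool" where
  "abelian_summand br V S \<longleftrightarrow> direct_summand br V S \<and> (\<forall>x\<in>S. \<forall>y\<in>S. br x y = 0)"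

definition largest_abelian_summand ::
  "('v::real_vector \<Rightarrow> 'v \<Rightarrow> 'v) \<Rightarrow> 'v set \<Rightarrow> 'v set \<Rightarrow> bool" where
  "largest_abelian_summand br V S \<longleftrightarrow>
     abelian_summand br V S \<and> (\<forall>S'. abelian_summand br V S' \<longrightarrow> S' \<subseteq> S)"


section \<open>Lie groups\<close>

text \<open>The model space is a finite-dimensional inner product space rather than a type of class
  \<^class>\<open>euclidean_space\<close>, because the latter excludes dimension 0.\<close>

locale lie_group = group G
  for G :: "('g::{t2_space, second_countable_topology}, 'm) monoid_scheme" (structure) +
  fixes A :: "('g, 'e::real_inner) chart set"
  assumes carrier_UNIV: "carrier G = UNIV"
    and finite_dim: "\<exists>B::'e set. finite B \<and> span B = UNIV"
    and atlas: "atlas A"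
    and smooth_mult: "smooth_map (prod_atlas A A) A (\<lambda>(x, y). x \<otimes> y)"
    and smooth_inv: "smooth_map A A (\<lambda>x. inv x)"

definition left_translation :: "('g, 'm) monoid_scheme \<Rightarrow> 'g \<Rightarrow> 'g \<Rightarrow> 'g" where
  "left_translation G g = (\<lambda>h. g \<otimes>\<^bsub>G\<^esub> h)"

definition right_translation :: "('g, 'm) monoid_scheme \<Rightarrow> 'g \<Rightarrow> 'g \<Rightarrow> 'g" where
  "right_translation G g = (\<lambda>h. h \<otimes>\<^bsub>G\<^esub> g)"

definition biinvariant_two_forms ::
  "('g::topological_space, 'm) monoid_scheme \<Rightarrow> ('g, 'e::real_normed_vector) chart set \<Rightarrow>
   'g two_form set" where
  "biinvariant_two_forms G A = {\<eta>\<in>two_forms A. \<forall>g\<in>carrier G.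
     pullback2 A A (left_translation G g) \<eta> = \<eta> \<and>
     pullback2 A A (right_translation G g) \<eta> = \<eta>}"

text \<open>With the bracket \<^const>\<open>vf_bracket\<close>, this is the Lie algebra of the Lie group.\<close>

definition left_invariant_fields ::
  "('g::topological_space, 'm) monoid_scheme \<Rightarrow> ('g, 'e::real_normed_vector) chart set \<Rightarrow>
   'g vector_field set" where
  "left_invariant_fields G A = {X. smooth_vector_field_on A UNIV X \<and>
     (\<forall>g\<in>carrier G. \<forall>p. differential A (left_translation G g) p (X p)
        = X (left_translation G g p))}"

end

theory Submission
  imports Defs
begin

text \<open>For a bi-invariant form \<open>\<eta>\<close>, the value at the identity is invariant under the adjoint
  representation; differentiating gives \<open>\<eta> [w, v] z = \<eta> [w, z] v\<close>. The trilinear map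
  \<open>(w, v, z) \<mapsto> \<eta> [w, v] z\<close> is then antisymmetric in the first two and symmetric in the last two
  arguments, hence zero, so that \<open>\<eta>\<close> descends to the abelianisation. Conversely, along a left
  invariant field \<open>w\<close> the function \<open>g \<mapsto> l (Ad g v)\<close> has the derivative
  \<open>l (Ad g [w, v]) = l [Ad g w, Ad g v]\<close>. If \<open>l\<close> vanishes on brackets, then this function is
  constant by connectedness. Thus \<open>Ad g\<close> is trivial modulo \<open>[\<gg>, \<gg>]\<close>, and every left invariant
  form that comes from the abelianisation is also right invariant. No exponential map is needed.

  If the group is compact, then every closed convex set that is invariant under a linear
  representation contains a fixed point, namely the minimiser of an invariant strictly convex norm.
  For the adjoint representation on \<open>v + [\<gg>, \<gg>]\<close> this shows that \<open>\<gg>\<close> is spanned by the center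
  and \<open>[\<gg>, \<gg>]\<close>; for the dual representation on the functionals with value 1 at a central \<open>z \<noteq> 0\<close>
  it shows that \<open>z \<notin> [\<gg>, \<gg>]\<close>. So the center is a complement of \<open>[\<gg>, \<gg>]\<close>, and it contains every
  abelian direct summand.\<close>

section \<open>Calculus on finite-dimensional inner product spaces\<close>

text \<open>A chart at \<open>\<one>\<close> identifies the Lie algebra with the model space
  \<open>'e\<close>: the bracket becomes \<open>brk\<close> and the adjoint representation becomes
  \<open>rho\<close>. Linear functionals are then of the form
  \<open>\<lambda>x. x \<bullet> l\<close>, so membership in the commutator subspace is tested by
  orthogonality, and the dual representation lives on the same space. As \<open>'e\<close> may have
  dimension 0, coordinates come from a \<open>frame\<close>.

  The obstacle is that tangent vectors are derivations, without coordinates of their own. Hadamard's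
  lemma recovers coordinates, and for it a parametric integral has to be differentiated. The
  derivative of \<open>rho\<close> rests on the commuting of left with right invariant fields, that
  is, of derivations on the two factors of the product applied to \<open>h (x \<otimes> y)\<close>.
  This is the symmetry of second derivatives in a product chart, hence the work on product
  manifolds. They are used once more for the Maurer-Cartan form \<open>mc\<close>, which spreads a
  form on the Lie algebra over the group: its smoothness comes from differentiating in one factor
  and restricting to the diagonal.\<close>

text \<open>A finite Parseval frame. The expansion formula is the whole interface: it makes
  \<open>x \<bullet> b\<close> the coordinates of \<open>x\<close>, passes to products, and is
  satisfied by the empty set in dimension 0.\<close>

definition frame :: "'e::real_inner set \<Rightarrow> bool" where
  "frame B \<longleftrightarrow> finite B \<and> (\<forall>x. (\<Sum>b\<in>B. (x \<bullet> b) *\<^sub>R b) = x)"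

lemma frame_finite: "frame B \<Longrightarrow> finite B"
  by (simp add: frame_def)

lemma frame_expand: "frame B \<Longrightarrow> (\<Sum>b\<in>B. (x \<bullet> b) *\<^sub>R b) = x"
  by (simp add: frame_def)

lemma frame_eqI:
  assumes "frame B" "\<And>b. b \<in> B \<Longrightarrow> x \<bullet> b = y \<bullet> b"
  shows "x = y"
proof -
  have "(\<Sum>b\<in>B. (x \<bullet> b) *\<^sub>R b) = (\<Sum>b\<in>B. (y \<bullet> b) *\<^sub>R b)"
    using assms(2) by (intro sum.cong) auto
  then show ?thesis using frame_expand[OF assms(1)] by metis
qed

text \<open>The reproducing formula for \<open>C\<close> is itself the induction hypothesis. It
  yields the residual \<open>b'\<close>, and since the projection it describes is self-adjoint, also
  the orthogonality of \<open>b'\<close> to the old span. A zero residual leaves \<open>C\<close>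
  unchanged.\<close>

lemma gram_schmidt:
  fixes B :: "'e::real_inner set"
  assumes "finite B"
  shows "\<exists>C. finite C \<and> C \<subseteq> span B \<and> (\<forall>x\<in>span B. (\<Sum>c\<in>C. (x \<bullet> c) *\<^sub>R c) = x)"
  using assms
proof (induction B)
  case empty
  show ?case by (intro exI[of _ "{}"]) auto
next
  case (insert b B)
  then obtain C where C: "finite C" "C \<subseteq> span B" "\<And>x. x \<in> span B \<Longrightarrow> (\<Sum>c\<in>C. (x \<bullet> c) *\<^sub>R c) = x"
    by blast
  define b' where "b' = b - (\<Sum>c\<in>C. (b \<bullet> c) *\<^sub>R c)"
  have proj: "(\<Sum>c\<in>C. (b \<bullet> c) *\<^sub>R c) \<in> span B"
    using C(2) by (intro span_sum span_scale) auto
  have decomp: "\<exists>k y. y \<in> span B \<and> x = k *\<^sub>R b' + y" if x: "x \<in> span (insert b B)" for x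
  proof -
    obtain k where k: "x - k *\<^sub>R b \<in> span B"
      using x span_breakdown_eq[of x b B] by auto
    have "x - k *\<^sub>R b' = (x - k *\<^sub>R b) + k *\<^sub>R (\<Sum>c\<in>C. (b \<bullet> c) *\<^sub>R c)"
      by (simp add: b'_def algebra_simps)
    also have "\<dots> \<in> span B"
      using k proj by (intro span_add span_scale)
    finally show ?thesis
      by (intro exI[of _ k] exI[of _ "x - k *\<^sub>R b'"]) auto
  qed
  have orth: "b' \<bullet> y = 0" if "y \<in> span B" for y
  proof -
    have "b' \<bullet> y = b \<bullet> y - (\<Sum>c\<in>C. (b \<bullet> c) * (y \<bullet> c))"
      by (simp add: b'_def inner_diff_left inner_sum_left inner_commute[of y])
    also have "(\<Sum>c\<in>C. (b \<bullet> c) * (y \<bullet> c)) = b \<bullet> (\<Sum>c\<in>C. (y \<bullet> c) *\<^sub>R c)"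
      by (simp add: inner_sum_right mult.commute)
    also have "\<dots> = b \<bullet> y"
      using C(3) that by simp
    finally show ?thesis by simp
  qed
  have b'_span: "b' \<in> span (insert b B)"
    unfolding b'_def using proj span_mono[of B "insert b B"]
    by (intro span_diff) (auto intro: span_base)
  have sub: "span B \<subseteq> span (insert b B)" by (intro span_mono) auto
  show ?case
  proof (cases "b' = 0")
    case True
    then have "x \<in> span B" if "x \<in> span (insert b B)" for x
      using decomp[OF that] by auto
    then show ?thesis
      using C sub by (intro exI[of _ C]) blast
  next
    case False
    define c' where "c' = b' /\<^sub>R norm b'"
    have c'1: "c' \<bullet> c' = 1"
      using False by (simp add: c'_def dot_square_norm power2_eq_square)
    have orth': "c' \<bullet> y = 0" if "y \<in> span B" for y
      using orth[OF that] by (simp add: c'_def)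
    have c'C: "c' \<notin> C"
      using orth' c'1 C(2) by fastforce
    have "(\<Sum>c\<in>insert c' C. (x \<bullet> c) *\<^sub>R c) = x" if x: "x \<in> span (insert b B)" for x
    proof -
      obtain k y where ky: "y \<in> span B" "x = k *\<^sub>R b' + y"
        using decomp[OF x] by blast
      have b'c': "b' = norm b' *\<^sub>R c'"
        using False by (simp add: c'_def)
      then have xc: "x = (k * norm b') *\<^sub>R c' + y"
        using ky(2) by (metis scaleR_scaleR)
      have "c' \<bullet> x = k * norm b'"
        unfolding xc by (simp add: inner_add_right c'1 orth'[OF ky(1)])
      then have "x \<bullet> c' = k * norm b'"
        by (simp add: inner_commute)
      moreover have "x \<bullet> c = y \<bullet> c" if "c \<in> C" for c
        using orth'[of c] C(2) that by (auto simp: xc inner_add_left)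
      then have "(\<Sum>c\<in>C. (x \<bullet> c) *\<^sub>R c) = y"
        using C(3)[OF ky(1)] by simp
      ultimately show ?thesis
        using C(1) c'C xc by simp
    qed
    moreover have "insert c' C \<subseteq> span (insert b B)"
      using C(2) sub b'_span by (auto simp: c'_def intro: span_scale)
    ultimately show ?thesis
      using C(1) by (intro exI[of _ "insert c' C"]) blast
  qed
qed

lemma frame_exists:
  assumes "finite B" "span B = (UNIV :: 'e::real_inner set)"
  shows "\<exists>C::'e set. frame C"
  using gram_schmidt[OF assms(1)] unfolding frame_def assms(2) by auto

lemma frame_prod:
  assumes "frame (B :: 'e::real_inner set)" "frame (C :: 'f::real_inner set)"
  shows "frame ((\<lambda>b. (b, 0)) ` B \<union> (\<lambda>c. (0, c)) ` C)"
proof -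
  have fin: "finite B" "finite C" using assms by (auto dest: frame_finite)
  have "(\<Sum>b\<in>(\<lambda>b. (b, 0)) ` B \<union> (\<lambda>c. (0, c)) ` C. (x \<bullet> b) *\<^sub>R b) = x" for x :: "'e \<times> 'f"
  proof -
    have "(\<Sum>b\<in>(\<lambda>b. (b, 0)) ` B \<union> (\<lambda>c. (0, c)) ` C. (x \<bullet> b) *\<^sub>R b) =
      (\<Sum>b\<in>(\<lambda>b. (b, 0)) ` B. (x \<bullet> b) *\<^sub>R b) + (\<Sum>b\<in>(\<lambda>c. (0, c)) ` C. (x \<bullet> b) *\<^sub>R b)
       - (\<Sum>b\<in>(\<lambda>b. (b, 0)) ` B \<inter> (\<lambda>c. (0, c)) ` C. (x \<bullet> b) *\<^sub>R b)"
      using fin by (intro sum_Un) auto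
    \<comment> \<open>A frame may contain 0, so the two embedded families need not be disjoint;
      their only possible common element is 0 and contributes nothing.\<close>
    also have "(\<Sum>b\<in>(\<lambda>b. (b, 0)) ` B \<inter> (\<lambda>c. (0, c)) ` C. (x \<bullet> b) *\<^sub>R b) = 0"
      by (intro sum.neutral) (auto simp: zero_prod_def)
    also have "(\<Sum>b\<in>(\<lambda>b. (b, 0)) ` B. (x \<bullet> b) *\<^sub>R b) = (\<Sum>b\<in>B. (fst x \<bullet> b) *\<^sub>R (b, 0))"
      by (subst sum.reindex) (auto simp: inj_on_def inner_prod_def)
    also have "\<dots> = (fst x, 0)"
      using frame_expand[OF assms(1), of "fst x"]
      by (simp add: prod_eq_iff fst_sum snd_sum)
    also have "(\<Sum>b\<in>(\<lambda>c. (0, c)) ` C. (x \<bullet> b) *\<^sub>R b) = (\<Sum>b\<in>C. (snd x \<bullet> b) *\<^sub>R (0, b))"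
      by (subst sum.reindex) (auto simp: inj_on_def inner_prod_def)
    also have "\<dots> = (0, snd x)"
      using frame_expand[OF assms(2), of "snd x"]
      by (simp add: prod_eq_iff fst_sum snd_sum)
    finally show ?thesis by (simp add: prod_eq_iff)
  qed
  then show ?thesis using fin by (auto simp: frame_def)
qed

lemma frame_linear:
  assumes "frame B" "linear f"
  shows "f x = (\<Sum>b\<in>B. (x \<bullet> b) *\<^sub>R f b)"
proof -
  have "f x = f (\<Sum>b\<in>B. (x \<bullet> b) *\<^sub>R b)" using frame_expand[OF assms(1)] by simp
  then show ?thesis by (simp add: linear_sum[OF assms(2)] linear_scale[OF assms(2)])
qed

lemma frame_linear_bound:
  assumes "frame B" "linear f" "\<And>b. b \<in> B \<Longrightarrow> norm (f b) \<le> e" "0 \<le> e"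
  shows "norm (f x) \<le> (\<Sum>b\<in>B. norm b) * e * norm x"
proof -
  have "norm (f x) \<le> (\<Sum>b\<in>B. norm ((x \<bullet> b) *\<^sub>R f b))"
    unfolding frame_linear[OF assms(1,2), of x] by (rule norm_sum)
  also have "\<dots> \<le> (\<Sum>b\<in>B. norm x * norm b * e)"
    using assms(3,4) Cauchy_Schwarz_ineq2
    by (intro sum_mono) (auto intro!: mult_mono)
  finally show ?thesis by (simp add: sum_distrib_left sum_distrib_right mult_ac)
qed

lemma frame_bounded_linear:
  assumes "frame (B :: 'e::real_inner set)" "linear (f :: 'e \<Rightarrow> 'f::real_normed_vector)"
  shows "bounded_linear f"
proof -
  have "bounded_linear (\<lambda>x. \<Sum>b\<in>B. (x \<bullet> b) *\<^sub>R f b)"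
    by (intro bounded_linear_sum bounded_linear_scaleR_const bounded_linear_inner_left)
  moreover have "(\<lambda>x. \<Sum>b\<in>B. (x \<bullet> b) *\<^sub>R f b) = f"
    by (intro ext frame_linear[OF assms, symmetric])
  ultimately show ?thesis by simp
qed

text \<open>A box of coefficients, built up one factor at a time as a continuous image of an
  interval times a compact set. It is the source of Heine-Borel for the model space.\<close>

lemma compact_combinations:
  fixes B :: "'a::real_normed_vector set"
  assumes "finite B"
  shows "compact {\<Sum>b\<in>B. a b *\<^sub>R b | a. \<forall>b\<in>B. \<bar>a b\<bar> \<le> (r::real)}"
  using assms
proof (induction B)
  case empty
  show ?case by simp
next
  case (insert b B)
  define S where "S = {\<Sum>b\<in>B. a b *\<^sub>R b | a. \<forall>b\<in>B. \<bar>a b\<bar> \<le> r}"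
  have "continuous_on X (\<lambda>(t, s). t *\<^sub>R b + s)" for X :: "(real \<times> 'a) set"
    unfolding split_def by (intro continuous_intros)
  then have "compact ((\<lambda>(t, s). t *\<^sub>R b + s) ` ({-r..r} \<times> S))"
    using insert by (intro compact_continuous_image compact_Times) (auto simp: S_def)
  moreover have "(\<lambda>(t, s). t *\<^sub>R b + s) ` ({-r..r} \<times> S) =
      {\<Sum>b\<in>insert b B. a b *\<^sub>R b | a. \<forall>b\<in>insert b B. \<bar>a b\<bar> \<le> r}" (is "?L = ?R")
  proof (intro subset_antisym subsetI)
    fix x assume "x \<in> ?L"
    then obtain t a where x: "x = t *\<^sub>R b + (\<Sum>b\<in>B. a b *\<^sub>R b)" "\<bar>t\<bar> \<le> r" "\<forall>b\<in>B. \<bar>a b\<bar> \<le> r"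
      by (auto simp: S_def abs_le_iff)
    have "(\<Sum>b\<in>B. a b *\<^sub>R b) = (\<Sum>b'\<in>B. (a(b := t)) b' *\<^sub>R b')"
      using insert by (intro sum.cong) auto
    then have "x = (\<Sum>b'\<in>insert b B. (a(b := t)) b' *\<^sub>R b')"
      using insert x by simp
    moreover have "\<forall>b'\<in>insert b B. \<bar>(a(b := t)) b'\<bar> \<le> r" using x by auto
    ultimately show "x \<in> ?R" by blast
  next
    fix x assume "x \<in> ?R"
    then obtain a where "x = (\<Sum>b\<in>insert b B. a b *\<^sub>R b)" "\<forall>b\<in>insert b B. \<bar>a b\<bar> \<le> r" by blast
    then have "x = (\<lambda>(t, s). t *\<^sub>R b + s) (a b, \<Sum>b\<in>B. a b *\<^sub>R b)"
      "(a b, \<Sum>b\<in>B. a b *\<^sub>R b) \<in> {-r..r} \<times> S"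
      using insert by (auto simp: S_def abs_le_iff)
    then show "x \<in> ?L" by blast
  qed
  ultimately show ?case by simp
qed

lemma frame_compact:
  assumes "frame (B :: 'e::real_inner set)" "closed S" "bounded S"
  shows "compact (S :: 'e set)"
proof -
  obtain r where r: "\<And>x. x \<in> S \<Longrightarrow> norm x \<le> r" using assms(3) bounded_iff by metis
  define m where "m = (\<Sum>b\<in>B. norm b)"
  have m: "norm b \<le> m" if "b \<in> B" for b
    unfolding m_def using that frame_finite[OF assms(1)] by (intro member_le_sum) auto
  let ?K = "{\<Sum>b\<in>B. a b *\<^sub>R b | a. \<forall>b\<in>B. \<bar>a b\<bar> \<le> \<bar>r\<bar> * m}"
  have "S \<subseteq> ?K"
  proof
    fix x assume x: "x \<in> S"
    have "\<bar>x \<bullet> b\<bar> \<le> \<bar>r\<bar> * m" if "b \<in> B" for b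
    proof -
      have "\<bar>x \<bullet> b\<bar> \<le> norm x * norm b" by (rule Cauchy_Schwarz_ineq2)
      also have "\<dots> \<le> \<bar>r\<bar> * m"
        using r[OF x] m[OF that] by (intro mult_mono) auto
      finally show ?thesis .
    qed
    then show "x \<in> ?K"
      using frame_expand[OF assms(1), of x] by (intro CollectI exI[of _ "\<lambda>b. x \<bullet> b"]) auto
  qed
  then have "?K \<inter> S = S" by blast
  moreover have "compact (?K \<inter> S)"
    using assms by (intro compact_Int_closed compact_combinations frame_finite)
  ultimately show ?thesis by simp
qed

section \<open>Calculus of k times continuously differentiable maps\<close>

text \<open>\<open>frechet_derivative\<close> is a choice; the two choices agree because the
  predicates chosen from are the same.\<close>

lemma frechet_derivative_cong_open:
  assumes "open S" "x \<in> S" "\<And>y. y \<in> S \<Longrightarrow> f y = g y"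
  shows "frechet_derivative f (at x) = frechet_derivative g (at x)"
proof -
  have "(f has_derivative f') (at x) \<longleftrightarrow> (g has_derivative f') (at x)" for f'
    using has_derivative_transform_within_open[of f f' x UNIV S g]
      has_derivative_transform_within_open[of g f' x UNIV S f] assms by auto
  then show ?thesis by (simp add: frechet_derivative_def)
qed

lemma differentiable_cong_open:
  assumes "open S" "x \<in> S" "\<And>y. y \<in> S \<Longrightarrow> f y = g y" "f differentiable (at x)"
  shows "g differentiable (at x)"
  using assms has_derivative_transform_within_open[of f _ x UNIV S g]
  unfolding differentiable_def by blast

lemma Ck_on_cong:
  assumes "open S" "\<And>y. y \<in> S \<Longrightarrow> f y = g y" "Ck_on k S f"
  shows "Ck_on k S g"
  using assms(2,3)
proof (induction k arbitrary: f g)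
  case 0
  then show ?case using continuous_on_eq by fastforce
next
  case (Suc k)
  have "Ck_on k S (\<lambda>x. frechet_derivative g (at x) v)" for v
  proof (rule Suc.IH[of "\<lambda>x. frechet_derivative f (at x) v"])
    show "frechet_derivative f (at y) v = frechet_derivative g (at y) v" if "y \<in> S" for y
      using frechet_derivative_cong_open[OF assms(1) that Suc.prems(1)] by simp
    show "Ck_on k S (\<lambda>x. frechet_derivative f (at x) v)"
      using Suc.prems(2) by simp
  qed
  moreover have "g differentiable (at x)" if "x \<in> S" for x
    using differentiable_cong_open[OF assms(1) that Suc.prems(1)] Suc.prems(2) that by auto
  ultimately show ?case by auto
qed

lemma Ck_on_subset: "Ck_on k S f \<Longrightarrow> T \<subseteq> S \<Longrightarrow> Ck_on k T f"
  by (induction k arbitrary: f) (auto intro: continuous_on_subset)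

lemma Ck_on_local:
  assumes "\<And>x. x \<in> S \<Longrightarrow> \<exists>T. open T \<and> x \<in> T \<and> Ck_on k T f"
  shows "Ck_on k S f"
  using assms
proof (induction k arbitrary: f)
  case 0
  have "continuous (at x within S) f" if x: "x \<in> S" for x
  proof -
    obtain T where "open T" "x \<in> T" "continuous_on T f"
      using 0[OF x] by auto
    then have "isCont f x" using continuous_on_eq_continuous_at by blast
    then show ?thesis using continuous_at_imp_continuous_at_within by blast
  qed
  then show ?case by (simp add: continuous_on_eq_continuous_within)
next
  case (Suc k)
  have "Ck_on k S (\<lambda>x. frechet_derivative f (at x) v)" for v
    using Suc.prems by (intro Suc.IH) fastforce
  moreover have "f differentiable (at x)" if "x \<in> S" for x
    using Suc.prems[OF that] by auto
  ultimately show ?case by simp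
qed

lemma Ck_on_SucI:
  assumes "open S" "\<And>x. x \<in> S \<Longrightarrow> (f has_derivative f' x) (at x)"
    "\<And>v. Ck_on k S (\<lambda>x. f' x v)"
  shows "Ck_on (Suc k) S f"
proof -
  have "Ck_on k S (\<lambda>x. frechet_derivative f (at x) v)" for v
    using frechet_derivative_at[OF assms(2)]
    by (intro Ck_on_cong[OF assms(1) _ assms(3)[of v]]) metis
  then show ?thesis
    using assms(2) by (auto simp: differentiable_def)
qed

lemma Ck_on_SucD:
  assumes "Ck_on (Suc k) S f"
  shows "x \<in> S \<Longrightarrow> (f has_derivative frechet_derivative f (at x)) (at x)"
    "Ck_on k S (\<lambda>x. frechet_derivative f (at x) v)"
  using assms by (auto simp: frechet_derivative_works)

text \<open>The recursion speaks about the continuity of \<open>f\<close> itself only at level 0, so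
  the descent ends with the continuity of differentiable functions.\<close>

lemma Ck_on_Suc_imp: "open S \<Longrightarrow> Ck_on (Suc k) S f \<Longrightarrow> Ck_on k S f"
proof (induction k arbitrary: f)
  case 0
  then show ?case
    by (auto intro!: continuous_at_imp_continuous_on differentiable_imp_continuous_within)
next
  case (Suc k)
  then show ?case by (metis Ck_on.simps(2))
qed

lemma Ck_on_0: "open S \<Longrightarrow> Ck_on k S f \<Longrightarrow> continuous_on S f"
  by (induction k arbitrary: f) (auto intro: Ck_on_Suc_imp
    intro!: continuous_at_imp_continuous_on differentiable_imp_continuous_within)

lemma Ck_on_const: "open S \<Longrightarrow> Ck_on k S (\<lambda>x. c)"
proof (induction k arbitrary: c)
  case (Suc k)
  then show ?case
    by (intro Ck_on_SucI[where f'="\<lambda>_ _. 0"]) auto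
qed simp

lemma Ck_on_linear: "open S \<Longrightarrow> bounded_linear f \<Longrightarrow> Ck_on k S f"
proof (induction k)
  case (Suc k)
  then show ?case
    by (intro Ck_on_SucI[where f'="\<lambda>_. f"] Ck_on_const bounded_linear_imp_has_derivative)
qed (simp add: linear_continuous_on)

lemma Ck_on_linear_comp:
  assumes "open S" "bounded_linear L"
  shows "Ck_on k S f \<Longrightarrow> Ck_on k S (\<lambda>x. L (f x))"
proof (induction k arbitrary: f)
  case 0
  then show ?case using bounded_linear.continuous_on[OF assms(2)] by simp
next
  case (Suc k)
  show ?case
    using Ck_on_SucD[OF Suc.prems]
    by (intro Ck_on_SucI[OF assms(1), of _ "\<lambda>x v. L (frechet_derivative f (at x) v)"]
        bounded_linear.has_derivative[OF assms(2)] Suc.IH)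
qed

lemma Ck_on_add:
  assumes "open S"
  shows "Ck_on k S f \<Longrightarrow> Ck_on k S g \<Longrightarrow> Ck_on k S (\<lambda>x. f x + g x)"
proof (induction k arbitrary: f g)
  case 0
  then show ?case by (simp add: continuous_on_add)
next
  case (Suc k)
  show ?case
    using Ck_on_SucD[OF Suc.prems(1)] Ck_on_SucD[OF Suc.prems(2)]
    by (intro Ck_on_SucI[OF assms(1), of _
          "\<lambda>x v. frechet_derivative f (at x) v + frechet_derivative g (at x) v"]
        has_derivative_add Suc.IH)
qed

lemma Ck_on_bilinear:
  assumes "open S" "bounded_bilinear p"
  shows "Ck_on k S f \<Longrightarrow> Ck_on k S g \<Longrightarrow> Ck_on k S (\<lambda>x. p (f x) (g x))"
proof (induction k arbitrary: f g)
  case 0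
  then show ?case using bounded_bilinear.continuous_on[OF assms(2)] by simp
next
  case (Suc k)
  note D = Ck_on_SucD[OF Suc.prems(1)] Ck_on_SucD[OF Suc.prems(2)]
  have "Ck_on k S f" "Ck_on k S g" using Suc.prems assms(1) Ck_on_Suc_imp by blast+
  then show ?case
    using D
    by (intro Ck_on_SucI[OF assms(1), of _
          "\<lambda>x v. p (f x) (frechet_derivative g (at x) v) + p (frechet_derivative f (at x) v) (g x)"]
        bounded_bilinear.FDERIV[OF assms(2)] Ck_on_add[OF assms(1)] Suc.IH)
qed

lemma Ck_on_sum:
  assumes "open S" "\<And>i. i \<in> I \<Longrightarrow> Ck_on k S (f i)"
  shows "Ck_on k S (\<lambda>x. \<Sum>i\<in>I. f i x)"
proof (cases "finite I")
  case True
  then show ?thesis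
    using assms(2)
  proof (induction I)
    case empty
    show ?case unfolding sum.empty by (rule Ck_on_const[OF assms(1)])
  next
    case (insert i I)
    then show ?case
      unfolding sum.insert[OF insert.hyps] by (intro Ck_on_add[OF assms(1)]) auto
  qed
next
  case False
  then show ?thesis unfolding sum.infinite[OF False] by (intro Ck_on_const[OF assms(1)])
qed

text \<open>The chain rule evaluates the derivative of \<open>g\<close> in a direction that moves
  with the point, whereas \<open>Ck_on\<close> speaks of fixed directions. Expanding that direction
  in the frame gives a sum of products whose factors are derivatives of \<open>f\<close> and
  derivatives of \<open>g\<close> in fixed directions \<open>b\<close> composed with
  \<open>f\<close>; the induction over \<open>g\<close> covers the latter.\<close>

lemma Ck_on_compose:
  fixes g :: "'e::real_inner \<Rightarrow> 'f::real_normed_vector"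
  assumes "frame (B :: 'e set)" "open S" "open T"
  shows "f ` S \<subseteq> T \<Longrightarrow> Ck_on k S f \<Longrightarrow> Ck_on k T g \<Longrightarrow> Ck_on k S (\<lambda>x. g (f x))"
proof (induction k arbitrary: g)
  case 0
  then show ?case using continuous_on_compose2[of T g S f] by simp
next
  case (Suc k)
  note F = Ck_on_SucD[OF Suc.prems(2)] and G = Ck_on_SucD[OF Suc.prems(3)]
  let ?d = "\<lambda>x v. \<Sum>b\<in>B. (frechet_derivative f (at x) v \<bullet> b) *\<^sub>R frechet_derivative g (at (f x)) b"
  have "((\<lambda>x. g (f x)) has_derivative ?d x) (at x)" if x: "x \<in> S" for x
  proof -
    have "f x \<in> T" using x Suc.prems(1) by auto
    note G' = G(1)[OF this]
    have "((\<lambda>x. g (f x)) has_derivative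
      (\<lambda>v. frechet_derivative g (at (f x)) (frechet_derivative f (at x) v))) (at x)"
      using has_derivative_compose[OF F(1)[OF x] G'] .
    moreover have "(\<lambda>v. frechet_derivative g (at (f x)) (frechet_derivative f (at x) v)) = ?d x"
      by (intro ext frame_linear[OF assms(1) has_derivative_linear[OF G']])
    ultimately show ?thesis by simp
  qed
  moreover have "Ck_on k S (\<lambda>x. ?d x v)" for v
    using Ck_on_Suc_imp[OF assms(2) Suc.prems(2)] Suc.prems(1) F(2) G(2)
    by (intro Ck_on_sum Ck_on_bilinear[OF assms(2) bounded_bilinear_scaleR]
        Ck_on_linear_comp[OF assms(2) bounded_linear_inner_left] assms Suc.IH)
  ultimately show ?case
    by (intro Ck_on_SucI[OF assms(2)])
qed

section \<open>Smoothness at a point\<close>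

text \<open>Smoothness of a germ. The closure rules for it carry no common domain along, and
  \<open>smooth_on_iff_smooth_at\<close> translates back on open sets.\<close>

definition smooth_at :: "('e::real_normed_vector \<Rightarrow> 'f::real_normed_vector) \<Rightarrow> 'e \<Rightarrow> bool" where
  "smooth_at f x \<longleftrightarrow> (\<exists>S. open S \<and> x \<in> S \<and> smooth_on S f)"

lemma smooth_on_cong:
  "open S \<Longrightarrow> (\<And>y. y \<in> S \<Longrightarrow> f y = g y) \<Longrightarrow> smooth_on S f \<Longrightarrow> smooth_on S g"
  unfolding smooth_on_def using Ck_on_cong by blast

lemma smooth_on_subset: "smooth_on S f \<Longrightarrow> T \<subseteq> S \<Longrightarrow> smooth_on T f"
  unfolding smooth_on_def using Ck_on_subset by blast

lemma smooth_on_iff_smooth_at: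
  assumes "open S"
  shows "smooth_on S f \<longleftrightarrow> (\<forall>x\<in>S. smooth_at f x)"
proof
  assume "smooth_on S f"
  then show "\<forall>x\<in>S. smooth_at f x" using assms by (auto simp: smooth_at_def)
next
  assume *: "\<forall>x\<in>S. smooth_at f x"
  show "smooth_on S f"
    unfolding smooth_on_def
  proof
    fix k show "Ck_on k S f"
      using * by (intro Ck_on_local) (auto simp: smooth_at_def smooth_on_def)
  qed
qed

lemma smooth_at_cong:
  assumes "open S" "x \<in> S" "\<And>y. y \<in> S \<Longrightarrow> f y = g y" "smooth_at f x"
  shows "smooth_at g x"
proof -
  obtain T where "open T" "x \<in> T" "smooth_on T f" using assms(4) by (auto simp: smooth_at_def)
  then have "smooth_on (S \<inter> T) g"
    using assms by (intro smooth_on_cong[of "S \<inter> T" f g]) (auto intro: smooth_on_subset)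
  then show ?thesis
    using assms \<open>open T\<close> \<open>x \<in> T\<close> unfolding smooth_at_def by (intro exI[of _ "S \<inter> T"]) auto
qed

lemma smooth_at_const: "smooth_at (\<lambda>x. c) x"
  unfolding smooth_at_def smooth_on_def by (intro exI[of _ UNIV]) (auto intro: Ck_on_const)

lemma smooth_at_linear: "bounded_linear f \<Longrightarrow> smooth_at f x"
  unfolding smooth_at_def smooth_on_def by (intro exI[of _ UNIV]) (auto intro: Ck_on_linear)

lemma smooth_at_bilinear:
  assumes "bounded_bilinear p" "smooth_at f x" "smooth_at g x"
  shows "smooth_at (\<lambda>x. p (f x) (g x)) x"
proof -
  obtain S T where "open S" "x \<in> S" "smooth_on S f" "open T" "x \<in> T" "smooth_on T g"
    using assms(2,3) by (auto simp: smooth_at_def)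
  then show ?thesis
    unfolding smooth_at_def smooth_on_def
    by (intro exI[of _ "S \<inter> T"]) (auto intro!: Ck_on_bilinear[OF _ assms(1)] intro: Ck_on_subset)
qed

lemma smooth_at_add:
  assumes "smooth_at f x" "smooth_at g x"
  shows "smooth_at (\<lambda>x. f x + g x) x"
proof -
  obtain S T where "open S" "x \<in> S" "smooth_on S f" "open T" "x \<in> T" "smooth_on T g"
    using assms by (auto simp: smooth_at_def)
  then show ?thesis
    unfolding smooth_at_def smooth_on_def
    by (intro exI[of _ "S \<inter> T"]) (auto intro!: Ck_on_add intro: Ck_on_subset)
qed

lemma smooth_at_linear_comp:
  assumes "bounded_linear L" "smooth_at f x"
  shows "smooth_at (\<lambda>x. L (f x)) x"
  using assms(2) Ck_on_linear_comp[OF _ assms(1)]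
  unfolding smooth_at_def smooth_on_def by blast

lemma smooth_at_sum:
  assumes "\<And>i. i \<in> I \<Longrightarrow> smooth_at (f i) x"
  shows "smooth_at (\<lambda>x. \<Sum>i\<in>I. f i x) x"
proof (cases "finite I")
  case True
  then show ?thesis
    using assms
  proof (induction I)
    case empty
    show ?case unfolding sum.empty by (rule smooth_at_const)
  next
    case (insert i I)
    then show ?case
      unfolding sum.insert[OF insert.hyps] by (intro smooth_at_add) auto
  qed
next
  case False
  then show ?thesis unfolding sum.infinite[OF False] by (intro smooth_at_const)
qed

lemma smooth_at_Pair:
  fixes f :: "'a::real_normed_vector \<Rightarrow> 'b::real_normed_vector"
    and g :: "'a::real_normed_vector \<Rightarrow> 'c::real_normed_vector"
  assumes "smooth_at f x" "smooth_at g x"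
  shows "smooth_at (\<lambda>x. (f x, g x)) x"
proof -
  have "bounded_linear (\<lambda>y::'b. (y, 0::'c))" "bounded_linear (\<lambda>y::'c. (0::'b, y))"
    by (auto intro!: bounded_linear_Pair bounded_linear_ident bounded_linear_zero)
  then have "smooth_at (\<lambda>x. (f x, 0) + (0, g x)) x"
    using assms by (intro smooth_at_add) (auto intro: smooth_at_linear_comp)
  then show ?thesis by simp
qed

lemma smooth_at_isCont:
  assumes "smooth_at f x"
  shows "isCont f x"
proof -
  obtain S where "open S" "x \<in> S" "Ck_on 0 S f"
    using assms unfolding smooth_at_def smooth_on_def by blast
  then show ?thesis using continuous_on_eq_continuous_at by auto
qed

lemma smooth_at_has_derivative:
  assumes "smooth_at f x"
  shows "(f has_derivative frechet_derivative f (at x)) (at x)"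
proof -
  obtain S where "open S" "x \<in> S" "Ck_on (Suc 0) S f"
    using assms unfolding smooth_at_def smooth_on_def by blast
  then show ?thesis using Ck_on_SucD(1) by blast
qed

lemma smooth_on_derivative:
  assumes "smooth_on S f"
  shows "smooth_on S (\<lambda>x. frechet_derivative f (at x) v)"
  using assms Ck_on_SucD(2) unfolding smooth_on_def by blast

lemma smooth_at_derivative:
  assumes "smooth_at f x"
  shows "smooth_at (\<lambda>x. frechet_derivative f (at x) v) x"
  using assms smooth_on_derivative unfolding smooth_at_def by blast

lemma smooth_at_compose:
  fixes g :: "'e::real_inner \<Rightarrow> 'f::real_normed_vector"
  assumes "frame (B :: 'e set)" "smooth_at f x" "smooth_at g (f x)"
  shows "smooth_at (\<lambda>x. g (f x)) x"
proof -
  obtain S where S: "open S" "x \<in> S" "smooth_on S f"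
    using assms(2) unfolding smooth_at_def by blast
  obtain T where T: "open T" "f x \<in> T" "smooth_on T g"
    using assms(3) unfolding smooth_at_def by blast
  have "Ck_on 0 S f" using S(3) unfolding smooth_on_def by blast
  then have o: "open (f -` T \<inter> S)"
    using continuous_on_open_vimage[OF S(1)] T(1) by auto
  have f: "Ck_on k (f -` T \<inter> S) f" for k
    using S(3) unfolding smooth_on_def by (blast intro: Ck_on_subset)
  have "Ck_on k (f -` T \<inter> S) (\<lambda>x. g (f x))" for k
    using T(3) unfolding smooth_on_def
    by (intro Ck_on_compose[OF assms(1) o T(1) _ f]) auto
  then show ?thesis
    using o S(2) T(2) unfolding smooth_at_def smooth_on_def by blast
qed

section \<open>Symmetry of second derivatives\<close>

lemma has_derivative_along_line:
  fixes f :: "'e::real_normed_vector \<Rightarrow> real"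
  assumes "(f has_derivative f') (at (a + t *\<^sub>R v))"
  shows "((\<lambda>t. f (a + t *\<^sub>R v)) has_real_derivative f' v) (at t)"
proof -
  have "((\<lambda>t. a + t *\<^sub>R v) has_derivative (\<lambda>t. t *\<^sub>R v)) (at t)"
    by (auto intro!: derivative_eq_intros)
  from has_derivative_compose[OF this assms]
  show ?thesis
    by (simp add: has_field_derivative_def linear_scale[OF has_derivative_linear[OF assms]]
        mult_commute_abs)
qed

text \<open>The mean value theorem is applied twice: first to the difference \<open>\<phi>\<close>
  of \<open>f\<close> along two parallel sides in direction \<open>v\<close>, then to the
  \<open>v\<close>-derivative in direction \<open>w\<close>. The second difference on the left does
  not change when \<open>v\<close> and \<open>w\<close> are exchanged, which is what makes it
  useful.\<close>

lemma second_difference: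
  fixes f :: "'e::real_normed_vector \<Rightarrow> real"
  assumes S: "smooth_on S f" and h: "0 < h"
    and seg: "\<And>s t. 0 \<le> s \<Longrightarrow> s \<le> h \<Longrightarrow> 0 \<le> t \<Longrightarrow> t \<le> h \<Longrightarrow> x + s *\<^sub>R v + t *\<^sub>R w \<in> S"
  shows "\<exists>s t. 0 < s \<and> s < h \<and> 0 < t \<and> t < h \<and>
    f (x + h *\<^sub>R v + h *\<^sub>R w) - f (x + h *\<^sub>R v) - f (x + h *\<^sub>R w) + f x =
    h * h * frechet_derivative (\<lambda>x. frechet_derivative f (at x) v) (at (x + s *\<^sub>R v + t *\<^sub>R w)) w"
proof -
  define f' where "f' = (\<lambda>x. frechet_derivative f (at x) v)"
  have D: "(f has_derivative frechet_derivative f (at y)) (at y)"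
    "(f' has_derivative frechet_derivative f' (at y)) (at y)" if "y \<in> S" for y
  proof -
    have "Ck_on (Suc 0) S f" "Ck_on (Suc 0) S f'"
      using S smooth_on_derivative[OF S, of v] unfolding smooth_on_def f'_def by blast+
    then show "(f has_derivative frechet_derivative f (at y)) (at y)"
      "(f' has_derivative frechet_derivative f' (at y)) (at y)"
      using that Ck_on_SucD(1) by blast+
  qed
  define \<phi> where "\<phi> = (\<lambda>s. f ((x + h *\<^sub>R w) + s *\<^sub>R v) - f (x + s *\<^sub>R v))"
  have d\<phi>: "(\<phi> has_real_derivative f' ((x + h *\<^sub>R w) + s *\<^sub>R v) - f' (x + s *\<^sub>R v)) (at s)"
    if "0 \<le> s" "s \<le> h" for s
    unfolding \<phi>_def f'_def
    using seg[of s h] seg[of s 0] that h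
    by (intro DERIV_diff has_derivative_along_line D(1)) (auto simp: algebra_simps)
  obtain s where s: "0 < s" "s < h"
    "\<phi> h - \<phi> 0 = (h - 0) * (f' ((x + h *\<^sub>R w) + s *\<^sub>R v) - f' (x + s *\<^sub>R v))"
    using MVT2[OF h d\<phi>] by blast
  have d\<psi>: "((\<lambda>t. f' ((x + s *\<^sub>R v) + t *\<^sub>R w)) has_real_derivative
      frechet_derivative f' (at (x + s *\<^sub>R v + t *\<^sub>R w)) w) (at t)" if "0 \<le> t" "t \<le> h" for t
    using seg[of s t] that s by (intro has_derivative_along_line D(2)) auto
  obtain t where t: "0 < t" "t < h"
    "f' ((x + s *\<^sub>R v) + h *\<^sub>R w) - f' ((x + s *\<^sub>R v) + 0 *\<^sub>R w) =
      (h - 0) * frechet_derivative f' (at (x + s *\<^sub>R v + t *\<^sub>R w)) w"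
    using MVT2[OF h d\<psi>] by blast
  have "\<phi> h - \<phi> 0 = h * (h * frechet_derivative f' (at (x + s *\<^sub>R v + t *\<^sub>R w)) w)"
    using s(3) t(3) by (simp add: ac_simps)
  then show ?thesis
    using s t unfolding f'_def by (intro exI[of _ s] exI[of _ t]) (simp add: \<phi>_def ac_simps)
qed

lemma small_parallelogram:
  fixes x :: "'e::real_normed_vector"
  assumes "open S" "x \<in> S"
  shows "\<exists>h>0. \<forall>s t. 0 \<le> s \<and> s \<le> h \<and> 0 \<le> t \<and> t \<le> h \<longrightarrow> x + s *\<^sub>R v + t *\<^sub>R w \<in> S"
proof -
  obtain r where r: "r > 0" "ball x r \<subseteq> S" using assms openE by blast
  \<comment> \<open>The summand 1 keeps the denominator positive when \<open>v\<close> and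
    \<open>w\<close> vanish; the factor 2 gives a strict inequality.\<close>
  define h where "h = r / (2 * (norm v + norm w + 1))"
  have h: "h > 0" using r by (simp add: h_def add_nonneg_pos)
  have hr: "h * (norm v + norm w) < r"
  proof -
    have "h * (norm v + norm w) \<le> h * (norm v + norm w + 1)"
      using h by (intro mult_left_mono) auto
    also have "\<dots> = r / 2" by (simp add: h_def add_nonneg_eq_0_iff field_simps)
    finally show ?thesis using r(1) by simp
  qed
  have "x + s *\<^sub>R v + t *\<^sub>R w \<in> S" if "0 \<le> s" "s \<le> h" "0 \<le> t" "t \<le> h" for s t
  proof -
    have "norm (s *\<^sub>R v + t *\<^sub>R w) \<le> norm (s *\<^sub>R v) + norm (t *\<^sub>R w)"
      by (rule norm_triangle_ineq)
    also have "\<dots> \<le> h * norm v + h * norm w"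
      using that by (intro add_mono) (auto intro: mult_right_mono)
    also have "\<dots> < r" using hr by (simp add: distrib_left)
    finally have "dist x (x + s *\<^sub>R v + t *\<^sub>R w) < r"
      by (metis add.assoc add_diff_cancel_left' dist_commute dist_norm)
    then show ?thesis using r(2) by auto
  qed
  then show ?thesis using h by blast
qed

text \<open>The same second difference, computed in both orders, equates the two mixed derivatives
  at two different points of a small parallelogram; their continuity at \<open>x\<close> carries the
  equality over to \<open>x\<close>.\<close>

lemma smooth_at_second_derivative_symmetric:
  fixes f :: "'e::real_normed_vector \<Rightarrow> real"
  assumes "smooth_at f x"
  shows "frechet_derivative (\<lambda>x. frechet_derivative f (at x) v) (at x) w =
    frechet_derivative (\<lambda>x. frechet_derivative f (at x) w) (at x) v"
proof -
  define a where "a = (\<lambda>y. frechet_derivative (\<lambda>x. frechet_derivative f (at x) v) (at y) w)"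
  define b where "b = (\<lambda>y. frechet_derivative (\<lambda>x. frechet_derivative f (at x) w) (at y) v)"
  obtain S where S: "open S" "x \<in> S" "smooth_on S f"
    using assms unfolding smooth_at_def by blast
  have cont: "isCont a x" "isCont b x"
    unfolding a_def b_def by (intro smooth_at_isCont smooth_at_derivative assms)+
  have "\<bar>a x - b x\<bar> \<le> e" if e: "e > 0" for e
  proof -
    have "\<forall>\<^sub>F y in nhds x. dist (a y) (a x) < e / 2" "\<forall>\<^sub>F y in nhds x. dist (b y) (b x) < e / 2"
      using cont e by (intro tendstoD; simp add: isCont_def tendsto_at_iff_tendsto_nhds)+
    then have "\<forall>\<^sub>F y in nhds x. dist (a y) (a x) < e / 2 \<and> dist (b y) (b x) < e / 2 \<and> y \<in> S"
      using S eventually_nhds by (intro eventually_conj) auto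
    then obtain T where T: "open T" "x \<in> T"
      "\<And>y. y \<in> T \<Longrightarrow> dist (a y) (a x) < e / 2 \<and> dist (b y) (b x) < e / 2 \<and> y \<in> S"
      unfolding eventually_nhds by blast
    obtain h where h: "h > 0"
      "\<And>s t. 0 \<le> s \<Longrightarrow> s \<le> h \<Longrightarrow> 0 \<le> t \<Longrightarrow> t \<le> h \<Longrightarrow> x + s *\<^sub>R v + t *\<^sub>R w \<in> T"
      using small_parallelogram[OF T(1,2), of v w] by blast
    have h': "x + s *\<^sub>R w + t *\<^sub>R v \<in> T" if "0 \<le> s" "s \<le> h" "0 \<le> t" "t \<le> h" for s t
      using h(2)[of t s] that by (simp add: ac_simps)
    obtain s t where st: "0 < s" "s < h" "0 < t" "t < h"
      "f (x + h *\<^sub>R v + h *\<^sub>R w) - f (x + h *\<^sub>R v) - f (x + h *\<^sub>R w) + f x = h * h * a (x + s *\<^sub>R v + t *\<^sub>R w)"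
      using second_difference[OF S(3) h(1), of x v w] h(2) T(3) unfolding a_def by blast
    obtain s' t' where st': "0 < s'" "s' < h" "0 < t'" "t' < h"
      "f (x + h *\<^sub>R w + h *\<^sub>R v) - f (x + h *\<^sub>R w) - f (x + h *\<^sub>R v) + f x = h * h * b (x + s' *\<^sub>R w + t' *\<^sub>R v)"
      using second_difference[OF S(3) h(1), of x w v] h' T(3) unfolding b_def by blast
    have swap: "x + h *\<^sub>R w + h *\<^sub>R v = x + h *\<^sub>R v + h *\<^sub>R w"
      by simp
    have "h * h * a (x + s *\<^sub>R v + t *\<^sub>R w) = h * h * b (x + s' *\<^sub>R w + t' *\<^sub>R v)"
      using st(5) st'(5) unfolding swap by linarith
    then have "a (x + s *\<^sub>R v + t *\<^sub>R w) = b (x + s' *\<^sub>R w + t' *\<^sub>R v)"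
      using h(1) by simp
    moreover have "dist (a (x + s *\<^sub>R v + t *\<^sub>R w)) (a x) < e / 2"
      using T(3) h(2)[of s t] st by auto
    moreover have "dist (b (x + s' *\<^sub>R w + t' *\<^sub>R v)) (b x) < e / 2"
      using T(3) h'[of s' t'] st' by auto
    ultimately show ?thesis unfolding dist_real_def by linarith
  qed
  then have "\<bar>a x - b x\<bar> \<le> 0"
    by (rule field_le_epsilon) simp
  then have "a x = b x" by simp
  then show ?thesis by (simp add: a_def b_def)
qed

section \<open>Integrals along rays and Hadamard's lemma\<close>

lemma ray_in_ball:
  fixes c :: "'e::real_normed_vector"
  assumes "x \<in> ball c r" "t \<in> {0..1}"
  shows "c + t *\<^sub>R (x - c) \<in> ball c r"
proof -
  have "norm (t *\<^sub>R (x - c)) \<le> norm (x - c)"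
    using assms by (simp add: mult_left_le_one_le)
  then show ?thesis using assms by (simp add: dist_norm norm_minus_commute)
qed

lemma continuous_on_rays:
  fixes f :: "'e::real_normed_vector \<Rightarrow> real"
  assumes "continuous_on (ball c r) f"
  shows "continuous_on (ball c r \<times> cbox 0 1) (\<lambda>(x, t). t ^ n * f (c + t *\<^sub>R (x - c)))"
proof -
  have "continuous_on (ball c r \<times> cbox 0 1) (\<lambda>p. c + snd p *\<^sub>R (fst p - c))"
    by (intro continuous_intros)
  then have "continuous_on (ball c r \<times> cbox 0 1) (\<lambda>p. f (c + snd p *\<^sub>R (fst p - c)))"
    by (rule continuous_on_compose2[OF assms]) (use ray_in_ball in fastforce)
  then show ?thesis
    unfolding split_def by (intro continuous_on_mult continuous_on_power continuous_on_snd continuous_on_id)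
qed

text \<open>Differentiation under the integral sign, repeated \<open>k\<close> times. Each
  derivative in \<open>x\<close> brings out one more factor \<open>t\<close>, so the weight
  \<open>t ^ n\<close> has to be part of the induction.\<close>

lemma Ck_on_ray_integral:
  fixes f :: "'e::real_inner \<Rightarrow> real"
  assumes B: "frame (B :: 'e set)"
  shows "Ck_on k (ball c r) f \<Longrightarrow>
    Ck_on k (ball c r) (\<lambda>x. integral {0..1} (\<lambda>t. t ^ n * f (c + t *\<^sub>R (x - c))))"
proof (induction k arbitrary: f n)
  case 0
  from integral_continuous_on_param[OF continuous_on_rays] 0 show ?case by simp
next
  case (Suc k)
  note D = Ck_on_SucD[OF Suc.prems]
  define g where "g = (\<lambda>x t. t ^ n * f (c + t *\<^sub>R (x - c)))"
  define g' where "g' = (\<lambda>v x t. t ^ Suc n * frechet_derivative f (at (c + t *\<^sub>R (x - c))) v)"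
  have g_der: "((\<lambda>x. g x t) has_derivative (\<lambda>v. g' v x t)) (at x)" if "x \<in> ball c r" "t \<in> {0..1}" for x t
  proof -
    have *: "((\<lambda>x. c + t *\<^sub>R (x - c)) has_derivative (\<lambda>v. t *\<^sub>R v)) (at x)"
      by (auto intro!: derivative_eq_intros)
    note Df = D(1)[OF ray_in_ball[OF that]]
    have "((\<lambda>x. g x t) has_derivative
      (\<lambda>v. t ^ n * frechet_derivative f (at (c + t *\<^sub>R (x - c))) (t *\<^sub>R v))) (at x)"
      unfolding g_def using has_derivative_compose[OF * Df] by (intro has_derivative_mult_right)
    then show ?thesis
      unfolding g'_def by (simp add: linear_scale[OF has_derivative_linear[OF Df]] ac_simps)
  qed
  have lin: "linear (\<lambda>v. g' v x t)" if "x \<in> ball c r" "t \<in> {0..1}" for x t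
    using g_der[OF that] by (rule has_derivative_linear)
  have cont_g': "continuous_on (ball c r \<times> cbox 0 1) (\<lambda>(x, t). g' v x t)" for v
    unfolding g'_def by (intro continuous_on_rays Ck_on_0[OF open_ball D(2)])
  have cont_g: "continuous_on (ball c r \<times> cbox 0 1) (\<lambda>(x, t). g x t)"
    unfolding g_def by (intro continuous_on_rays Ck_on_0[OF open_ball Suc.prems])
  have slice: "continuous_on (cbox 0 1) (h x)"
    if "continuous_on (ball c r \<times> cbox 0 1) (\<lambda>(x, t). h x t)" "x \<in> ball c r"
    for h :: "'e \<Rightarrow> real \<Rightarrow> real" and x
  proof -
    have "continuous_on (cbox 0 1) (\<lambda>t. (x, t))" by (intro continuous_intros)
    from continuous_on_compose2[OF that(1) this] that(2) show ?thesis by force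
  qed
  have int: "g x integrable_on {0..1}" "g' v x integrable_on {0..1}" if "x \<in> ball c r" for x v
    using slice[OF cont_g that] slice[OF cont_g' that]
    by (auto intro!: integrable_continuous_real)
  have der: "((\<lambda>x. integral {0..1} (g x)) has_derivative (\<lambda>v. integral {0..1} (g' v x))) (at x)"
    if x: "x \<in> ball c r" for x
    unfolding has_derivative_within_alt
  proof (intro conjI allI impI)
    have "linear (\<lambda>v. integral {0..1} (g' v x))"
    proof
      fix u v :: 'e and a :: real
      have "integral {0..1} (g' (u + v) x) = integral {0..1} (\<lambda>t. g' u x t + g' v x t)"
        by (intro integral_cong) (simp add: linear_add[OF lin[OF x]])
      then show "integral {0..1} (g' (u + v) x) = integral {0..1} (g' u x) + integral {0..1} (g' v x)"
        using int(2)[OF x] by (simp add: integral_add)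
      have "integral {0..1} (g' (a *\<^sub>R u) x) = integral {0..1} (\<lambda>t. a *\<^sub>R g' u x t)"
        by (intro integral_cong) (simp add: linear_scale[OF lin[OF x]])
      then show "integral {0..1} (g' (a *\<^sub>R u) x) = a *\<^sub>R integral {0..1} (g' u x)"
        by (simp only: integral_cmul)
    qed
    then show "bounded_linear (\<lambda>v. integral {0..1} (g' v x))"
      by (rule frame_bounded_linear[OF B])
    fix e :: real assume e: "e > 0"
    define m where "m = (\<Sum>b\<in>B. norm b)"
    have m: "m \<ge> 0" by (simp add: m_def sum_nonneg)
    \<comment> \<open>\<open>frame_linear_bound\<close> multiplies a bound on the frame vectors by
      \<open>m\<close>, so \<open>m * e'\<close> must not exceed \<open>e\<close>; the summand 1
      covers the case \<open>m = 0\<close>.\<close>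
    define e' where "e' = e / (m + 1)"
    have e': "e' > 0" "m * e' \<le> e" using e m by (auto simp: e'_def field_simps)
    \<comment> \<open>Compactness of the parameter interval makes the neighbourhood uniform in
      \<open>t\<close>. Intersecting over the finitely many frame vectors then makes the estimate
      uniform in the direction \<open>v\<close> as well.\<close>
    have "\<exists>X. open X \<and> x \<in> X \<and> (\<forall>y\<in>X \<inter> ball c r. \<forall>t\<in>cbox 0 1. norm (g' b y t - g' b x t) \<le> e')" for b
      using continuous_on_prod_compactE[OF cont_g' compact_cbox x e'(1), of b]
      unfolding split_def fst_conv snd_conv dist_norm by metis
    then obtain X where X: "\<And>b. open (X b)" "\<And>b. x \<in> X b"
      "\<And>b y t. y \<in> X b \<inter> ball c r \<Longrightarrow> t \<in> cbox 0 1 \<Longrightarrow> norm (g' b y t - g' b x t) \<le> e'"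
      by metis
    have "open ((\<Inter>b\<in>B. X b) \<inter> ball c r)"
      using frame_finite[OF B] X(1) by (intro open_Int open_INT) auto
    then obtain d where d: "d > 0" "ball x d \<subseteq> (\<Inter>b\<in>B. X b) \<inter> ball c r"
      using x X(2) by (metis INT_I IntI openE)
    have bound: "norm (g' v y t - g' v x t) \<le> e * norm v" if "y \<in> ball x d" "t \<in> {0..1}" for y t v
    proof -
      have y: "y \<in> ball c r" using that d by auto
      have "norm (g' b y t - g' b x t) \<le> e'" if "b \<in> B" for b
        using X(3)[of y b t] \<open>y \<in> ball x d\<close> \<open>t \<in> {0..1}\<close> d(2) that by fastforce
      moreover have "linear (\<lambda>v. g' v y t - g' v x t)"
        using lin[OF y that(2)] lin[OF x that(2)] by (rule linear_compose_sub)
      ultimately have "norm (g' v y t - g' v x t) \<le> m * e' * norm v"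
        unfolding m_def using e'(1) by (intro frame_linear_bound[OF B]) auto
      also have "\<dots> \<le> e * norm v" using e'(2) by (intro mult_right_mono) auto
      finally show ?thesis .
    qed
    have "norm (integral {0..1} (g y) - integral {0..1} (g x) - integral {0..1} (g' (y - x) x)) \<le> e * norm (y - x)"
      if y: "norm (y - x) < d" for y
    proof -
      have yb: "y \<in> ball x d" using y by (simp add: dist_norm norm_minus_commute)
      then have yc: "y \<in> ball c r" using d by auto
      have "norm (g y t - g x t - g' (y - x) x t) \<le> e * norm (y - x)" if t: "t \<in> {0..1}" for t
      proof -
        \<comment> \<open>Subtracting the linear part at \<open>x\<close> leaves a function whose
          derivative has norm at most \<open>e\<close> on the ball, so the mean value inequality
          bounds the remainder.\<close>
        define k where "k = (\<lambda>z. g z t - g' z x t)"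
        have k': "(k has_derivative (\<lambda>v. g' v z t - g' v x t)) (at z within ball x d)" if "z \<in> ball x d" for z
          unfolding k_def using that d t x
          by (intro has_derivative_diff has_derivative_at_withinI[OF g_der]
              bounded_linear_imp_has_derivative frame_bounded_linear[OF B] lin) auto
        have "norm (k y - k x) \<le> e * norm (y - x)"
        proof (rule differentiable_bound[OF convex_ball k' _ yb])
          show "onorm (\<lambda>v. g' v z t - g' v x t) \<le> e" if "z \<in> ball x d" for z
            using bound[OF that t] e by (intro onorm_bound) auto
          show "x \<in> ball x d" using d(1) by simp
        qed
        moreover have "k y - k x = g y t - g x t - g' (y - x) x t"
          by (simp add: k_def linear_diff[OF lin[OF x t]])
        ultimately show ?thesis by simp
      qed
      moreover have I: "(\<lambda>t. g y t - g x t - g' (y - x) x t) integrable_on {0..1}"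
        by (intro integrable_diff int x yc)
      ultimately have "norm (integral (cbox 0 1) (\<lambda>t. g y t - g x t - g' (y - x) x t))
          \<le> e * norm (y - x) * measure lborel (cbox 0 (1::real))"
        using e by (intro integrable_bound) auto
      moreover have "integral {0..1} (\<lambda>t. g y t - g x t - g' (y - x) x t) =
        integral {0..1} (g y) - integral {0..1} (g x) - integral {0..1} (g' (y - x) x)"
        by (intro integral_unique has_integral_diff integrable_integral int x yc)
      ultimately show ?thesis by simp
    qed
    then show "\<exists>d>0. \<forall>y\<in>UNIV. norm (y - x) < d \<longrightarrow>
       norm (integral {0..1} (g y) - integral {0..1} (g x) - integral {0..1} (g' (y - x) x)) \<le> e * norm (y - x)"
      using d(1) by blast
  qed
  have "Ck_on k (ball c r) (\<lambda>x. integral {0..1} (g' v x))" for v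
    unfolding g'_def by (rule Suc.IH[OF D(2)])
  then have "Ck_on (Suc k) (ball c r) (\<lambda>x. integral {0..1} (g x))"
    by (intro Ck_on_SucI[OF open_ball der])
  then show ?case by (simp only: g_def)
qed

text \<open>The function \<open>g b\<close> is the average of the \<open>b\<close>-derivative of
  \<open>f\<close> over the segment from \<open>c\<close> to \<open>x\<close>; the expansion is the
  fundamental theorem of calculus along this segment.\<close>

lemma hadamard:
  fixes f :: "'e::real_inner \<Rightarrow> real"
  assumes B: "frame (B :: 'e set)" and f: "smooth_on (ball c r) f"
  shows "\<exists>g. (\<forall>b\<in>B. smooth_on (ball c r) (g b) \<and> g b c = frechet_derivative f (at c) b) \<and>
    (\<forall>x\<in>ball c r. f x = f c + (\<Sum>b\<in>B. ((x - c) \<bullet> b) * g b x))"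
proof -
  \<comment> \<open>The factor \<open>t ^ 0\<close> gives the integrand the shape required by
    \<open>Ck_on_ray_integral\<close>.\<close>
  define G where "G = (\<lambda>v x. integral {0..1} (\<lambda>t. t ^ 0 * frechet_derivative f (at (c + t *\<^sub>R (x - c))) v))"
  have smooth: "smooth_on (ball c r) (G v)" for v
    using smooth_on_derivative[OF f, of v] Ck_on_ray_integral[OF B]
    unfolding smooth_on_def G_def by blast
  have C1: "Ck_on (Suc 0) (ball c r) f" using f unfolding smooth_on_def by blast
  note D = Ck_on_SucD(1)[OF C1]
  have cont: "continuous_on (ball c r) (\<lambda>x. frechet_derivative f (at x) v)" for v
    using Ck_on_SucD(2)[OF C1] by simp
  have "f x = f c + (\<Sum>b\<in>B. ((x - c) \<bullet> b) * G b x)" if x: "x \<in> ball c r" for x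
  proof -
    let ?d = "\<lambda>v t. frechet_derivative f (at (c + t *\<^sub>R (x - c))) v"
    have "((\<lambda>t. f (c + t *\<^sub>R (x - c))) has_vector_derivative ?d (x - c) t) (at t within {0..1})"
      if "t \<in> {0..1}" for t
      using has_derivative_along_line[OF D[OF ray_in_ball[OF x that]]]
      by (simp add: has_real_derivative_iff_has_vector_derivative has_vector_derivative_at_within)
    then have "(?d (x - c) has_integral (f (c + 1 *\<^sub>R (x - c)) - f (c + 0 *\<^sub>R (x - c)))) {0..1}"
      by (intro fundamental_theorem_of_calculus) auto
    then have 1: "integral {0..1} (?d (x - c)) = f x - f c"
      by (simp add: integral_unique)
    have "continuous_on {0..1} (?d v)" for v
      using ray_in_ball[OF x] by (intro continuous_on_compose2[OF cont] continuous_intros) auto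
    then have int: "?d v integrable_on {0..1}" for v
      by (rule integrable_continuous_real)
    have "integral {0..1} (?d (x - c)) = integral {0..1} (\<lambda>t. \<Sum>b\<in>B. ((x - c) \<bullet> b) * ?d b t)"
    proof (rule integral_cong)
      fix t :: real assume t: "t \<in> {0..1}"
      show "?d (x - c) t = (\<Sum>b\<in>B. ((x - c) \<bullet> b) * ?d b t)"
        using frame_linear[OF B has_derivative_linear[OF D[OF ray_in_ball[OF x t]]], of "x - c"]
        by simp
    qed
    also have "\<dots> = (\<Sum>b\<in>B. integral {0..1} (\<lambda>t. ((x - c) \<bullet> b) * ?d b t))"
      using frame_finite[OF B] int by (intro integral_sum integrable_on_mult_right) auto
    also have "\<dots> = (\<Sum>b\<in>B. ((x - c) \<bullet> b) * G b x)"
      by (simp add: G_def)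
    finally show ?thesis using 1 by simp
  qed
  moreover have "G b c = frechet_derivative f (at c) b" for b
    by (simp add: G_def)
  ultimately show ?thesis using smooth by (intro exI[of _ G]) auto
qed

section \<open>Manifolds\<close>

locale manifold =
  fixes A :: "('a::topological_space, 'e::real_inner) chart set" and B :: "'e set"
  assumes atlas: "atlas A" and frame: "frame B"
begin

lemma chart:
  assumes "(U, \<phi>) \<in> A"
  shows open_chart_domain: "open U" and open_chart_image: "open (\<phi> ` U)"
    and chart_cont: "continuous_on U \<phi>" and chart_inv_cont: "continuous_on (\<phi> ` U) (inv_into U \<phi>)"
    and chart_inv_chart: "\<And>q. q \<in> U \<Longrightarrow> inv_into U \<phi> (\<phi> q) = q"
    and chart_inv_mem: "\<And>x. x \<in> \<phi> ` U \<Longrightarrow> inv_into U \<phi> x \<in> U"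
    and chart_chart_inv: "\<And>x. x \<in> \<phi> ` U \<Longrightarrow> \<phi> (inv_into U \<phi> x) = x"
proof -
  have "is_chart (U, \<phi>)" using atlas assms unfolding atlas_def by blast
  then show "open U" "open (\<phi> ` U)" "continuous_on U \<phi>" "continuous_on (\<phi> ` U) (inv_into U \<phi>)"
    "\<And>q. q \<in> U \<Longrightarrow> inv_into U \<phi> (\<phi> q) = q"
    by (auto simp: is_chart_def homeomorphism_def)
  show "inv_into U \<phi> x \<in> U" "\<phi> (inv_into U \<phi> x) = x" if "x \<in> \<phi> ` U" for x
    using that by (auto intro: inv_into_into f_inv_into_f)
qed

lemma chart_at: obtains U \<phi> where "(U, \<phi>) \<in> A" "p \<in> U"
proof -
  have "p \<in> (\<Union>c\<in>A. fst c)" using atlas unfolding atlas_def by blast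
  then obtain c where "c \<in> A" "p \<in> fst c" by blast
  then show thesis by (intro that[of "fst c" "snd c"]) auto
qed

lemma open_image_chart:
  assumes "(U, \<phi>) \<in> A" "open W"
  shows "open (\<phi> ` (U \<inter> W))"
proof -
  have "\<phi> ` (U \<inter> W) = \<phi> ` U \<inter> inv_into U \<phi> -` W"
    using chart_inv_chart[OF assms(1)] chart_inv_mem[OF assms(1)] chart_chart_inv[OF assms(1)]
    by (auto simp: image_iff)
  then show ?thesis
    using continuous_open_preimage[OF chart_inv_cont open_chart_image, OF assms(1,1,2)] by simp
qed

lemma open_preimage_chart:
  assumes "(U, \<phi>) \<in> A" "open S"
  shows "open (U \<inter> \<phi> -` S)"
  using continuous_open_preimage[OF chart_cont open_chart_domain, OF assms(1,1,2)] .

lemma chart_transition_smooth_at: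
  assumes "(U, \<phi>) \<in> A" "(V, \<kappa>) \<in> A" "q \<in> U" "q \<in> V"
  shows "smooth_at (\<kappa> \<circ> inv_into U \<phi>) (\<phi> q)"
proof -
  have "smooth_on (\<phi> ` (U \<inter> V)) (\<kappa> \<circ> inv_into U \<phi>)"
    using atlas assms unfolding atlas_def by blast
  moreover have "open (\<phi> ` (U \<inter> V))"
    using assms by (intro open_image_chart open_chart_domain)
  ultimately show ?thesis using assms unfolding smooth_at_def by blast
qed

text \<open>A single chart around \<open>p\<close> decides, because any other chart differs from it
  by a smooth transition map. This is the bridge from germs on the manifold to calculus in the model
  space.\<close>

lemma smooth_near_iff:
  assumes "(U, \<phi>) \<in> A" "p \<in> U"
  shows "smooth_near A p f \<longleftrightarrow> smooth_at (f \<circ> inv_into U \<phi>) (\<phi> p)"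
proof
  assume "smooth_near A p f"
  then obtain W where W: "open W" "p \<in> W" "smooth_fun_on A W f"
    unfolding smooth_near_def by blast
  then have "smooth_on (\<phi> ` (U \<inter> W)) (f \<circ> inv_into U \<phi>)"
    using assms unfolding smooth_fun_on_def by blast
  then show "smooth_at (f \<circ> inv_into U \<phi>) (\<phi> p)"
    using open_image_chart[OF assms(1) W(1)] assms W unfolding smooth_at_def by blast
next
  assume "smooth_at (f \<circ> inv_into U \<phi>) (\<phi> p)"
  then obtain S where S: "open S" "\<phi> p \<in> S" "smooth_on S (f \<circ> inv_into U \<phi>)"
    unfolding smooth_at_def by blast
  define W where "W = U \<inter> \<phi> -` S"
  have W: "open W" "p \<in> W"
    using open_preimage_chart[OF assms(1) S(1)] S(2) assms by (auto simp: W_def)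
  have "smooth_on (\<kappa> ` (V \<inter> W)) (f \<circ> inv_into V \<kappa>)" if V: "(V, \<kappa>) \<in> A" for V \<kappa>
    unfolding smooth_on_iff_smooth_at[OF open_image_chart[OF V W(1)]]
  proof
    fix y assume "y \<in> \<kappa> ` (V \<inter> W)"
    then obtain q where q: "y = \<kappa> q" "q \<in> V" "q \<in> U" "\<phi> q \<in> S" by (auto simp: W_def)
    have *: "(\<phi> \<circ> inv_into V \<kappa>) y = \<phi> q"
      using q chart_inv_chart[OF V] by simp
    have 2: "smooth_at (f \<circ> inv_into U \<phi>) ((\<phi> \<circ> inv_into V \<kappa>) y)"
      unfolding * using S q unfolding smooth_at_def by blast
    have 1: "smooth_at (\<phi> \<circ> inv_into V \<kappa>) y"
      unfolding q(1) by (rule chart_transition_smooth_at[OF V assms(1) q(2,3)])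
    from smooth_at_compose[OF frame 1 2] show "smooth_at (f \<circ> inv_into V \<kappa>) y"
    proof (rule smooth_at_cong[OF open_image_chart[OF V open_chart_domain[OF assms(1)]], rotated 2])
      show "y \<in> \<kappa> ` (V \<inter> U)" using q by blast
      show "(f \<circ> inv_into U \<phi>) ((\<phi> \<circ> inv_into V \<kappa>) z) = (f \<circ> inv_into V \<kappa>) z" if "z \<in> \<kappa> ` (V \<inter> U)" for z
        using that chart_inv_chart[OF V] chart_inv_chart[OF assms(1)] by auto
    qed
  qed
  then show "smooth_near A p f"
    using W unfolding smooth_near_def smooth_fun_on_def by blast
qed

lemma smooth_near_mem: "open W \<Longrightarrow> smooth_fun_on A W f \<Longrightarrow> p \<in> W \<Longrightarrow> smooth_near A p f"
  unfolding smooth_near_def by blast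

lemma smooth_near_nhd:
  assumes "smooth_near A p f"
  obtains W where "open W" "p \<in> W" "\<And>q. q \<in> W \<Longrightarrow> smooth_near A q f"
  using assms unfolding smooth_near_def by blast

lemma smooth_fun_on_iff:
  assumes "open W"
  shows "smooth_fun_on A W f \<longleftrightarrow> (\<forall>p\<in>W. smooth_near A p f)"
proof
  assume "smooth_fun_on A W f"
  then show "\<forall>p\<in>W. smooth_near A p f" using assms smooth_near_mem by blast
next
  assume *: "\<forall>p\<in>W. smooth_near A p f"
  have "smooth_on (\<phi> ` (U \<inter> W)) (f \<circ> inv_into U \<phi>)" if U: "(U, \<phi>) \<in> A" for U \<phi>
    unfolding smooth_on_iff_smooth_at[OF open_image_chart[OF U assms]]
    using * smooth_near_iff[OF U] by blast
  then show "smooth_fun_on A W f" unfolding smooth_fun_on_def by blast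
qed

lemma smooth_near_cong:
  assumes "open W" "p \<in> W" "\<And>q. q \<in> W \<Longrightarrow> f q = g q" "smooth_near A p f"
  shows "smooth_near A p g"
proof -
  obtain U \<phi> where U: "(U, \<phi>) \<in> A" "p \<in> U" by (rule chart_at)
  have "smooth_at (f \<circ> inv_into U \<phi>) (\<phi> p)" using assms(4) smooth_near_iff[OF U] by simp
  then have "smooth_at (g \<circ> inv_into U \<phi>) (\<phi> p)"
  proof (rule smooth_at_cong[OF open_image_chart[OF U(1) assms(1)], rotated 2])
    show "\<phi> p \<in> \<phi> ` (U \<inter> W)" using U assms by blast
    show "(f \<circ> inv_into U \<phi>) y = (g \<circ> inv_into U \<phi>) y" if "y \<in> \<phi> ` (U \<inter> W)" for y
      using that assms(3) chart_inv_chart[OF U(1)] by auto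
  qed
  then show ?thesis using smooth_near_iff[OF U] by simp
qed

lemma smooth_near_const: "smooth_near A p (\<lambda>q. c)"
proof -
  obtain U \<phi> where U: "(U, \<phi>) \<in> A" "p \<in> U" by (rule chart_at)
  show ?thesis unfolding smooth_near_iff[OF U] by (simp add: o_def smooth_at_const)
qed

lemma smooth_near_add:
  assumes "smooth_near A p f" "smooth_near A p g"
  shows "smooth_near A p (\<lambda>q. f q + g q)"
proof -
  obtain U \<phi> where U: "(U, \<phi>) \<in> A" "p \<in> U" by (rule chart_at)
  show ?thesis
    using assms smooth_at_add[of "f \<circ> inv_into U \<phi>" _ "g \<circ> inv_into U \<phi>"]
    unfolding smooth_near_iff[OF U] by (simp add: o_def)
qed

lemma smooth_near_mult:
  assumes "smooth_near A p f" "smooth_near A p g"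
  shows "smooth_near A p (\<lambda>q. f q * g q)"
proof -
  obtain U \<phi> where U: "(U, \<phi>) \<in> A" "p \<in> U" by (rule chart_at)
  show ?thesis
    using assms smooth_at_bilinear[OF bounded_bilinear_mult, of "f \<circ> inv_into U \<phi>" _ "g \<circ> inv_into U \<phi>"]
    unfolding smooth_near_iff[OF U] by (simp add: o_def)
qed

lemma smooth_near_sum:
  assumes "\<And>i. i \<in> I \<Longrightarrow> smooth_near A p (f i)"
  shows "smooth_near A p (\<lambda>q. \<Sum>i\<in>I. f i q)"
proof -
  obtain U \<phi> where U: "(U, \<phi>) \<in> A" "p \<in> U" by (rule chart_at)
  show ?thesis
    using assms smooth_at_sum[of I "\<lambda>i. f i \<circ> inv_into U \<phi>"]
    unfolding smooth_near_iff[OF U] by (simp add: o_def)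
qed

lemma smooth_near_scale: "smooth_near A p f \<Longrightarrow> smooth_near A p (\<lambda>q. c * f q)"
  by (intro smooth_near_mult smooth_near_const)

lemma smooth_near_diff:
  assumes "smooth_near A p f" "smooth_near A p g"
  shows "smooth_near A p (\<lambda>q. f q - g q)"
  using smooth_near_add[OF assms(1) smooth_near_scale[OF assms(2), of "-1"]] by simp

lemma smooth_near_coord:
  assumes "(U, \<phi>) \<in> A" "p \<in> U"
  shows "smooth_near A p (\<lambda>q. \<phi> q \<bullet> b)"
  unfolding smooth_near_iff[OF assms]
proof (rule smooth_at_cong[OF open_chart_image[OF assms(1)]])
  show "smooth_at (\<lambda>x. x \<bullet> b) (\<phi> p)"
    by (intro smooth_at_linear bounded_linear_inner_left)
qed (use assms chart_chart_inv[OF assms(1)] in auto)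

lemma smooth_near_continuous_on:
  assumes "\<And>p. smooth_near A p f"
  shows "continuous_on UNIV f"
proof -
  have "continuous_on (fst c) f" if c: "c \<in> A" for c
  proof -
    obtain U \<phi> where U: "c = (U, \<phi>)" "(U, \<phi>) \<in> A" using c by (cases c) auto
    have "continuous_on (\<phi> ` U) (f \<circ> inv_into U \<phi>)"
      using assms smooth_near_iff[OF U(2)] smooth_at_isCont
      by (intro continuous_at_imp_continuous_on) blast
    then have "continuous_on U (\<lambda>q. (f \<circ> inv_into U \<phi>) (\<phi> q))"
      using chart_cont[OF U(2)] by (rule continuous_on_compose2) simp
    then have "continuous_on U f"
      by (rule continuous_on_eq) (simp add: chart_inv_chart[OF U(2)])
    then show ?thesis by (simp add: U(1))
  qed
  then have "continuous_on (\<Union>c\<in>A. fst c) f"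
    using open_chart_domain by (intro continuous_on_open_UN) auto
  then show ?thesis using atlas unfolding atlas_def by simp
qed

end

section \<open>Smooth maps through pullback of germs\<close>

text \<open>Smoothness expressed by continuity and the pullback of smooth germs. In this form it
  composes without reference to charts and fits derivations, which act on germs;
  \<open>smooth_map\<close> implies it.\<close>

definition smooth_pull ::
  "('a::topological_space, 'e::real_inner) chart set \<Rightarrow>
   ('b::topological_space, 'f::real_inner) chart set \<Rightarrow> ('a \<Rightarrow> 'b) \<Rightarrow> bool" where
  "smooth_pull A A' F \<longleftrightarrow> continuous_on UNIV F \<and>
     (\<forall>p f. smooth_near A' (F p) f \<longrightarrow> smooth_near A p (\<lambda>q. f (F q)))"

lemma smooth_pull_near: "smooth_pull A A' F \<Longrightarrow> smooth_near A' (F p) f \<Longrightarrow> smooth_near A p (\<lambda>q. f (F q))"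
  by (simp add: smooth_pull_def)

lemma smooth_pull_id: "smooth_pull A A (\<lambda>p. p)"
  by (simp add: smooth_pull_def)

lemma smooth_pull_const: "manifold A B \<Longrightarrow> smooth_pull A A' (\<lambda>p. c)"
  by (simp add: smooth_pull_def manifold.smooth_near_const)

lemma smooth_pull_compose:
  "smooth_pull A A' F \<Longrightarrow> smooth_pull A' A'' H \<Longrightarrow> smooth_pull A A'' (\<lambda>p. H (F p))"
  by (auto simp: smooth_pull_def intro: continuous_on_compose2)

lemma smooth_map_imp_smooth_pull:
  assumes "manifold A B" "manifold A' B'" "smooth_map A A' F"
  shows "smooth_pull A A' F"
  unfolding smooth_pull_def
proof (intro conjI allI impI)
  interpret M: manifold A B by fact
  interpret N: manifold A' B' by fact
  show cont: "continuous_on UNIV F" using assms(3) by (simp add: smooth_map_def)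
  fix p f assume f: "smooth_near A' (F p) f"
  obtain U \<phi> where U: "(U, \<phi>) \<in> A" "p \<in> U" by (rule M.chart_at)
  obtain V \<kappa> where V: "(V, \<kappa>) \<in> A'" "F p \<in> V" by (rule N.chart_at)
  have o: "open (\<phi> ` (U \<inter> F -` V))"
    using cont N.open_chart_domain[OF V(1)] by (intro M.open_image_chart[OF U(1)] open_vimage)
  have "smooth_on (\<phi> ` (U \<inter> F -` V)) (\<kappa> \<circ> F \<circ> inv_into U \<phi>)"
    using assms(3) U V unfolding smooth_map_def by blast
  then have 1: "smooth_at (\<kappa> \<circ> F \<circ> inv_into U \<phi>) (\<phi> p)"
    using o U V unfolding smooth_at_def by blast
  have "(\<kappa> \<circ> F \<circ> inv_into U \<phi>) (\<phi> p) = \<kappa> (F p)"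
    using M.chart_inv_chart[OF U(1)] U(2) by simp
  then have "smooth_at (f \<circ> inv_into V \<kappa>) ((\<kappa> \<circ> F \<circ> inv_into U \<phi>) (\<phi> p))"
    using f N.smooth_near_iff[OF V] by metis
  from smooth_at_compose[OF N.frame 1 this]
  have "smooth_at ((\<lambda>q. f (F q)) \<circ> inv_into U \<phi>) (\<phi> p)"
  proof (rule smooth_at_cong[OF o, rotated 2])
    show "\<phi> p \<in> \<phi> ` (U \<inter> F -` V)" using U V by blast
    show "(f \<circ> inv_into V \<kappa>) ((\<kappa> \<circ> F \<circ> inv_into U \<phi>) y) = ((\<lambda>q. f (F q)) \<circ> inv_into U \<phi>) y"
      if "y \<in> \<phi> ` (U \<inter> F -` V)" for y
      using that M.chart_inv_chart[OF U(1)] N.chart_inv_chart[OF V(1)] by auto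
  qed
  then show "smooth_near A p (\<lambda>q. f (F q))" using M.smooth_near_iff[OF U] by simp
qed

section \<open>Product manifolds\<close>

lemma inv_into_map_prod:
  assumes "inj_on \<phi> U" "inj_on \<kappa> V" "x \<in> \<phi> ` U" "y \<in> \<kappa> ` V"
  shows "inv_into (U \<times> V) (map_prod \<phi> \<kappa>) (x, y) = (inv_into U \<phi> x, inv_into V \<kappa> y)"
proof (rule inv_into_f_eq)
  show "inj_on (map_prod \<phi> \<kappa>) (U \<times> V)" using assms by (intro map_prod_inj_on)
qed (use assms in \<open>auto intro: inv_into_into f_inv_into_f\<close>)

locale two_manifolds = M: manifold A B + N: manifold A' B'
  for A :: "('a::topological_space, 'e::real_inner) chart set" and B :: "'e set"
    and A' :: "('b::topological_space, 'f::real_inner) chart set" and B' :: "'f set"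
begin

lemma prod_chart_inv:
  assumes "(U, \<phi>) \<in> A" "(V, \<kappa>) \<in> A'" "x \<in> \<phi> ` U" "y \<in> \<kappa> ` V"
  shows "inv_into (U \<times> V) (map_prod \<phi> \<kappa>) (x, y) = (inv_into U \<phi> x, inv_into V \<kappa> y)"
proof (rule inv_into_map_prod[OF _ _ assms(3,4)])
  show "inj_on \<phi> U" using M.chart_inv_chart[OF assms(1)] by (metis inj_on_inverseI)
  show "inj_on \<kappa> V" using N.chart_inv_chart[OF assms(2)] by (metis inj_on_inverseI)
qed

lemma is_chart_prod:
  assumes U: "(U, \<phi>) \<in> A" and V: "(V, \<kappa>) \<in> A'"
  shows "is_chart (U \<times> V, map_prod \<phi> \<kappa>)"
proof -
  have im: "map_prod \<phi> \<kappa> ` (U \<times> V) = \<phi> ` U \<times> \<kappa> ` V" by (simp add: map_prod_surj_on)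
  have "continuous_on (U \<times> V) (map_prod \<phi> \<kappa>)"
    unfolding map_prod_def split_def using M.chart_cont[OF U] N.chart_cont[OF V]
    by (auto intro!: continuous_on_Pair continuous_on_compose2[of U \<phi>] continuous_on_compose2[of V \<kappa>]
        continuous_on_fst continuous_on_snd continuous_on_id)
  moreover have "continuous_on (\<phi> ` U \<times> \<kappa> ` V) (\<lambda>z. (inv_into U \<phi> (fst z), inv_into V \<kappa> (snd z)))"
    using M.chart_inv_cont[OF U] N.chart_inv_cont[OF V]
    by (auto intro!: continuous_on_Pair continuous_on_compose2[of "\<phi> ` U" "inv_into U \<phi>"]
        continuous_on_compose2[of "\<kappa> ` V" "inv_into V \<kappa>"]
        continuous_on_fst continuous_on_snd continuous_on_id)
  then have "continuous_on (\<phi> ` U \<times> \<kappa> ` V) (inv_into (U \<times> V) (map_prod \<phi> \<kappa>))"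
    by (rule continuous_on_eq) (auto simp: prod_chart_inv[OF assms])
  moreover have "inj_on (map_prod \<phi> \<kappa>) (U \<times> V)"
    using M.chart_inv_chart[OF U] N.chart_inv_chart[OF V]
    by (intro map_prod_inj_on) (metis inj_on_inverseI)+
  then have inv: "inv_into (U \<times> V) (map_prod \<phi> \<kappa>) (map_prod \<phi> \<kappa> z) = z" if "z \<in> U \<times> V" for z
    using that by (rule inv_into_f_f)
  moreover have "inv_into (U \<times> V) (map_prod \<phi> \<kappa>) ` (\<phi> ` U \<times> \<kappa> ` V) = U \<times> V"
    unfolding im[symmetric] image_image using inv by simp
  moreover have "map_prod \<phi> \<kappa> (inv_into (U \<times> V) (map_prod \<phi> \<kappa>) z) = z" if "z \<in> \<phi> ` U \<times> \<kappa> ` V" for z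
    using that unfolding im[symmetric] by (rule f_inv_into_f)
  ultimately show ?thesis
    unfolding is_chart_def homeomorphism_def
    using M.open_chart_domain[OF U] N.open_chart_domain[OF V] M.open_chart_image[OF U] N.open_chart_image[OF V]
    by (auto simp: im open_Times prod_chart_inv[OF assms] M.chart_inv_chart[OF U] N.chart_inv_chart[OF V])
qed

lemma prod_chart_mem: "(U, \<phi>) \<in> A \<Longrightarrow> (V, \<kappa>) \<in> A' \<Longrightarrow> (U \<times> V, map_prod \<phi> \<kappa>) \<in> prod_atlas A A'"
  unfolding prod_atlas_def by blast

lemma atlas_prod: "atlas (prod_atlas A A')"
  unfolding atlas_def
proof (intro conjI)
  show "\<forall>c\<in>prod_atlas A A'. is_chart c" using is_chart_prod unfolding prod_atlas_def by blast
  show "(\<Union>c\<in>prod_atlas A A'. fst c) = UNIV"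
  proof -
    have "z \<in> (\<Union>c\<in>prod_atlas A A'. fst c)" for z
    proof -
      obtain U \<phi> where U: "(U, \<phi>) \<in> A" "fst z \<in> U" by (rule M.chart_at)
      obtain V \<kappa> where V: "(V, \<kappa>) \<in> A'" "snd z \<in> V" by (rule N.chart_at)
      show ?thesis using prod_chart_mem[OF U(1) V(1)] U(2) V(2) by (force simp: mem_Times_iff)
    qed
    then show ?thesis by blast
  qed
  have "smooth_on (map_prod \<phi> \<kappa> ` (U \<times> V \<inter> U' \<times> V')) (map_prod \<phi>' \<kappa>' \<circ> inv_into (U \<times> V) (map_prod \<phi> \<kappa>))"
    if U: "(U, \<phi>) \<in> A" "(U', \<phi>') \<in> A" and V: "(V, \<kappa>) \<in> A'" "(V', \<kappa>') \<in> A'" for U \<phi> V \<kappa> U' \<phi>' V' \<kappa>'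
  proof -
    have im: "map_prod \<phi> \<kappa> ` (U \<times> V \<inter> U' \<times> V') = \<phi> ` (U \<inter> U') \<times> \<kappa> ` (V \<inter> V')"
      by (simp add: Times_Int_Times map_prod_surj_on)
    have o: "open (\<phi> ` (U \<inter> U') \<times> \<kappa> ` (V \<inter> V'))"
      using U V M.open_chart_domain N.open_chart_domain
      by (intro open_Times M.open_image_chart N.open_image_chart)
    have "smooth_at (map_prod \<phi>' \<kappa>' \<circ> inv_into (U \<times> V) (map_prod \<phi> \<kappa>)) z"
      if z: "z \<in> \<phi> ` (U \<inter> U') \<times> \<kappa> ` (V \<inter> V')" for z
    proof -
      obtain p q where pq: "z = (\<phi> p, \<kappa> q)" "p \<in> U" "p \<in> U'" "q \<in> V" "q \<in> V'" using z by auto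
      have "smooth_at (\<lambda>z. (\<phi>' \<circ> inv_into U \<phi>) (fst z)) z"
        using pq M.chart_transition_smooth_at[OF U pq(2,3)]
        by (intro smooth_at_compose[OF M.frame smooth_at_linear[OF bounded_linear_fst]]) (auto simp: o_def)
      moreover have "smooth_at (\<lambda>z. (\<kappa>' \<circ> inv_into V \<kappa>) (snd z)) z"
        using pq N.chart_transition_smooth_at[OF V pq(4,5)]
        by (intro smooth_at_compose[OF N.frame smooth_at_linear[OF bounded_linear_snd]]) (auto simp: o_def)
      ultimately have "smooth_at (\<lambda>z. ((\<phi>' \<circ> inv_into U \<phi>) (fst z), (\<kappa>' \<circ> inv_into V \<kappa>) (snd z))) z"
        by (rule smooth_at_Pair)
      then show ?thesis
        by (rule smooth_at_cong[OF o z, rotated]) (auto simp: prod_chart_inv[OF U(1) V(1)])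
    qed
    then show ?thesis unfolding im smooth_on_iff_smooth_at[OF o] by blast
  qed
  then show "\<forall>(U, \<phi>)\<in>prod_atlas A A'. \<forall>(V, \<psi>)\<in>prod_atlas A A'. smooth_on (\<phi> ` (U \<inter> V)) (\<psi> \<circ> inv_into U \<phi>)"
    unfolding prod_atlas_def by blast
qed

sublocale P: manifold "prod_atlas A A'" "(\<lambda>b. (b, 0)) ` B \<union> (\<lambda>c. (0, c)) ` B'"
  by unfold_locales (auto intro: atlas_prod frame_prod M.frame N.frame)

lemma smooth_pull_Pair:
  assumes "manifold A'' B''" "smooth_pull A'' A F" "smooth_pull A'' A' H"
  shows "smooth_pull A'' (prod_atlas A A') (\<lambda>p. (F p, H p))"
  unfolding smooth_pull_def
proof (intro conjI allI impI)
  interpret L: manifold A'' B'' by fact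
  have cF: "continuous_on UNIV F" and cH: "continuous_on UNIV H"
    using assms by (auto simp: smooth_pull_def)
  then show "continuous_on UNIV (\<lambda>p. (F p, H p))" by (rule continuous_on_Pair)
  fix p f assume f: "smooth_near (prod_atlas A A') (F p, H p) f"
  obtain T \<tau> where T: "(T, \<tau>) \<in> A''" "p \<in> T" by (rule L.chart_at)
  obtain U \<phi> where U: "(U, \<phi>) \<in> A" "F p \<in> U" by (rule M.chart_at)
  obtain V \<kappa> where V: "(V, \<kappa>) \<in> A'" "H p \<in> V" by (rule N.chart_at)
  \<comment> \<open>\<open>smooth_pull\<close> speaks of real functions only, so the vector-valued
    chart expression of \<open>F\<close> is reassembled from its frame coordinates.\<close>
  have "smooth_at (\<lambda>x. \<Sum>b\<in>B. ((\<phi> (F (inv_into T \<tau> x))) \<bullet> b) *\<^sub>R b) (\<tau> p)"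
    using smooth_pull_near[OF assms(2) M.smooth_near_coord[OF U]] unfolding L.smooth_near_iff[OF T]
    by (intro smooth_at_sum smooth_at_linear_comp[OF bounded_linear_scaleR_left]) (simp add: o_def)
  then have 1: "smooth_at (\<lambda>x. \<phi> (F (inv_into T \<tau> x))) (\<tau> p)"
    by (simp only: frame_expand[OF M.frame])
  have "smooth_at (\<lambda>x. \<Sum>b\<in>B'. ((\<kappa> (H (inv_into T \<tau> x))) \<bullet> b) *\<^sub>R b) (\<tau> p)"
    using smooth_pull_near[OF assms(3) N.smooth_near_coord[OF V]] unfolding L.smooth_near_iff[OF T]
    by (intro smooth_at_sum smooth_at_linear_comp[OF bounded_linear_scaleR_left]) (simp add: o_def)
  then have 2: "smooth_at (\<lambda>x. \<kappa> (H (inv_into T \<tau> x))) (\<tau> p)"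
    by (simp only: frame_expand[OF N.frame])
  let ?i = "inv_into (U \<times> V) (map_prod \<phi> \<kappa>)"
  have "smooth_at (f \<circ> ?i) (map_prod \<phi> \<kappa> (F p, H p))"
    using f P.smooth_near_iff[OF prod_chart_mem[OF U(1) V(1)]] U V by auto
  then have "smooth_at (f \<circ> ?i) (\<phi> (F (inv_into T \<tau> (\<tau> p))), \<kappa> (H (inv_into T \<tau> (\<tau> p))))"
    by (simp add: L.chart_inv_chart[OF T])
  from smooth_at_compose[OF P.frame smooth_at_Pair[OF 1 2] this]
  have *: "smooth_at (\<lambda>x. (f \<circ> ?i) (\<phi> (F (inv_into T \<tau> x)), \<kappa> (H (inv_into T \<tau> x)))) (\<tau> p)" .
  have o: "open (\<tau> ` (T \<inter> (F -` U \<inter> H -` V)))"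
    using M.open_chart_domain[OF U(1)] N.open_chart_domain[OF V(1)] cF cH
    by (intro L.open_image_chart[OF T(1)] open_Int open_vimage)
  have "smooth_at ((\<lambda>q. f (F q, H q)) \<circ> inv_into T \<tau>) (\<tau> p)"
  proof (rule smooth_at_cong[OF o _ _ *])
    show "\<tau> p \<in> \<tau> ` (T \<inter> (F -` U \<inter> H -` V))" using T U V by blast
    fix y assume "y \<in> \<tau> ` (T \<inter> (F -` U \<inter> H -` V))"
    then obtain q where q: "y = \<tau> q" "q \<in> T" "F q \<in> U" "H q \<in> V" by blast
    then show "(f \<circ> ?i) (\<phi> (F (inv_into T \<tau> y)), \<kappa> (H (inv_into T \<tau> y))) = ((\<lambda>q. f (F q, H q)) \<circ> inv_into T \<tau>) y"
      by (simp add: L.chart_inv_chart[OF T(1)] prod_chart_inv[OF U(1) V(1)]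
          M.chart_inv_chart[OF U(1)] N.chart_inv_chart[OF V(1)])
  qed
  then show "smooth_near A'' p (\<lambda>q. f (F q, H q))" using L.smooth_near_iff[OF T] by simp
qed

lemma smooth_pull_fst: "smooth_pull (prod_atlas A A') A fst"
  unfolding smooth_pull_def
proof (intro conjI allI impI)
  show "continuous_on UNIV (fst :: 'a \<times> 'b \<Rightarrow> 'a)" by (rule continuous_on_fst[OF continuous_on_id])
  fix z :: "'a \<times> 'b" and f assume f: "smooth_near A (fst z) f"
  obtain U \<phi> where U: "(U, \<phi>) \<in> A" "fst z \<in> U" by (rule M.chart_at)
  obtain V \<kappa> where V: "(V, \<kappa>) \<in> A'" "snd z \<in> V" by (rule N.chart_at)
  let ?i = "inv_into (U \<times> V) (map_prod \<phi> \<kappa>)"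
  have z: "z \<in> U \<times> V" using U V by (simp add: mem_Times_iff)
  have "smooth_at (\<lambda>w. (f \<circ> inv_into U \<phi>) (fst w)) (map_prod \<phi> \<kappa> z)"
    using f M.smooth_near_iff[OF U]
    by (intro smooth_at_compose[OF M.frame smooth_at_linear[OF bounded_linear_fst]]) (auto simp: o_def)
  then have "smooth_at ((\<lambda>q. f (fst q)) \<circ> ?i) (map_prod \<phi> \<kappa> z)"
  proof (rule smooth_at_cong[OF open_Times[OF M.open_chart_image[OF U(1)] N.open_chart_image[OF V(1)]], rotated 2])
    show "map_prod \<phi> \<kappa> z \<in> \<phi> ` U \<times> \<kappa> ` V" using z by (cases z) auto
  qed (auto simp: prod_chart_inv[OF U(1) V(1)])
  then show "smooth_near (prod_atlas A A') z (\<lambda>q. f (fst q))"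
    using P.smooth_near_iff[OF prod_chart_mem[OF U(1) V(1)] z] by simp
qed

lemma smooth_pull_snd: "smooth_pull (prod_atlas A A') A' snd"
  unfolding smooth_pull_def
proof (intro conjI allI impI)
  show "continuous_on UNIV (snd :: 'a \<times> 'b \<Rightarrow> 'b)" by (rule continuous_on_snd[OF continuous_on_id])
  fix z :: "'a \<times> 'b" and f assume f: "smooth_near A' (snd z) f"
  obtain U \<phi> where U: "(U, \<phi>) \<in> A" "fst z \<in> U" by (rule M.chart_at)
  obtain V \<kappa> where V: "(V, \<kappa>) \<in> A'" "snd z \<in> V" by (rule N.chart_at)
  let ?i = "inv_into (U \<times> V) (map_prod \<phi> \<kappa>)"
  have z: "z \<in> U \<times> V" using U V by (simp add: mem_Times_iff)
  have "smooth_at (\<lambda>w. (f \<circ> inv_into V \<kappa>) (snd w)) (map_prod \<phi> \<kappa> z)"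
    using f N.smooth_near_iff[OF V]
    by (intro smooth_at_compose[OF N.frame smooth_at_linear[OF bounded_linear_snd]]) (auto simp: o_def)
  then have "smooth_at ((\<lambda>q. f (snd q)) \<circ> ?i) (map_prod \<phi> \<kappa> z)"
  proof (rule smooth_at_cong[OF open_Times[OF M.open_chart_image[OF U(1)] N.open_chart_image[OF V(1)]], rotated 2])
    show "map_prod \<phi> \<kappa> z \<in> \<phi> ` U \<times> \<kappa> ` V" using z by (cases z) auto
  qed (auto simp: prod_chart_inv[OF U(1) V(1)])
  then show "smooth_near (prod_atlas A A') z (\<lambda>q. f (snd q))"
    using P.smooth_near_iff[OF prod_chart_mem[OF U(1) V(1)] z] by simp
qed

end

section \<open>Tangent vectors\<close>

definition coord_vector ::
  "('a::topological_space, 'e::real_normed_vector) chart set \<Rightarrow> 'a set \<Rightarrow> ('a \<Rightarrow> 'e) \<Rightarrow> 'a \<Rightarrow> 'e \<Rightarrow> 'a tangent"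
  where
  "coord_vector A U \<phi> p v =
     (\<lambda>f. if smooth_near A p f then frechet_derivative (f \<circ> inv_into U \<phi>) (at (\<phi> p)) v else 0)"

lemma tangent_combine:
  "D \<in> tangent_space A p \<Longrightarrow> smooth_near A p f \<Longrightarrow> smooth_near A p h \<Longrightarrow>
    D (\<lambda>q. a * f q + b * h q) = a * D f + b * D h"
  by (simp add: tangent_space_def)

lemma tangent_mult:
  "D \<in> tangent_space A p \<Longrightarrow> smooth_near A p f \<Longrightarrow> smooth_near A p h \<Longrightarrow>
    D (\<lambda>q. f q * h q) = D f * h p + f p * D h"
  by (simp add: tangent_space_def)

lemma tangent_not_smooth: "D \<in> tangent_space A p \<Longrightarrow> \<not> smooth_near A p f \<Longrightarrow> D f = 0"
  by (simp add: tangent_space_def)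

lemma tangent_add:
  "D \<in> tangent_space A p \<Longrightarrow> smooth_near A p f \<Longrightarrow> smooth_near A p h \<Longrightarrow>
    D (\<lambda>q. f q + h q) = D f + D h"
  using tangent_combine[of D A p f h 1 1] by simp

lemma tangent_diff:
  "D \<in> tangent_space A p \<Longrightarrow> smooth_near A p f \<Longrightarrow> smooth_near A p h \<Longrightarrow>
    D (\<lambda>q. f q - h q) = D f - D h"
  using tangent_combine[of D A p f h 1 "-1"] by simp

lemma tangent_scale:
  "D \<in> tangent_space A p \<Longrightarrow> smooth_near A p f \<Longrightarrow> D (\<lambda>q. a * f q) = a * D f"
  using tangent_combine[of D A p f f a 0] by simp

lemma tangent_eqI:
  assumes "D \<in> tangent_space A p" "D' \<in> tangent_space A p" "\<And>f. smooth_near A p f \<Longrightarrow> D f = D' f"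
  shows "D = D'"
proof
  fix f show "D f = D' f"
    using assms(3)[of f] tangent_not_smooth[OF assms(1), of f] tangent_not_smooth[OF assms(2), of f]
    by (cases "smooth_near A p f") auto
qed

lemma subspace_tangent: "subspace (tangent_space A p)"
  by (rule subspaceI) (auto simp: tangent_space_def scaleR_fun_def algebra_simps)

lemma smooth_vector_field_mem:
  "smooth_vector_field_on A W X \<Longrightarrow> p \<in> W \<Longrightarrow> X p \<in> tangent_space A p"
  by (simp add: smooth_vector_field_on_def)

context manifold
begin

lemma tangent_const:
  assumes "D \<in> tangent_space A p"
  shows "D (\<lambda>q. c) = 0"
proof -
  have "D (\<lambda>q. 1 * 1) = D (\<lambda>q. 1) * 1 + 1 * D (\<lambda>q. 1)"
    by (rule tangent_mult[OF assms smooth_near_const smooth_near_const])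
  then have "D (\<lambda>q. 1) = 0" by simp
  moreover have "D (\<lambda>q. c * 1) = c * D (\<lambda>q. 1)"
    by (rule tangent_scale[OF assms smooth_near_const])
  ultimately show ?thesis by simp
qed

lemma tangent_sum:
  assumes "D \<in> tangent_space A p" "\<And>i. i \<in> I \<Longrightarrow> smooth_near A p (f i)"
  shows "D (\<lambda>q. \<Sum>i\<in>I. f i q) = (\<Sum>i\<in>I. D (f i))"
proof (cases "finite I")
  case True
  then show ?thesis
    using assms(2)
  proof (induction I)
    case empty
    then show ?case using tangent_const[OF assms(1)] by simp
  next
    case (insert i I)
    then show ?case
      by (simp add: tangent_add[OF assms(1)] smooth_near_sum)
  qed
next
  case False
  then show ?thesis using tangent_const[OF assms(1)] by simp
qed

text \<open>Cutting off with an indicator function, which is smooth near the point in question, shows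
  that a derivation is local; no bump functions are needed.\<close>

lemma tangent_local:
  assumes D: "D \<in> tangent_space A p" and f: "smooth_near A p f"
    and W: "open W" "p \<in> W" "\<And>q. q \<in> W \<Longrightarrow> f q = g q"
  shows "D f = D g"
proof -
  have g: "smooth_near A p g" using smooth_near_cong[OF W f] .
  define i :: "'a \<Rightarrow> real" where "i = (\<lambda>q. if q \<in> W then 1 else 0)"
  have i: "smooth_near A p i"
    by (rule smooth_near_cong[OF W(1,2) _ smooth_near_const[of p 1]]) (simp add: i_def)
  have "(\<lambda>q. (f q - g q) * i q) = (\<lambda>q. 0)" using W(3) by (auto simp: i_def)
  then have "D (\<lambda>q. (f q - g q) * i q) = 0" using tangent_const[OF D] by simp
  moreover have "D (\<lambda>q. (f q - g q) * i q) = D (\<lambda>q. f q - g q) * i p + (f p - g p) * D i"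
    by (rule tangent_mult[OF D smooth_near_diff[OF f g] i])
  ultimately show ?thesis
    using W by (simp add: i_def tangent_diff[OF D f g])
qed

lemma coord_deriv:
  assumes "(U, \<phi>) \<in> A" "p \<in> U" "smooth_near A p f"
  shows "((f \<circ> inv_into U \<phi>) has_derivative (\<lambda>v. coord_vector A U \<phi> p v f)) (at (\<phi> p))"
proof -
  have "smooth_at (f \<circ> inv_into U \<phi>) (\<phi> p)" using assms smooth_near_iff by blast
  from smooth_at_has_derivative[OF this] show ?thesis
    unfolding coord_vector_def using assms(3) by simp
qed

lemma coord_vector_eqI:
  assumes "(U, \<phi>) \<in> A" "p \<in> U" "smooth_near A p f"
    and "((f \<circ> inv_into U \<phi>) has_derivative f') (at (\<phi> p))"
  shows "coord_vector A U \<phi> p v f = f' v"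
  using has_derivative_unique[OF coord_deriv[OF assms(1,2,3)] assms(4)] by metis

lemma coord_vector_tangent:
  assumes U: "(U, \<phi>) \<in> A" "p \<in> U"
  shows "coord_vector A U \<phi> p v \<in> tangent_space A p"
  unfolding tangent_space_def
proof (intro CollectI conjI allI impI)
  fix f h :: "'a \<Rightarrow> real" and a b :: real
  assume fh: "smooth_near A p f \<and> smooth_near A p h"
  note D = coord_deriv[OF U conjunct1[OF fh]] coord_deriv[OF U conjunct2[OF fh]]
  have "((\<lambda>q. a * f q + b * h q) \<circ> inv_into U \<phi> has_derivative
    (\<lambda>v. a * coord_vector A U \<phi> p v f + b * coord_vector A U \<phi> p v h)) (at (\<phi> p))"
    using has_derivative_add[OF has_derivative_mult_right[OF D(1), of a] has_derivative_mult_right[OF D(2), of b]]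
    by (simp add: o_def)
  from coord_vector_eqI[OF U _ this] show "coord_vector A U \<phi> p v (\<lambda>q. a * f q + b * h q) =
    a * coord_vector A U \<phi> p v f + b * coord_vector A U \<phi> p v h"
    using smooth_near_add[OF smooth_near_scale smooth_near_scale] fh by blast
next
  fix f h :: "'a \<Rightarrow> real"
  assume fh: "smooth_near A p f \<and> smooth_near A p h"
  note D = coord_deriv[OF U conjunct1[OF fh]] coord_deriv[OF U conjunct2[OF fh]]
  have "((\<lambda>q. f q * h q) \<circ> inv_into U \<phi> has_derivative
    (\<lambda>v. (f \<circ> inv_into U \<phi>) (\<phi> p) * coord_vector A U \<phi> p v h +
      coord_vector A U \<phi> p v f * (h \<circ> inv_into U \<phi>) (\<phi> p))) (at (\<phi> p))"
    using has_derivative_mult[OF D] by (simp add: o_def)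
  from coord_vector_eqI[OF U _ this] have "coord_vector A U \<phi> p v (\<lambda>q. f q * h q) =
    (f \<circ> inv_into U \<phi>) (\<phi> p) * coord_vector A U \<phi> p v h +
      coord_vector A U \<phi> p v f * (h \<circ> inv_into U \<phi>) (\<phi> p)"
    using fh by (auto intro!: smooth_near_mult)
  then show "coord_vector A U \<phi> p v (\<lambda>q. f q * h q) =
    coord_vector A U \<phi> p v f * h p + f p * coord_vector A U \<phi> p v h"
    using chart_inv_chart[OF U] by simp
next
  fix f :: "'a \<Rightarrow> real" assume "\<not> smooth_near A p f"
  then show "coord_vector A U \<phi> p v f = 0" by (simp add: coord_vector_def)
qed

lemma linear_coord_vector:
  assumes U: "(U, \<phi>) \<in> A" "p \<in> U"
  shows "linear (coord_vector A U \<phi> p)"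
proof
  fix v w :: 'e and c :: real
  show "coord_vector A U \<phi> p (v + w) = coord_vector A U \<phi> p v + coord_vector A U \<phi> p w"
  proof
    fix f show "coord_vector A U \<phi> p (v + w) f = (coord_vector A U \<phi> p v + coord_vector A U \<phi> p w) f"
      using linear_add[OF has_derivative_linear[OF coord_deriv[OF U, of f]]]
      by (cases "smooth_near A p f") (auto simp: coord_vector_def)
  qed
  show "coord_vector A U \<phi> p (c *\<^sub>R v) = c *\<^sub>R coord_vector A U \<phi> p v"
  proof
    fix f show "coord_vector A U \<phi> p (c *\<^sub>R v) f = (c *\<^sub>R coord_vector A U \<phi> p v) f"
      using linear_scale[OF has_derivative_linear[OF coord_deriv[OF U, of f]]]
      by (cases "smooth_near A p f") (auto simp: coord_vector_def scaleR_fun_def)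
  qed
qed

lemma coord_vector_coord:
  assumes U: "(U, \<phi>) \<in> A" "p \<in> U"
  shows "coord_vector A U \<phi> p v (\<lambda>q. \<phi> q \<bullet> b) = v \<bullet> b"
proof (rule coord_vector_eqI[OF U smooth_near_coord[OF U]])
  have "((\<lambda>x. x \<bullet> b) has_derivative (\<lambda>v. v \<bullet> b)) (at (\<phi> p))"
    by (intro bounded_linear_imp_has_derivative bounded_linear_inner_left)
  then show "((\<lambda>q. \<phi> q \<bullet> b) \<circ> inv_into U \<phi> has_derivative (\<lambda>v. v \<bullet> b)) (at (\<phi> p))"
    by (rule has_derivative_transform_within_open[OF _ open_chart_image[OF U(1)]])
      (use U chart_chart_inv[OF U(1)] in auto)
qed

text \<open>Hadamard's lemma shows that a derivation is determined by its values on the coordinates.\<close>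

lemma tangent_eq_coord_vector:
  assumes U: "(U, \<phi>) \<in> A" "p \<in> U" and D: "D \<in> tangent_space A p"
  shows "D = coord_vector A U \<phi> p (\<Sum>b\<in>B. D (\<lambda>q. \<phi> q \<bullet> b) *\<^sub>R b)"
proof (rule tangent_eqI[OF D coord_vector_tangent[OF U]])
  fix f assume f: "smooth_near A p f"
  let ?c = "\<phi> p" and ?f = "f \<circ> inv_into U \<phi>"
  obtain S where S: "open S" "?c \<in> S" "smooth_on S ?f"
    using f smooth_near_iff[OF U] unfolding smooth_at_def by blast
  have "open (S \<inter> \<phi> ` U)" "?c \<in> S \<inter> \<phi> ` U"
    using S open_chart_image[OF U(1)] U(2) by auto
  then obtain r where r: "r > 0" "ball ?c r \<subseteq> S \<inter> \<phi> ` U" by (rule openE)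
  have "smooth_on (ball ?c r) ?f" using S(3) r(2) by (blast intro: smooth_on_subset)
  from hadamard[OF frame this] obtain g where
    g: "\<And>b. b \<in> B \<Longrightarrow> smooth_on (ball ?c r) (g b)" "\<And>b. b \<in> B \<Longrightarrow> g b ?c = frechet_derivative ?f (at ?c) b"
    and exp: "\<And>x. x \<in> ball ?c r \<Longrightarrow> ?f x = ?f ?c + (\<Sum>b\<in>B. ((x - ?c) \<bullet> b) * g b x)"
    by blast
  have c: "?c \<in> ball ?c r" using r(1) by simp
  have g_smooth: "smooth_near A p (\<lambda>q. g b (\<phi> q))" if b: "b \<in> B" for b
    unfolding smooth_near_iff[OF U]
  proof (rule smooth_at_cong[OF open_ball c])
    show "smooth_at (g b) ?c" using g(1)[OF b] c unfolding smooth_at_def by blast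
    show "g b y = ((\<lambda>q. g b (\<phi> q)) \<circ> inv_into U \<phi>) y" if "y \<in> ball ?c r" for y
      using that r(2) chart_chart_inv[OF U(1)] by auto
  qed
  have lin_smooth: "smooth_near A p (\<lambda>q. \<phi> q \<bullet> b - ?c \<bullet> b)" for b
    by (intro smooth_near_diff smooth_near_coord[OF U] smooth_near_const)
  let ?h = "\<lambda>q. f p + (\<Sum>b\<in>B. (\<phi> q \<bullet> b - ?c \<bullet> b) * g b (\<phi> q))"
  have s: "smooth_near A p (\<lambda>q. \<Sum>b\<in>B. (\<phi> q \<bullet> b - ?c \<bullet> b) * g b (\<phi> q))"
    by (intro smooth_near_sum smooth_near_mult lin_smooth g_smooth)
  have "D f = D ?h"
  proof (rule tangent_local[OF D f open_preimage_chart[OF U(1) open_ball[of ?c r]]])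
    show "p \<in> U \<inter> \<phi> -` ball ?c r" using U(2) c by simp
    show "f q = ?h q" if "q \<in> U \<inter> \<phi> -` ball ?c r" for q
      using exp[of "\<phi> q"] that chart_inv_chart[OF U(1)] U(2) by (simp add: inner_diff_left)
  qed
  also have "\<dots> = D (\<lambda>q. \<Sum>b\<in>B. (\<phi> q \<bullet> b - ?c \<bullet> b) * g b (\<phi> q))"
    using tangent_add[OF D smooth_near_const s] tangent_const[OF D] by simp
  also have "\<dots> = (\<Sum>b\<in>B. D (\<lambda>q. (\<phi> q \<bullet> b - ?c \<bullet> b) * g b (\<phi> q)))"
    by (intro tangent_sum[OF D] smooth_near_mult lin_smooth g_smooth)
  also have "\<dots> = (\<Sum>b\<in>B. D (\<lambda>q. \<phi> q \<bullet> b) * coord_vector A U \<phi> p b f)"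
  proof (rule sum.cong[OF refl])
    fix b assume b: "b \<in> B"
    have "D (\<lambda>q. (\<phi> q \<bullet> b - ?c \<bullet> b) * g b (\<phi> q)) = D (\<lambda>q. \<phi> q \<bullet> b - ?c \<bullet> b) * g b ?c"
      using tangent_mult[OF D lin_smooth g_smooth[OF b], of b] by simp
    also have "D (\<lambda>q. \<phi> q \<bullet> b - ?c \<bullet> b) = D (\<lambda>q. \<phi> q \<bullet> b)"
      by (simp add: tangent_diff[OF D smooth_near_coord[OF U] smooth_near_const] tangent_const[OF D])
    also have "g b ?c = coord_vector A U \<phi> p b f"
      using g(2)[OF b] f by (simp add: coord_vector_def)
    finally show "D (\<lambda>q. (\<phi> q \<bullet> b - ?c \<bullet> b) * g b (\<phi> q)) = D (\<lambda>q. \<phi> q \<bullet> b) * coord_vector A U \<phi> p b f" .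
  qed
  also have "\<dots> = coord_vector A U \<phi> p (\<Sum>b\<in>B. D (\<lambda>q. \<phi> q \<bullet> b) *\<^sub>R b) f"
    by (simp add: linear_sum[OF has_derivative_linear[OF coord_deriv[OF U f]]]
        linear_scale[OF has_derivative_linear[OF coord_deriv[OF U f]]])
  finally show "D f = coord_vector A U \<phi> p (\<Sum>b\<in>B. D (\<lambda>q. \<phi> q \<bullet> b) *\<^sub>R b) f" .
qed

lemma smooth_near_coord_vector:
  assumes U: "(U, \<phi>) \<in> A" "p \<in> U" and f: "smooth_near A p f"
  shows "smooth_near A p (\<lambda>q. coord_vector A U \<phi> q v f)"
proof -
  obtain W where W: "open W" "p \<in> W" "\<And>q. q \<in> W \<Longrightarrow> smooth_near A q f"
    by (rule smooth_near_nhd[OF f]) blast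
  have "smooth_at (\<lambda>x. frechet_derivative (f \<circ> inv_into U \<phi>) (at x) v) (\<phi> p)"
    using f smooth_near_iff[OF U] by (intro smooth_at_derivative) simp
  then have "smooth_at ((\<lambda>q. coord_vector A U \<phi> q v f) \<circ> inv_into U \<phi>) (\<phi> p)"
  proof (rule smooth_at_cong[OF open_image_chart[OF U(1) W(1)], rotated 2])
    show "\<phi> p \<in> \<phi> ` (U \<inter> W)" using U W by blast
    show "frechet_derivative (f \<circ> inv_into U \<phi>) (at y) v = ((\<lambda>q. coord_vector A U \<phi> q v f) \<circ> inv_into U \<phi>) y"
      if "y \<in> \<phi> ` (U \<inter> W)" for y
      using that W(3) chart_inv_chart[OF U(1)] by (auto simp: coord_vector_def)
  qed
  then show ?thesis using smooth_near_iff[OF U] by simp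
qed

text \<open>Symmetry of second derivatives, read in the chart. Applied to a product chart, it is the
  reason why derivations on the two factors commute.\<close>

lemma coord_vector_commute:
  assumes U: "(U, \<phi>) \<in> A" "p \<in> U" and f: "smooth_near A p f"
  shows "coord_vector A U \<phi> p u (\<lambda>q. coord_vector A U \<phi> q v f) =
    coord_vector A U \<phi> p v (\<lambda>q. coord_vector A U \<phi> q u f)"
proof -
  let ?f = "f \<circ> inv_into U \<phi>"
  have *: "coord_vector A U \<phi> p u (\<lambda>q. coord_vector A U \<phi> q v f) =
    frechet_derivative (\<lambda>x. frechet_derivative ?f (at x) v) (at (\<phi> p)) u" for u v
  proof -
    obtain W where W: "open W" "p \<in> W" "\<And>q. q \<in> W \<Longrightarrow> smooth_near A q f"
      by (rule smooth_near_nhd[OF f]) blast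
    have "frechet_derivative ((\<lambda>q. coord_vector A U \<phi> q v f) \<circ> inv_into U \<phi>) (at (\<phi> p)) =
      frechet_derivative (\<lambda>x. frechet_derivative ?f (at x) v) (at (\<phi> p))"
    proof (rule frechet_derivative_cong_open[OF open_image_chart[OF U(1) W(1)]])
      show "\<phi> p \<in> \<phi> ` (U \<inter> W)" using U W by blast
      show "((\<lambda>q. coord_vector A U \<phi> q v f) \<circ> inv_into U \<phi>) y = frechet_derivative ?f (at y) v"
        if "y \<in> \<phi> ` (U \<inter> W)" for y
        using that W(3) chart_inv_chart[OF U(1)] by (auto simp: coord_vector_def)
    qed
    then show ?thesis
      using smooth_near_coord_vector[OF U f] by (simp add: coord_vector_def[of A U \<phi> p u])
  qed
  have "smooth_at ?f (\<phi> p)" using f smooth_near_iff[OF U] by simp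
  then show ?thesis unfolding * by (rule smooth_at_second_derivative_symmetric)
qed

section \<open>Smooth vector fields and their bracket\<close>

lemma smooth_vector_field_near:
  assumes X: "smooth_vector_field_on A W X" and "open W" "p \<in> W" "smooth_near A p f"
  shows "smooth_near A p (\<lambda>q. X q f)"
proof -
  obtain V where V: "open V" "p \<in> V" "\<And>q. q \<in> V \<Longrightarrow> smooth_near A q f"
    by (rule smooth_near_nhd[OF assms(4)]) blast
  have o: "open (V \<inter> W)" using V assms by auto
  then have "smooth_fun_on A (V \<inter> W) f"
    using V by (subst smooth_fun_on_iff) auto
  then have "smooth_fun_on A (V \<inter> W) (\<lambda>q. X q f)"
    using X o unfolding smooth_vector_field_on_def by blast
  then show ?thesis using o V assms by (auto simp: smooth_fun_on_iff)
qed

lemma smooth_vector_fieldI: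
  assumes "open W" "\<And>p. p \<in> W \<Longrightarrow> X p \<in> tangent_space A p"
    and "\<And>p f. p \<in> W \<Longrightarrow> smooth_near A p f \<Longrightarrow> smooth_near A p (\<lambda>q. X q f)"
  shows "smooth_vector_field_on A W X"
  unfolding smooth_vector_field_on_def
  using assms smooth_fun_on_iff by (auto simp: subset_iff)

lemma vf_bracket_tangent:
  assumes X: "smooth_vector_field_on A UNIV X" and Y: "smooth_vector_field_on A UNIV Y"
  shows "vf_bracket A X Y p \<in> tangent_space A p"
proof -
  have T: "X q \<in> tangent_space A q" "Y q \<in> tangent_space A q" for q
    using X Y by (auto intro: smooth_vector_field_mem)
  have S: "smooth_near A q (\<lambda>q. X q f)" "smooth_near A q (\<lambda>q. Y q f)" if "smooth_near A q f" for q f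
    using smooth_vector_field_near[OF X open_UNIV] smooth_vector_field_near[OF Y open_UNIV] that by auto
  show ?thesis
    unfolding tangent_space_def
  proof (intro CollectI conjI allI impI)
    fix f h :: "'a \<Rightarrow> real" and a b :: real
    assume fh: "smooth_near A p f \<and> smooth_near A p h"
    then have f: "smooth_near A p f" and h: "smooth_near A p h" by auto
    have s: "smooth_near A p (\<lambda>q. a * f q + b * h q)"
      using fh by (intro smooth_near_add smooth_near_scale) auto
    obtain W where W: "open W" "p \<in> W" "\<And>q. q \<in> W \<Longrightarrow> smooth_near A q f"
      by (rule smooth_near_nhd[OF f]) blast
    obtain V where V: "open V" "p \<in> V" "\<And>q. q \<in> V \<Longrightarrow> smooth_near A q h"
      by (rule smooth_near_nhd[OF h]) blast
    have 1: "D (\<lambda>q. Z q (\<lambda>q. a * f q + b * h q)) = a * D (\<lambda>q. Z q f) + b * D (\<lambda>q. Z q h)"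
      if D: "D \<in> tangent_space A p" and Z: "\<And>q. Z q \<in> tangent_space A q"
        "\<And>f. smooth_near A p f \<Longrightarrow> smooth_near A p (\<lambda>q. Z q f)" for D Z
    proof -
      have "D (\<lambda>q. Z q (\<lambda>q. a * f q + b * h q)) = D (\<lambda>q. a * Z q f + b * Z q h)"
        using W V
        by (intro tangent_local[OF D Z(2)[OF s], of "W \<inter> V"]) (auto intro: tangent_combine[OF Z(1)])
      then show ?thesis using tangent_combine[OF D Z(2)[OF f] Z(2)[OF h]] by simp
    qed
    show "vf_bracket A X Y p (\<lambda>q. a * f q + b * h q) = a * vf_bracket A X Y p f + b * vf_bracket A X Y p h"
      using f h s 1[OF T(1)[of p] T(2) S(2)] 1[OF T(2)[of p] T(1) S(1)]
      by (simp add: vf_bracket_def algebra_simps)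
  next
    fix f h :: "'a \<Rightarrow> real"
    assume fh: "smooth_near A p f \<and> smooth_near A p h"
    then have f: "smooth_near A p f" and h: "smooth_near A p h" by auto
    have s: "smooth_near A p (\<lambda>q. f q * h q)"
      using fh by (intro smooth_near_mult) auto
    obtain W where W: "open W" "p \<in> W" "\<And>q. q \<in> W \<Longrightarrow> smooth_near A q f"
      by (rule smooth_near_nhd[OF f]) blast
    obtain V where V: "open V" "p \<in> V" "\<And>q. q \<in> V \<Longrightarrow> smooth_near A q h"
      by (rule smooth_near_nhd[OF h]) blast
    \<comment> \<open>The mixed terms \<open>Z p f * D h\<close> and \<open>D f * Z p h\<close> are
      symmetric in the two fields, so they cancel in the commutator. Locality of \<open>D\<close> is
      used because the Leibniz rule for \<open>Z q\<close> is available only where \<open>f\<close>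
      and \<open>h\<close> are smooth, that is, for \<open>q\<close> near \<open>p\<close>.\<close>
    have 1: "D (\<lambda>q. Z q (\<lambda>q. f q * h q)) =
      D (\<lambda>q. Z q f) * h p + Z p f * D h + (D f * Z p h + f p * D (\<lambda>q. Z q h))"
      if D: "D \<in> tangent_space A p" and Z: "\<And>q. Z q \<in> tangent_space A q"
        "\<And>f. smooth_near A p f \<Longrightarrow> smooth_near A p (\<lambda>q. Z q f)" for D Z
    proof -
      have "D (\<lambda>q. Z q (\<lambda>q. f q * h q)) = D (\<lambda>q. Z q f * h q + f q * Z q h)"
        using W V
        by (intro tangent_local[OF D Z(2)[OF s], of "W \<inter> V"]) (auto intro: tangent_mult[OF Z(1)])
      also have "\<dots> = D (\<lambda>q. Z q f * h q) + D (\<lambda>q. f q * Z q h)"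
        by (intro tangent_add[OF D] smooth_near_mult Z f h)
      finally show ?thesis
        using tangent_mult[OF D Z(2)[OF f] h] tangent_mult[OF D f Z(2)[OF h]] by simp
    qed
    show "vf_bracket A X Y p (\<lambda>q. f q * h q) = vf_bracket A X Y p f * h p + f p * vf_bracket A X Y p h"
      using f h s 1[OF T(1)[of p] T(2) S(2)] 1[OF T(2)[of p] T(1) S(1)]
      by (simp add: vf_bracket_def algebra_simps)
  next
    fix f :: "'a \<Rightarrow> real" assume "\<not> smooth_near A p f"
    then show "vf_bracket A X Y p f = 0" by (simp add: vf_bracket_def)
  qed
qed

lemma smooth_vf_bracket:
  assumes X: "smooth_vector_field_on A UNIV X" and Y: "smooth_vector_field_on A UNIV Y"
  shows "smooth_vector_field_on A UNIV (vf_bracket A X Y)"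
proof (rule smooth_vector_fieldI[OF open_UNIV])
  show "vf_bracket A X Y p \<in> tangent_space A p" for p by (rule vf_bracket_tangent[OF assms])
  fix p f assume f: "smooth_near A p f"
  have S: "smooth_near A q (\<lambda>q. X q f)" "smooth_near A q (\<lambda>q. Y q f)" if "smooth_near A q f" for q f
    using smooth_vector_field_near[OF X open_UNIV] smooth_vector_field_near[OF Y open_UNIV] that by auto
  obtain W where W: "open W" "p \<in> W" "\<And>q. q \<in> W \<Longrightarrow> smooth_near A q f"
    by (rule smooth_near_nhd[OF f]) blast
  have "smooth_near A p (\<lambda>q. X q (\<lambda>q. Y q f) - Y q (\<lambda>q. X q f))"
    by (intro smooth_near_diff S f)
  then show "smooth_near A p (\<lambda>q. vf_bracket A X Y q f)"
    by (rule smooth_near_cong[OF W(1,2), rotated]) (simp add: vf_bracket_def W(3))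
qed

end

section \<open>Differentials of maps\<close>

lemma differential_tangent:
  assumes "manifold A B" "manifold A' B'" "smooth_pull A A' F" "D \<in> tangent_space A p"
  shows "differential A' F p D \<in> tangent_space A' (F p)"
proof -
  interpret N: manifold A' B' by fact
  show ?thesis
    unfolding tangent_space_def differential_def
    using tangent_combine[OF assms(4)] tangent_mult[OF assms(4)] smooth_pull_near[OF assms(3)]
    by (auto simp: o_def N.smooth_near_add N.smooth_near_scale N.smooth_near_mult)
qed

lemma differential_near: "smooth_near A' (F p) f \<Longrightarrow> differential A' F p D f = D (\<lambda>q. f (F q))"
  by (simp add: differential_def o_def)

lemma differential_compose:
  assumes "smooth_pull A' A'' H"
  shows "differential A'' H (F p) (differential A' F p D) = differential A'' (\<lambda>q. H (F q)) p D"
  using smooth_pull_near[OF assms] by (auto simp: differential_def o_def fun_eq_iff)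

lemma differential_id: "D \<in> tangent_space A p \<Longrightarrow> differential A (\<lambda>q. q) p D = D"
  by (auto simp: differential_def o_def fun_eq_iff tangent_not_smooth)

lemma linear_differential: "linear (differential A' F p)"
  by (rule linearI) (auto simp: differential_def fun_eq_iff scaleR_fun_def)

section \<open>Partial derivatives on a product\<close>

context two_manifolds
begin

abbreviation (input) "PA \<equiv> prod_atlas A A'"

lemma smooth_near_slice:
  assumes "smooth_near PA (p, q) f"
  shows smooth_near_slice1: "smooth_near A p (\<lambda>p'. f (p', q))"
    and smooth_near_slice2: "smooth_near A' q (\<lambda>q'. f (p, q'))"
  using smooth_pull_near[OF smooth_pull_Pair[OF M.manifold_axioms smooth_pull_id smooth_pull_const[OF M.manifold_axioms, of _ q]], of p f]
    smooth_pull_near[OF smooth_pull_Pair[OF N.manifold_axioms smooth_pull_const[OF N.manifold_axioms, of _ p] smooth_pull_id], of q f]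
    assms by auto

lemma coord_vector_slice:
  assumes U: "(U, \<phi>) \<in> A" "p \<in> U" and V: "(V, \<kappa>) \<in> A'" "q \<in> V" and f: "smooth_near PA (p, q) f"
  shows coord_vector_slice1: "coord_vector A U \<phi> p v (\<lambda>p'. f (p', q)) =
      coord_vector PA (U \<times> V) (map_prod \<phi> \<kappa>) (p, q) (v, 0) f"
    and coord_vector_slice2: "coord_vector A' V \<kappa> q w (\<lambda>q'. f (p, q')) =
      coord_vector PA (U \<times> V) (map_prod \<phi> \<kappa>) (p, q) (0, w) f"
proof -
  let ?i = "inv_into (U \<times> V) (map_prod \<phi> \<kappa>)"
  have UV: "(U \<times> V, map_prod \<phi> \<kappa>) \<in> PA" "(p, q) \<in> U \<times> V"
    using prod_chart_mem U V by auto
  have D: "((f \<circ> ?i) has_derivative (\<lambda>v. coord_vector PA (U \<times> V) (map_prod \<phi> \<kappa>) (p, q) v f)) (at (\<phi> p, \<kappa> q))"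
    using P.coord_deriv[OF UV f] by simp
  have "((\<lambda>x. (x, \<kappa> q)) has_derivative (\<lambda>v. (v, 0))) (at (\<phi> p))"
    by (auto intro!: derivative_eq_intros)
  from has_derivative_compose[OF this D]
  have "((\<lambda>p'. f (p', q)) \<circ> inv_into U \<phi> has_derivative (\<lambda>v. coord_vector PA (U \<times> V) (map_prod \<phi> \<kappa>) (p, q) (v, 0) f)) (at (\<phi> p))"
    by (rule has_derivative_transform_within_open[OF _ M.open_chart_image[OF U(1)]])
      (use U V in \<open>auto simp: prod_chart_inv[OF U(1) V(1)] N.chart_inv_chart[OF V(1)]\<close>)
  then show "coord_vector A U \<phi> p v (\<lambda>p'. f (p', q)) =
      coord_vector PA (U \<times> V) (map_prod \<phi> \<kappa>) (p, q) (v, 0) f"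
    by (rule M.coord_vector_eqI[OF U smooth_near_slice1[OF f]])
  have "((\<lambda>y. (\<phi> p, y)) has_derivative (\<lambda>w. (0, w))) (at (\<kappa> q))"
    by (auto intro!: derivative_eq_intros)
  from has_derivative_compose[OF this D]
  have "((\<lambda>q'. f (p, q')) \<circ> inv_into V \<kappa> has_derivative (\<lambda>w. coord_vector PA (U \<times> V) (map_prod \<phi> \<kappa>) (p, q) (0, w) f)) (at (\<kappa> q))"
    by (rule has_derivative_transform_within_open[OF _ N.open_chart_image[OF V(1)]])
      (use U V in \<open>auto simp: prod_chart_inv[OF U(1) V(1)] M.chart_inv_chart[OF U(1)]\<close>)
  then show "coord_vector A' V \<kappa> q w (\<lambda>q'. f (p, q')) =
      coord_vector PA (U \<times> V) (map_prod \<phi> \<kappa>) (p, q) (0, w) f"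
    by (rule N.coord_vector_eqI[OF V smooth_near_slice2[OF f]])
qed

text \<open>Here smoothness is joint in both variables, so that the result can be restricted to the
  diagonal; this is how the smoothness of \<open>mc\<close> is obtained.\<close>

lemma smooth_near_coord_slice2:
  assumes V: "(V, \<kappa>) \<in> A'" "q \<in> V" and f: "smooth_near PA (p, q) f"
  shows "smooth_near PA (p, q) (\<lambda>z. coord_vector A' V \<kappa> (snd z) w (\<lambda>q'. f (fst z, q')))"
proof -
  obtain U \<phi> where U: "(U, \<phi>) \<in> A" "p \<in> U" by (rule M.chart_at)
  have UV: "(U \<times> V, map_prod \<phi> \<kappa>) \<in> PA" "(p, q) \<in> U \<times> V"
    using prod_chart_mem U V by auto
  obtain W where W: "open W" "(p, q) \<in> W" "\<And>z. z \<in> W \<Longrightarrow> smooth_near PA z f"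
    by (rule P.smooth_near_nhd[OF f]) blast
  have o: "open (W \<inter> U \<times> V)" "(p, q) \<in> W \<inter> U \<times> V"
    using W M.open_chart_domain[OF U(1)] N.open_chart_domain[OF V(1)] UV(2)
    by (auto intro!: open_Int open_Times)
  show ?thesis
  proof (rule P.smooth_near_cong[OF o _ P.smooth_near_coord_vector[OF UV f, of "(0, w)"]])
    fix z assume z: "z \<in> W \<inter> U \<times> V"
    then obtain a b where ab: "z = (a, b)" "a \<in> U" "b \<in> V" "(a, b) \<in> W" by auto
    show "coord_vector PA (U \<times> V) (map_prod \<phi> \<kappa>) z (0, w) f =
      coord_vector A' V \<kappa> (snd z) w (\<lambda>q'. f (fst z, q'))"
      using coord_vector_slice2[OF U(1) ab(2) V(1) ab(3) W(3)[OF ab(4)]] ab(1) by simp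
  qed
qed

text \<open>In a product chart the two derivations are the partial derivatives in directions
  \<open>(v, 0)\<close> and \<open>(0, w)\<close>. Smooth dependence on the parameter and
  commutation are then facts about coordinate vectors of one manifold.\<close>

lemma smooth_near_partial:
  assumes f: "smooth_near PA (p, q) f"
  shows smooth_near_partial1: "D \<in> tangent_space A p \<Longrightarrow> smooth_near A' q (\<lambda>q'. D (\<lambda>p'. f (p', q')))"
    and smooth_near_partial2: "D' \<in> tangent_space A' q \<Longrightarrow> smooth_near A p (\<lambda>p'. D' (\<lambda>q'. f (p', q')))"
    and tangent_commute: "D \<in> tangent_space A p \<Longrightarrow> D' \<in> tangent_space A' q \<Longrightarrow>
      D (\<lambda>p'. D' (\<lambda>q'. f (p', q'))) = D' (\<lambda>q'. D (\<lambda>p'. f (p', q')))"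
proof -
  obtain U \<phi> where U: "(U, \<phi>) \<in> A" "p \<in> U" by (rule M.chart_at)
  obtain V \<kappa> where V: "(V, \<kappa>) \<in> A'" "q \<in> V" by (rule N.chart_at)
  have UV: "(U \<times> V, map_prod \<phi> \<kappa>) \<in> PA" "(p, q) \<in> U \<times> V"
    using prod_chart_mem U V by auto
  let ?C = "coord_vector PA (U \<times> V) (map_prod \<phi> \<kappa>)"
  obtain W where W: "open W" "(p, q) \<in> W" "\<And>z. z \<in> W \<Longrightarrow> smooth_near PA z f"
    by (rule P.smooth_near_nhd[OF f]) blast
  have o1: "open ((\<lambda>p'. (p', q)) -` W)" and o2: "open ((\<lambda>q'. (p, q')) -` W)"
    using W(1) by (auto intro!: open_vimage continuous_on_Pair continuous_on_id continuous_on_const)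
  \<comment> \<open>The derivation stays at \<open>p\<close> while \<open>q'\<close> moves, so one
    direction \<open>v\<close> serves for all \<open>q'\<close> under consideration.\<close>
  have D: "\<exists>v. \<forall>q'. (p, q') \<in> W \<and> q' \<in> V \<longrightarrow> D (\<lambda>p'. f (p', q')) = ?C (p, q') (v, 0) f"
    if "D \<in> tangent_space A p" for D
  proof -
    obtain v where "D = coord_vector A U \<phi> p v" using M.tangent_eq_coord_vector[OF U \<open>D \<in> _\<close>] by blast
    then show ?thesis using coord_vector_slice1[OF U V(1) _ W(3)] by blast
  qed
  have D': "\<exists>v. \<forall>p'. (p', q) \<in> W \<and> p' \<in> U \<longrightarrow> D' (\<lambda>q'. f (p', q')) = ?C (p', q) (0, v) f"
    if "D' \<in> tangent_space A' q" for D'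
  proof -
    obtain v where "D' = coord_vector A' V \<kappa> q v" using N.tangent_eq_coord_vector[OF V \<open>D' \<in> _\<close>] by blast
    then show ?thesis using coord_vector_slice2[OF U(1) _ V W(3)] by blast
  qed
  have oU: "open ((\<lambda>p'. (p', q)) -` W \<inter> U)" "p \<in> (\<lambda>p'. (p', q)) -` W \<inter> U"
    using o1 M.open_chart_domain[OF U(1)] W(2) U(2) by auto
  have oV: "open ((\<lambda>q'. (p, q')) -` W \<inter> V)" "q \<in> (\<lambda>q'. (p, q')) -` W \<inter> V"
    using o2 N.open_chart_domain[OF V(1)] W(2) V(2) by auto
  have s: "smooth_near PA (p, q) (\<lambda>z. ?C z v f)" for v
    by (rule P.smooth_near_coord_vector[OF UV f])
  show s1: "smooth_near A' q (\<lambda>q'. D (\<lambda>p'. f (p', q')))" if "D \<in> tangent_space A p" for D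
  proof -
    obtain v where "\<And>q'. (p, q') \<in> W \<Longrightarrow> q' \<in> V \<Longrightarrow> D (\<lambda>p'. f (p', q')) = ?C (p, q') (v, 0) f"
      using D[OF \<open>D \<in> _\<close>] by blast
    then show ?thesis
      by (intro N.smooth_near_cong[OF oV _ smooth_near_slice2[OF s[of "(v, 0)"]]]) auto
  qed
  show s2: "smooth_near A p (\<lambda>p'. D' (\<lambda>q'. f (p', q')))" if "D' \<in> tangent_space A' q" for D'
  proof -
    obtain v where "\<And>p'. (p', q) \<in> W \<Longrightarrow> p' \<in> U \<Longrightarrow> D' (\<lambda>q'. f (p', q')) = ?C (p', q) (0, v) f"
      using D'[OF \<open>D' \<in> _\<close>] by blast
    then show ?thesis
      by (intro M.smooth_near_cong[OF oU _ smooth_near_slice1[OF s[of "(0, v)"]]]) auto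
  qed
  assume DT: "D \<in> tangent_space A p" and DT': "D' \<in> tangent_space A' q"
  obtain v where v: "D = coord_vector A U \<phi> p v" using M.tangent_eq_coord_vector[OF U DT] by blast
  obtain w where w: "D' = coord_vector A' V \<kappa> q w" using N.tangent_eq_coord_vector[OF V DT'] by blast
  have "D (\<lambda>p'. D' (\<lambda>q'. f (p', q'))) = D (\<lambda>p'. ?C (p', q) (0, w) f)"
    using W(3) w
    by (intro M.tangent_local[OF DT s2[OF DT'] oU]) (auto simp: coord_vector_slice2[OF U(1) _ V])
  also have "\<dots> = ?C (p, q) (v, 0) (\<lambda>z. ?C z (0, w) f)"
    unfolding v by (rule coord_vector_slice1[OF U V s])
  also have "\<dots> = ?C (p, q) (0, w) (\<lambda>z. ?C z (v, 0) f)"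
    by (rule P.coord_vector_commute[OF UV f])
  also have "\<dots> = D' (\<lambda>q'. ?C (p, q') (v, 0) f)"
    unfolding w by (rule coord_vector_slice2[OF U V s, symmetric])
  also have "\<dots> = D' (\<lambda>q'. D (\<lambda>p'. f (p', q')))"
    using W(3) v
    by (intro N.tangent_local[OF DT' s1[OF DT] oV, symmetric]) (auto simp: coord_vector_slice1[OF U V(1)])
  finally show "D (\<lambda>p'. D' (\<lambda>q'. f (p', q'))) = D' (\<lambda>q'. D (\<lambda>p'. f (p', q')))" .
qed

end

section \<open>Left invariant fields and the adjoint representation\<close>

text \<open>For related fields, \<open>Y\<close> applied to \<open>f \<circ> F\<close> is
  \<open>Y' f\<close> composed with \<open>F\<close>, so iterated derivatives correspond. With left
  translations this closes the left invariant fields under the bracket; with conjugations it makes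
  the adjoint action a Lie algebra automorphism.\<close>

lemma (in manifold) vf_bracket_related:
  assumes F: "smooth_pull A A F"
    and X: "smooth_vector_field_on A UNIV X" "smooth_vector_field_on A UNIV X'"
      "\<And>p. differential A F p (X p) = X' (F p)"
    and Y: "smooth_vector_field_on A UNIV Y" "smooth_vector_field_on A UNIV Y'"
      "\<And>p. differential A F p (Y p) = Y' (F p)"
  shows "differential A F p (vf_bracket A X Y p) = vf_bracket A X' Y' (F p)"
proof (rule tangent_eqI)
  show "differential A F p (vf_bracket A X Y p) \<in> tangent_space A (F p)"
    by (rule differential_tangent[OF manifold_axioms manifold_axioms F vf_bracket_tangent[OF X(1) Y(1)]])
  show "vf_bracket A X' Y' (F p) \<in> tangent_space A (F p)"
    by (rule vf_bracket_tangent[OF X(2) Y(2)])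
  fix f assume f: "smooth_near A (F p) f"
  have fF: "smooth_near A p (\<lambda>q. f (F q))" by (rule smooth_pull_near[OF F f])
  obtain W where W: "open W" "F p \<in> W" "\<And>q. q \<in> W \<Longrightarrow> smooth_near A q f"
    by (rule smooth_near_nhd[OF f]) blast
  have FW: "open (F -` W)" "p \<in> F -` W"
    using F W by (auto simp: smooth_pull_def open_vimage)
  have *: "Z p (\<lambda>q. Y q (\<lambda>q. f (F q))) = Z' (F p) (\<lambda>q. Y' q f)"
    if Z: "smooth_vector_field_on A UNIV Z" "\<And>p. differential A F p (Z p) = Z' (F p)"
      and Y: "smooth_vector_field_on A UNIV Y" "smooth_vector_field_on A UNIV Y'"
        "\<And>p. differential A F p (Y p) = Y' (F p)" for Z Z' Y Y'
  proof -
    have "Z p (\<lambda>q. Y q (\<lambda>q. f (F q))) = Z p (\<lambda>q. Y' (F q) f)"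
    proof (rule tangent_local[OF _ smooth_vector_field_near[OF Y(1) open_UNIV UNIV_I fF] FW])
      show "Z p \<in> tangent_space A p" using Z(1) by (auto intro: smooth_vector_field_mem)
      show "Y q (\<lambda>q. f (F q)) = Y' (F q) f" if "q \<in> F -` W" for q
        using that W(3)[of "F q"] by (simp add: Y(3)[symmetric] differential_near)
    qed
    also have "\<dots> = Z' (F p) (\<lambda>q. Y' q f)"
      using smooth_vector_field_near[OF Y(2) open_UNIV UNIV_I f]
      by (simp add: Z(2)[symmetric] differential_near)
    finally show ?thesis .
  qed
  show "differential A F p (vf_bracket A X Y p) f = vf_bracket A X' Y' (F p) f"
    using *[OF X(1,3) Y] *[OF Y(1,3) X] f fF
    by (simp add: differential_near vf_bracket_def)
qed

section \<open>Left invariant fields on a Lie group\<close>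

locale lie_group_chart = lie_group G A
  for G :: "('g::{t2_space, second_countable_topology}, 'm) monoid_scheme" (structure)
    and A :: "('g, 'e::real_inner) chart set" +
  fixes B :: "'e set" and U :: "'g set" and \<phi> :: "'g \<Rightarrow> 'e"
  assumes frame: "frame B" and chart_one: "(U, \<phi>) \<in> A" "\<one> \<in> U"
begin

sublocale manifold A B
  by unfold_locales (rule atlas, rule frame)

lemma two: "two_manifolds A B A B"
  by unfold_locales

lemma mem_G [simp]: "x \<in> carrier G"
  by (simp add: carrier_UNIV)

lemma smooth_pull_mult:
  assumes "manifold A' B'" "smooth_pull A' A F" "smooth_pull A' A H"
  shows "smooth_pull A' A (\<lambda>p. F p \<otimes> H p)"
proof -
  interpret two_manifolds A B A B by (rule two)
  have "smooth_pull (prod_atlas A A) A (\<lambda>(x, y). x \<otimes> y)"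
    by (rule smooth_map_imp_smooth_pull[OF P.manifold_axioms manifold_axioms smooth_mult])
  from smooth_pull_compose[OF smooth_pull_Pair[OF assms] this] show ?thesis by simp
qed

lemma smooth_pull_inv: "smooth_pull A A (\<lambda>x. inv x)"
  by (rule smooth_map_imp_smooth_pull[OF manifold_axioms manifold_axioms smooth_inv])

abbreviation "AA \<equiv> prod_atlas A A"

lemma manifold_AA: "manifold AA ((\<lambda>b. (b, 0)) ` B \<union> (\<lambda>c. (0, c)) ` B)"
  using two_manifolds.atlas_prod[OF two] frame_prod[OF frame frame] by unfold_locales

lemma smooth_pull_fst_AA: "smooth_pull AA A fst" and smooth_pull_snd_AA: "smooth_pull AA A snd"
  by (rule two_manifolds.smooth_pull_fst[OF two], rule two_manifolds.smooth_pull_snd[OF two])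

lemma smooth_pull_left: "smooth_pull A A (\<lambda>q. g \<otimes> q)"
  by (intro smooth_pull_mult[OF manifold_axioms] smooth_pull_id smooth_pull_const[OF manifold_axioms])

lemma smooth_pull_right: "smooth_pull A A (\<lambda>q. q \<otimes> g)"
  by (intro smooth_pull_mult[OF manifold_axioms] smooth_pull_id smooth_pull_const[OF manifold_axioms])

lemma smooth_pull_conj: "smooth_pull A A (\<lambda>q. g \<otimes> q \<otimes> inv g)"
  by (rule smooth_pull_compose[OF smooth_pull_left smooth_pull_right])

lemma smooth_near_mult_AA:
  assumes "smooth_near A (p \<otimes> q) f"
  shows "smooth_near AA (p, q) (\<lambda>z. f (fst z \<otimes> snd z))"
  using smooth_pull_near[OF smooth_pull_mult[OF manifold_AA smooth_pull_fst_AA smooth_pull_snd_AA], of "(p, q)" f] assms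
  by simp

lemma mult_one_eta: "(\<otimes>) \<one> = (\<lambda>q. q)"
  by (rule ext) simp

definition left_field :: "'g tangent \<Rightarrow> 'g vector_field" where
  "left_field u = (\<lambda>g. differential A (\<lambda>q. g \<otimes> q) \<one> u)"

lemma left_field_apply: "smooth_near A g f \<Longrightarrow> left_field u g f = u (\<lambda>q. f (g \<otimes> q))"
  by (simp add: left_field_def differential_near)

lemma left_field_tangent: "u \<in> tangent_space A \<one> \<Longrightarrow> left_field u g \<in> tangent_space A g"
  using differential_tangent[OF manifold_axioms manifold_axioms smooth_pull_left, of u \<one> g]
  by (simp add: left_field_def)

lemma left_field_one: "u \<in> tangent_space A \<one> \<Longrightarrow> left_field u \<one> = u"
  using differential_id[of u A \<one>] by (simp add: left_field_def mult_one_eta)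

text \<open>Differentiating the jointly smooth function \<open>f (x \<otimes> q)\<close> in
  \<open>q\<close> at \<open>\<one>\<close> leaves a smooth function of \<open>x\<close>.\<close>

lemma smooth_left_field:
  assumes u: "u \<in> tangent_space A \<one>"
  shows "smooth_vector_field_on A UNIV (left_field u)"
proof (rule smooth_vector_fieldI[OF open_UNIV left_field_tangent[OF u]])
  fix p f assume f: "smooth_near A p f"
  obtain W where W: "open W" "p \<in> W" "\<And>q. q \<in> W \<Longrightarrow> smooth_near A q f"
    by (rule smooth_near_nhd[OF f]) blast
  have "smooth_near AA (p, \<one>) (\<lambda>z. f (fst z \<otimes> snd z))"
    by (rule smooth_near_mult_AA) (simp add: f)
  from two_manifolds.smooth_near_partial2[OF two this u]
  have "smooth_near A p (\<lambda>x. u (\<lambda>q. f (x \<otimes> q)))" by simp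
  then show "smooth_near A p (\<lambda>q. left_field u q f)"
    by (rule smooth_near_cong[OF W(1,2), rotated]) (simp add: left_field_apply W(3))
qed

lemma differential_left_field:
  "differential A (\<lambda>q. g \<otimes> q) p (left_field u p) = left_field u (g \<otimes> p)"
  using differential_compose[OF smooth_pull_left, of g "\<lambda>q. p \<otimes> q" \<one> u]
  by (simp add: left_field_def m_assoc[symmetric])

abbreviation "LF \<equiv> left_invariant_fields G A"

lemma left_field_mem: "u \<in> tangent_space A \<one> \<Longrightarrow> left_field u \<in> LF"
  using smooth_left_field differential_left_field
  by (simp add: left_invariant_fields_def left_translation_def)

lemma LF_smooth: "X \<in> LF \<Longrightarrow> smooth_vector_field_on A UNIV X"
  by (simp add: left_invariant_fields_def)

lemma LF_invariant: "X \<in> LF \<Longrightarrow> differential A (\<lambda>q. g \<otimes> q) p (X p) = X (g \<otimes> p)"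
  by (simp add: left_invariant_fields_def left_translation_def)

lemma LF_tangent: "X \<in> LF \<Longrightarrow> X p \<in> tangent_space A p"
  using LF_smooth smooth_vector_field_mem by blast

lemma left_field_eval: "X \<in> LF \<Longrightarrow> left_field (X \<one>) = X"
  using LF_invariant[of X _ \<one>] by (simp add: left_field_def fun_eq_iff)

lemma LF_bracket:
  assumes "X \<in> LF" "Y \<in> LF"
  shows "vf_bracket A X Y \<in> LF"
  using smooth_vf_bracket[OF assms[THEN LF_smooth]]
    vf_bracket_related[OF smooth_pull_left LF_smooth LF_smooth LF_invariant LF_smooth LF_smooth LF_invariant,
      OF assms(1,1,1,2,2,2)]
  by (simp add: left_invariant_fields_def left_translation_def)

lemma linear_left_field: "linear left_field"
proof (rule linearI; rule ext)
  show "left_field (u + v) g = (left_field u + left_field v) g" for u v g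
    by (simp add: left_field_def linear_add[OF linear_differential])
  show "left_field (r *\<^sub>R u) g = (r *\<^sub>R left_field u) g" for r u g
    by (simp add: left_field_def linear_scale[OF linear_differential]
        scaleR_fun_def[where 'a='g and 'b="'g tangent"])
qed

section \<open>The Lie algebra and the adjoint representation in coordinates\<close>

definition vec :: "'e \<Rightarrow> 'g tangent" where "vec v = coord_vector A U \<phi> \<one> v"

definition coords :: "'g tangent \<Rightarrow> 'e" where "coords u = (\<Sum>b\<in>B. u (\<lambda>q. \<phi> q \<bullet> b) *\<^sub>R b)"

definition field :: "'e \<Rightarrow> 'g vector_field" where "field v = left_field (vec v)"

definition Ad :: "'g \<Rightarrow> 'g tangent \<Rightarrow> 'g tangent" where
  "Ad g = differential A (\<lambda>q. g \<otimes> q \<otimes> inv g) \<one>"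

definition rho :: "'g \<Rightarrow> 'e \<Rightarrow> 'e" where "rho g v = coords (Ad g (vec v))"

definition brk :: "'e \<Rightarrow> 'e \<Rightarrow> 'e" where "brk v w = coords (vf_bracket A (field v) (field w) \<one>)"

lemma vec_tangent: "vec v \<in> tangent_space A \<one>"
  unfolding vec_def by (rule coord_vector_tangent[OF chart_one])

lemma linear_vec: "linear vec"
  using linear_coord_vector[OF chart_one] by (simp add: vec_def[abs_def])

lemma vec_coords: "u \<in> tangent_space A \<one> \<Longrightarrow> vec (coords u) = u"
  unfolding vec_def coords_def by (rule tangent_eq_coord_vector[OF chart_one, symmetric])

lemma vec_coord: "vec v (\<lambda>q. \<phi> q \<bullet> c) = v \<bullet> c"
  unfolding vec_def by (rule coord_vector_coord[OF chart_one])

lemma coords_vec: "coords (vec v) = v"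
  by (simp add: coords_def vec_coord frame_expand[OF frame])

lemma linear_coords: "linear coords"
  by (rule linearI)
    (simp_all add: coords_def scaleR_fun_def scaleR_add_left sum.distrib scaleR_sum_right)

lemma field_mem: "field v \<in> LF"
  unfolding field_def by (rule left_field_mem[OF vec_tangent])

lemma field_one: "field v \<one> = vec v"
  unfolding field_def by (rule left_field_one[OF vec_tangent])

lemma field_coords: "X \<in> LF \<Longrightarrow> field (coords (X \<one>)) = X"
  unfolding field_def by (simp add: vec_coords LF_tangent left_field_eval)

lemma linear_field: "linear field"
  using linear_compose[OF linear_vec linear_left_field] by (simp add: field_def[abs_def] o_def)

lemma inj_field: "inj field"
  by (rule inj_on_inverseI[of _ "\<lambda>X. coords (X \<one>)"]) (simp add: field_one coords_vec)

lemma range_field: "range field = LF"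
  using field_mem field_coords by (auto simp: image_iff) metis

lemma field_brk: "field (brk v w) = vf_bracket A (field v) (field w)"
  unfolding brk_def by (rule field_coords[OF LF_bracket[OF field_mem field_mem]])

lemma vec_brk: "vec (brk v w) = vf_bracket A (field v) (field w) \<one>"
  using field_brk[of v w] field_one by metis

lemma brk_antisym: "brk v w = - brk w v"
proof -
  have "vf_bracket A X Y p = - vf_bracket A Y X p" for X Y p
    by (auto simp: vf_bracket_def fun_eq_iff)
  then show ?thesis
    unfolding brk_def by (metis linear_neg[OF linear_coords])
qed

lemma Ad_tangent: "u \<in> tangent_space A \<one> \<Longrightarrow> Ad g u \<in> tangent_space A \<one>"
  using differential_tangent[OF manifold_axioms manifold_axioms smooth_pull_conj, of u \<one> g]
  by (simp add: Ad_def)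

lemma Ad_apply: "smooth_near A \<one> f \<Longrightarrow> Ad g u f = u (\<lambda>q. f (g \<otimes> q \<otimes> inv g))"
  using differential_near[of A "\<lambda>q. g \<otimes> q \<otimes> inv g" \<one> f u] by (simp add: Ad_def)

lemma Ad_mult: "Ad (g \<otimes> h) u = Ad g (Ad h u)"
  using differential_compose[OF smooth_pull_conj, of g "\<lambda>q. h \<otimes> q \<otimes> inv h" \<one> u]
  by (simp add: Ad_def m_assoc inv_mult_group)

lemma vec_rho: "vec (rho g v) = Ad g (vec v)"
  unfolding rho_def by (rule vec_coords[OF Ad_tangent[OF vec_tangent]])

lemma linear_rho: "linear (rho g)"
  using linear_compose[OF linear_compose[OF linear_vec linear_differential] linear_coords]
  by (simp add: rho_def[abs_def] Ad_def o_def)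

lemma rho_one: "rho \<one> v = v"
  using differential_id[OF vec_tangent] by (simp add: rho_def Ad_def coords_vec)

lemma rho_mult: "rho (g \<otimes> h) v = rho g (rho h v)"
  unfolding rho_def[of "g \<otimes> h"] Ad_mult unfolding rho_def[of g] vec_rho ..

text \<open>Conjugation is a homomorphism: both sides are the differential at \<open>\<one>\<close>
  of the map \<open>\<lambda>q. g \<otimes> (p \<otimes> q) \<otimes> inv g\<close>. Thus the left
  invariant fields of \<open>u\<close> and \<open>Ad g u\<close> are related by conjugation.\<close>

lemma differential_conj_left_field:
  "differential A (\<lambda>q. g \<otimes> q \<otimes> inv g) p (left_field u p) = left_field (Ad g u) (g \<otimes> p \<otimes> inv g)"
proof -
  have "differential A (\<lambda>q. g \<otimes> q \<otimes> inv g) p (left_field u p) = differential A (\<lambda>q. g \<otimes> (p \<otimes> q) \<otimes> inv g) \<one> u"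
    using differential_compose[OF smooth_pull_conj, of g "\<lambda>q. p \<otimes> q" \<one> u] by (simp add: left_field_def)
  moreover have "left_field (Ad g u) (g \<otimes> p \<otimes> inv g) =
    differential A (\<lambda>q. (g \<otimes> p \<otimes> inv g) \<otimes> (g \<otimes> q \<otimes> inv g)) \<one> u"
    using differential_compose[OF smooth_pull_left, of "g \<otimes> p \<otimes> inv g" "\<lambda>q. g \<otimes> q \<otimes> inv g" \<one> u]
    by (simp add: left_field_def Ad_def)
  moreover have "(g \<otimes> p \<otimes> inv g) \<otimes> (g \<otimes> q \<otimes> inv g) = g \<otimes> (p \<otimes> q) \<otimes> inv g" for q
    by (metis (no_types, opaque_lifting) inv_closed inv_solve_left m_assoc m_closed mem_G)
  ultimately show ?thesis by simp
qed

lemma rho_brk: "rho g (brk v w) = brk (rho g v) (rho g w)"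
proof -
  note S = smooth_left_field[OF vec_tangent]
  have "differential A (\<lambda>q. g \<otimes> q \<otimes> inv g) \<one> (vf_bracket A (field v) (field w) \<one>) =
    vf_bracket A (field (rho g v)) (field (rho g w)) (g \<otimes> \<one> \<otimes> inv g)"
    unfolding field_def
    by (intro vf_bracket_related[OF smooth_pull_conj S S _ S S])
      (simp_all add: differential_conj_left_field vec_rho)
  then show ?thesis
    by (simp add: rho_def[of g "brk v w"] vec_brk Ad_def brk_def[of "rho g v"])
qed

section \<open>The derivative of the adjoint representation\<close>

lemma smooth_near_coord_one: "smooth_near A \<one> (\<lambda>q. \<phi> q \<bullet> c)"
  by (rule smooth_near_coord[OF chart_one])

lemma rho_inner: "rho x v \<bullet> c = vec v (\<lambda>q. \<phi> (x \<otimes> q \<otimes> inv x) \<bullet> c)"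
  using vec_coord[of "rho x v" c] by (simp add: vec_rho Ad_apply smooth_near_coord_one)

lemma smooth_rho: "smooth_near A x (\<lambda>x. rho x v \<bullet> c)"
proof -
  have "smooth_pull AA A (\<lambda>z. fst z \<otimes> snd z \<otimes> inv (fst z))"
    by (intro smooth_pull_mult[OF manifold_AA] smooth_pull_fst_AA smooth_pull_snd_AA
        smooth_pull_compose[OF smooth_pull_fst_AA smooth_pull_inv])
  from smooth_pull_near[OF this, of "(x, \<one>)" "\<lambda>q. \<phi> q \<bullet> c"]
  have "smooth_near AA (x, \<one>) (\<lambda>z. \<phi> (fst z \<otimes> snd z \<otimes> inv (fst z)) \<bullet> c)"
    by (simp add: smooth_near_coord_one)
  from two_manifolds.smooth_near_partial2[OF two this vec_tangent]
  show ?thesis by (simp add: rho_inner)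
qed

lemma vec_scale_right: "smooth_near A \<one> f \<Longrightarrow> vec v (\<lambda>q. f q * a) = vec v f * a"
  using tangent_scale[OF vec_tangent, of f v a] by (simp add: mult.commute)

lemma linear_vec_apply: "linear (\<lambda>v. vec v f)"
  using linear_add[OF linear_vec] linear_scale[OF linear_vec]
  by (intro linearI) (auto simp: scaleR_fun_def)

text \<open>Since \<open>x \<otimes> q = (x \<otimes> q \<otimes> inv x) \<otimes> x\<close>, the left invariant field \<open>field v\<close> at \<open>x\<close> is the right
  invariant field of \<open>rho x v\<close> at \<open>x\<close>.\<close>

lemma field_apply_right:
  assumes "smooth_near A x f"
  shows "field v x f = vec (rho x v) (\<lambda>z. f (z \<otimes> x))"
proof -
  have "smooth_near A \<one> (\<lambda>z. f (z \<otimes> x))"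
    using smooth_pull_near[OF smooth_pull_right, of \<one> x f] assms by simp
  then have "vec (rho x v) (\<lambda>z. f (z \<otimes> x)) = vec v (\<lambda>q. f (x \<otimes> q \<otimes> inv x \<otimes> x))"
    by (simp add: vec_rho Ad_apply)
  then show ?thesis
    using assms by (simp add: m_assoc field_def left_field_apply)
qed

text \<open>Left and right invariant fields commute, so that the derivative of \<open>rho\<close> is all that
  remains of the bracket when \<open>field v\<close> is expanded as in \<open>field_apply_right\<close>.\<close>

lemma derivative_rho_one: "vec w (\<lambda>x. rho x v \<bullet> c) = brk w v \<bullet> c"
proof -
  define h where "h = (\<lambda>q. \<phi> q \<bullet> c)"
  have h: "smooth_near A \<one> h" unfolding h_def by (rule smooth_near_coord_one)
  obtain W where W: "open W" "\<one> \<in> W" "\<And>q. q \<in> W \<Longrightarrow> smooth_near A q h"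
    by (rule smooth_near_nhd[OF h]) blast
  have hh: "smooth_near AA (\<one>, \<one>) (\<lambda>z. h (fst z \<otimes> snd z))"
    by (rule smooth_near_mult_AA) (simp add: h)
  have s: "smooth_near A \<one> (\<lambda>x. vec b (\<lambda>z. h (z \<otimes> x)))" for b
    using two_manifolds.smooth_near_partial1[OF two hh vec_tangent] by simp
  have comm: "vec w (\<lambda>x. vec b (\<lambda>z. h (z \<otimes> x))) = vec b (\<lambda>z. vec w (\<lambda>x. h (z \<otimes> x)))" for b
    using two_manifolds.tangent_commute[OF two hh vec_tangent vec_tangent] by simp
  have S: "smooth_near A \<one> (\<lambda>q. field v q h)" for v
    by (rule smooth_vector_field_near[OF LF_smooth[OF field_mem] open_UNIV UNIV_I h])
  have "vec w (\<lambda>x. field v x h) = vec w (\<lambda>x. \<Sum>b\<in>B. (rho x v \<bullet> b) * vec b (\<lambda>z. h (z \<otimes> x)))"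
  proof (rule tangent_local[OF vec_tangent S W(1,2)])
    fix x assume "x \<in> W"
    then have "field v x h = vec (rho x v) (\<lambda>z. h (z \<otimes> x))"
      by (intro field_apply_right W(3))
    then show "field v x h = (\<Sum>b\<in>B. (rho x v \<bullet> b) * vec b (\<lambda>z. h (z \<otimes> x)))"
      using frame_linear[OF frame linear_vec_apply, of "rho x v"] by simp
  qed
  also have "\<dots> = (\<Sum>b\<in>B. vec w (\<lambda>x. (rho x v \<bullet> b) * vec b (\<lambda>z. h (z \<otimes> x))))"
    by (intro tangent_sum[OF vec_tangent] smooth_near_mult smooth_rho s)
  \<comment> \<open>The product rule at \<open>\<one>\<close> yields two sums. The first collects
    the derivatives of \<open>rho\<close>; the second, after the two derivations have been exchanged
    by \<open>comm\<close>, reassembles into the other half of the bracket.\<close>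
  also have "\<dots> = (\<Sum>b\<in>B. vec w (\<lambda>x. rho x v \<bullet> b) * (b \<bullet> c) +
      (v \<bullet> b) * vec b (\<lambda>z. vec w (\<lambda>x. h (z \<otimes> x))))"
  proof (intro sum.cong refl)
    fix b
    have "vec b (\<lambda>z. h (z \<otimes> \<one>)) = b \<bullet> c" using vec_coord[of b c] by (simp add: h_def)
    then show "vec w (\<lambda>x. (rho x v \<bullet> b) * vec b (\<lambda>z. h (z \<otimes> x))) =
      vec w (\<lambda>x. rho x v \<bullet> b) * (b \<bullet> c) + (v \<bullet> b) * vec b (\<lambda>z. vec w (\<lambda>x. h (z \<otimes> x)))"
      using tangent_mult[OF vec_tangent smooth_rho s, of w v b b] by (simp only: rho_one comm)
  qed
  also have "\<dots> = (\<Sum>b\<in>B. vec w (\<lambda>x. (rho x v \<bullet> b) * (b \<bullet> c))) +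
      vec v (\<lambda>z. vec w (\<lambda>x. h (z \<otimes> x)))"
    using frame_linear[OF frame linear_vec_apply, of v "\<lambda>z. vec w (\<lambda>x. h (z \<otimes> x))"]
    by (simp add: sum.distrib vec_scale_right smooth_rho)
  also have "(\<Sum>b\<in>B. vec w (\<lambda>x. (rho x v \<bullet> b) * (b \<bullet> c))) =
      vec w (\<lambda>x. \<Sum>b\<in>B. (rho x v \<bullet> b) * (b \<bullet> c))"
    by (intro tangent_sum[OF vec_tangent, symmetric] smooth_near_mult smooth_rho smooth_near_const)
  also have "(\<lambda>x. \<Sum>b\<in>B. (rho x v \<bullet> b) * (b \<bullet> c)) = (\<lambda>x. rho x v \<bullet> c)"
  proof
    fix x show "(\<Sum>b\<in>B. (rho x v \<bullet> b) * (b \<bullet> c)) = rho x v \<bullet> c"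
      using frame_linear[OF frame bounded_linear.linear[OF bounded_linear_inner_left], of "rho x v" c, symmetric]
      by simp
  qed
  also have "vec v (\<lambda>z. vec w (\<lambda>x. h (z \<otimes> x))) = vec v (\<lambda>z. field w z h)"
    using W(3)
    by (intro tangent_local[OF vec_tangent S W(1,2), symmetric]) (simp add: field_def left_field_apply)
  finally have "vec w (\<lambda>x. field v x h) - vec v (\<lambda>z. field w z h) = vec w (\<lambda>x. rho x v \<bullet> c)"
    by simp
  moreover have "brk w v \<bullet> c = vf_bracket A (field w) (field v) \<one> h"
    unfolding vec_brk[symmetric] h_def by (rule vec_coord[symmetric])
  ultimately show ?thesis
    using h by (simp add: vf_bracket_def field_one)
qed

text \<open>Reduction to \<open>\<one>\<close>: by left invariance the derivative at
  \<open>g\<close> is that of \<open>rho (g \<otimes> x) v = rho g (rho x v)\<close> in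
  \<open>x\<close> at \<open>\<one>\<close>, and the linear map \<open>rho g\<close> passes through
  the derivation once it is expanded in the frame.\<close>

lemma derivative_rho: "field w g (\<lambda>x. rho x v \<bullet> c) = rho g (brk w v) \<bullet> c"
proof -
  have ex: "rho g z \<bullet> c = (\<Sum>b\<in>B. (z \<bullet> b) * (rho g b \<bullet> c))" for z
    by (subst frame_linear[OF frame linear_rho]) (simp add: inner_sum_left)
  have "field w g (\<lambda>x. rho x v \<bullet> c) = vec w (\<lambda>x. rho g (rho x v) \<bullet> c)"
    unfolding field_def by (simp add: left_field_apply smooth_rho rho_mult)
  also have "\<dots> = vec w (\<lambda>x. \<Sum>b\<in>B. (rho x v \<bullet> b) * (rho g b \<bullet> c))"
    by (simp add: ex[of "rho _ v"])
  also have "\<dots> = (\<Sum>b\<in>B. vec w (\<lambda>x. (rho x v \<bullet> b) * (rho g b \<bullet> c)))"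
    by (intro tangent_sum[OF vec_tangent] smooth_near_mult smooth_rho smooth_near_const)
  also have "\<dots> = (\<Sum>b\<in>B. (brk w v \<bullet> b) * (rho g b \<bullet> c))"
    by (simp add: vec_scale_right smooth_rho derivative_rho_one)
  finally show ?thesis by (simp add: ex[of "brk w v"])
qed

section \<open>Invariance under the group and its infinitesimal form\<close>

lemma field_surj:
  assumes "D \<in> tangent_space A g"
  shows "\<exists>w. field w g = D"
proof -
  define u where "u = differential A (\<lambda>q. inv g \<otimes> q) g D"
  have u: "u \<in> tangent_space A \<one>"
    using differential_tangent[OF manifold_axioms manifold_axioms smooth_pull_left assms, of "inv g"]
    by (simp add: u_def)
  have "left_field u g = D"
    unfolding left_field_def u_def
    using differential_compose[OF smooth_pull_left, of g "\<lambda>q. inv g \<otimes> q" g D] differential_id[OF assms]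
    by (simp add: m_assoc[symmetric])
  then show ?thesis
    using vec_coords[OF u] unfolding field_def by metis
qed

text \<open>Left invariant fields reach every tangent vector, so all chart derivatives of
  \<open>f\<close> vanish and \<open>f\<close> is constant on a coordinate ball around each point;
  connectedness spreads this over the group.\<close>

lemma constant_if_fields_zero:
  assumes conn: "connected (UNIV :: 'g set)"
    and f: "\<And>p. smooth_near A p f" and zero: "\<And>w p. field w p f = 0"
  shows "f x = f y"
proof (rule connected_local_const[OF conn UNIV_I UNIV_I], intro ballI)
  fix p :: 'g
  obtain V \<kappa> where V: "(V, \<kappa>) \<in> A" "p \<in> V" by (rule chart_at)
  have "((f \<circ> inv_into V \<kappa>) has_derivative (\<lambda>v. 0)) (at y)" if y: "y \<in> \<kappa> ` V" for y
  proof -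
    obtain q where q: "q \<in> V" "y = \<kappa> q" using y by blast
    have "coord_vector A V \<kappa> q v f = 0" for v
      using field_surj[OF coord_vector_tangent[OF V(1) q(1), of v]] zero by metis
    then show ?thesis using coord_deriv[OF V(1) q(1) f] q(2) by simp
  qed
  moreover obtain r where r: "r > 0" "ball (\<kappa> p) r \<subseteq> \<kappa> ` V"
    using open_chart_image[OF V(1)] V(2) by (metis imageI openE)
  ultimately have "((f \<circ> inv_into V \<kappa>) has_derivative (\<lambda>v. 0)) (at y within ball (\<kappa> p) r)"
    if "y \<in> ball (\<kappa> p) r" for y
    using that by (blast intro: has_derivative_at_withinI)
  from has_derivative_zero_constant[OF convex_ball this]
  obtain c where c: "\<And>y. y \<in> ball (\<kappa> p) r \<Longrightarrow> (f \<circ> inv_into V \<kappa>) y = c"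
    by blast
  have "f q = c" if "q \<in> V \<inter> \<kappa> -` ball (\<kappa> p) r" for q
    using c[of "\<kappa> q"] that chart_inv_chart[OF V(1)] by simp
  moreover have "p \<in> V \<inter> \<kappa> -` ball (\<kappa> p) r" using V(2) r(1) by simp
  ultimately show "\<forall>\<^sub>F b in at p within UNIV. f p = f b"
    using open_preimage_chart[OF V(1) open_ball[of "\<kappa> p" r]]
    unfolding eventually_at_topological by metis
qed

lemma rho_inner_const:
  assumes "connected (UNIV :: 'g set)" "\<And>x y. brk x y \<bullet> l = 0"
  shows "rho g v \<bullet> l = v \<bullet> l"
proof -
  have "field w p (\<lambda>x. rho x v \<bullet> l) = 0" for w p
    by (simp add: derivative_rho rho_brk assms(2))
  from constant_if_fields_zero[OF assms(1) smooth_rho this, of g \<one>] show ?thesis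
    by (simp add: rho_one)
qed

lemma rho_fixes_central:
  assumes "connected (UNIV :: 'g set)" "\<And>w. brk w v = 0"
  shows "rho g v = v"
proof (rule frame_eqI[OF frame])
  fix c
  have "field w p (\<lambda>x. rho x v \<bullet> c) = 0" for w p
    by (simp add: derivative_rho assms(2) linear_0[OF linear_rho])
  from constant_if_fields_zero[OF assms(1) smooth_rho this, of g \<one>] show "rho g v \<bullet> c = v \<bullet> c"
    by (simp add: rho_one)
qed

text \<open>Differentiation of a constant function at \<open>\<one>\<close>. Used for a fixed vector
  \<open>v\<close> with all \<open>l\<close> of a frame, it shows that \<open>v\<close> is central;
  used for a fixed functional \<open>l\<close> with all \<open>v\<close>, it shows that
  \<open>l\<close> kills the brackets.\<close>

lemma brk_inner_zero:
  assumes "\<And>g. rho g v \<bullet> l = v \<bullet> l"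
  shows "brk w v \<bullet> l = 0"
  unfolding derivative_rho_one[symmetric] assms by (rule tangent_const[OF vec_tangent])

lemma invariant_form_derivative:
  assumes "bilinear \<beta>" and inv: "\<And>g. \<beta> (rho g v) (rho g z) = (\<beta> v z :: real)"
  shows "\<beta> (brk w v) z + \<beta> v (brk w z) = 0"
proof -
  \<comment> \<open>Derivations act on real functions, so the form is written as a polynomial in
    coordinates of \<open>rho x v\<close> and \<open>rho x z\<close>, to which the Leibniz rule
    applies.\<close>
  have ex: "\<beta> x y = (\<Sum>b\<in>B. \<Sum>c\<in>B. (x \<bullet> b) * (y \<bullet> c) * \<beta> b c)" for x y
  proof -
    have lin: "linear (\<lambda>x. \<beta> x y)" "\<And>b. linear (\<beta> b)" using assms(1) by (auto simp: bilinear_def)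
    have "\<beta> x y = (\<Sum>b\<in>B. (x \<bullet> b) *\<^sub>R \<beta> b y)" by (rule frame_linear[OF frame lin(1)])
    also have "\<dots> = (\<Sum>b\<in>B. (x \<bullet> b) *\<^sub>R (\<Sum>c\<in>B. (y \<bullet> c) *\<^sub>R \<beta> b c))"
      by (simp only: frame_linear[OF frame lin(2), of _ y, symmetric])
    finally show ?thesis by (simp add: sum_distrib_left mult.assoc)
  qed
  have "0 = vec w (\<lambda>x. \<beta> (rho x v) (rho x z))"
    unfolding inv by (simp add: tangent_const[OF vec_tangent])
  also have "\<dots> = vec w (\<lambda>x. \<Sum>b\<in>B. \<Sum>c\<in>B. (rho x v \<bullet> b) * (rho x z \<bullet> c) * \<beta> b c)"
    by (subst ex) simp
  also have "\<dots> = (\<Sum>b\<in>B. \<Sum>c\<in>B. vec w (\<lambda>x. (rho x v \<bullet> b) * (rho x z \<bullet> c) * \<beta> b c))"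
    by (subst tangent_sum[OF vec_tangent]; intro smooth_near_sum smooth_near_mult smooth_rho smooth_near_const sum.cong refl)
      (intro tangent_sum[OF vec_tangent] smooth_near_mult smooth_rho smooth_near_const)
  also have "\<dots> = (\<Sum>b\<in>B. \<Sum>c\<in>B. ((brk w v \<bullet> b) * (z \<bullet> c) + (v \<bullet> b) * (brk w z \<bullet> c)) * \<beta> b c)"
  proof (intro sum.cong refl)
    fix b c
    have "vec w (\<lambda>x. (rho x v \<bullet> b) * (rho x z \<bullet> c) * \<beta> b c) =
      vec w (\<lambda>x. \<beta> b c * ((rho x v \<bullet> b) * (rho x z \<bullet> c)))" by (simp add: mult.commute)
    also have "\<dots> = \<beta> b c * vec w (\<lambda>x. (rho x v \<bullet> b) * (rho x z \<bullet> c))"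
      by (intro tangent_scale[OF vec_tangent] smooth_near_mult smooth_rho)
    also have "vec w (\<lambda>x. (rho x v \<bullet> b) * (rho x z \<bullet> c)) = (brk w v \<bullet> b) * (z \<bullet> c) + (v \<bullet> b) * (brk w z \<bullet> c)"
      by (simp add: tangent_mult[OF vec_tangent smooth_rho smooth_rho] derivative_rho_one rho_one)
    finally show "vec w (\<lambda>x. (rho x v \<bullet> b) * (rho x z \<bullet> c) * \<beta> b c) =
      ((brk w v \<bullet> b) * (z \<bullet> c) + (v \<bullet> b) * (brk w z \<bullet> c)) * \<beta> b c" by (simp add: mult.commute)
  qed
  also have "\<dots> = \<beta> (brk w v) z + \<beta> v (brk w z)"
    by (simp add: ex[of "brk w v"] ex[of v "brk w z"] distrib_right sum.distrib)
  finally show ?thesis by simp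
qed

end

section \<open>Double orthogonals and fixed points of compact groups\<close>

text \<open>Gram-Schmidt provides the orthogonal projection \<open>p\<close> of \<open>z\<close> to
  \<open>D\<close>. The difference \<open>z - p\<close> is orthogonal to \<open>D\<close>, so by
  assumption also to \<open>z\<close>, hence to itself. This turns statements about functionals that
  kill all brackets into membership in the commutator subspace.\<close>

lemma frame_subspace_double_orthogonal:
  assumes "frame (B :: 'e::real_inner set)" "subspace D"
    and z: "\<And>l. (\<And>d. d \<in> D \<Longrightarrow> d \<bullet> l = 0) \<Longrightarrow> z \<bullet> l = 0"
  shows "z \<in> (D :: 'e set)"
proof -
  have "span B = UNIV"
  proof -
    have "x \<in> span B" for x
      by (subst frame_expand[OF assms(1), symmetric]) (intro span_sum span_scale span_base)
    then show ?thesis by blast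
  qed
  obtain S where S: "S \<subseteq> D" "independent S" "D \<subseteq> span S"
    using maximal_independent_subset[of D] by blast
  have "finite S"
    using independent_span_bound[OF frame_finite[OF assms(1)] S(2)] \<open>span B = UNIV\<close> by auto
  from gram_schmidt[OF this] obtain C where C: "finite C" "C \<subseteq> span S"
    "\<And>x. x \<in> span S \<Longrightarrow> (\<Sum>c\<in>C. (x \<bullet> c) *\<^sub>R c) = x"
    by blast
  have D: "span S = D" using S assms(2) by (simp add: span_subspace)
  define p where "p = (\<Sum>c\<in>C. (z \<bullet> c) *\<^sub>R c)"
  have p: "p \<in> D"
    using C(2) assms(2) unfolding D p_def by (intro subspace_sum subspace_scale) auto
  have orth: "d \<bullet> (z - p) = 0" if d: "d \<in> D" for d
  proof -
    have "d \<bullet> p = (\<Sum>c\<in>C. (d \<bullet> c) *\<^sub>R c) \<bullet> z"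
      by (simp add: p_def inner_sum_right inner_sum_left inner_commute[of _ z] mult.commute)
    then show ?thesis using C(3)[of d] d by (simp add: D inner_diff_right)
  qed
  have "z \<bullet> (z - p) = 0" using z orth by blast
  then have "(z - p) \<bullet> (z - p) = 0" using orth[OF p] by (simp add: inner_diff_left)
  then show ?thesis using p by simp
qed

text \<open>The minimiser of the invariant norm \<open>N v = sup\<^sub>g norm (R g v)\<close> over \<open>K\<close> is unique, since
  \<open>N\<close> is strictly convex by the parallelogram law; hence it is fixed. This replaces Haar measure.\<close>

lemma compact_group_fixed_point:
  fixes R :: "'g::topological_space \<Rightarrow> 'e::real_inner \<Rightarrow> 'e"
  assumes B: "frame (B :: 'e set)" and cpt: "compact (UNIV :: 'g set)"
    and cont: "\<And>v. continuous_on UNIV (\<lambda>g. R g v)"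
    and lin: "\<And>g. linear (R g)"
    and mult: "\<And>g h. \<exists>k. \<forall>v. R k v = R g (R h v)"
    and inv: "\<And>g. \<exists>h. \<forall>v. R h (R g v) = v"
    and K: "closed K" "convex K" "K \<noteq> {}" "\<And>g x. x \<in> K \<Longrightarrow> R g x \<in> K"
  shows "\<exists>x\<in>K. \<forall>g. R g x = x"
proof -
  have "\<exists>g. \<forall>h. norm (R h v) \<le> norm (R g v)" for v
    using continuous_attains_sup[OF cpt _ continuous_on_norm[OF cont[of v]]] by auto
  then obtain m where m: "\<And>v h. norm (R h v) \<le> norm (R (m v) v)" by metis
  define N where "N = (\<lambda>v. norm (R (m v) v))"
  have N_eq: "N v = norm (R (m v) v)" for v by (simp add: N_def)
  have N_ge: "norm (R h v) \<le> N v" for h v using m by (simp add: N_def)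
  have N_inv: "N (R h v) \<le> N v" for h v
  proof -
    obtain k where "R k v = R (m (R h v)) (R h v)" using mult[of "m (R h v)" h] by blast
    then show ?thesis using N_ge[of k v] by (simp add: N_eq[of "R h v"])
  qed
  \<comment> \<open>The assumptions name no unit, so the identity is produced as an operator
    \<open>R k\<close>, by undoing the action of an arbitrary group element, here
    \<open>undefined\<close>.\<close>
  have norm_le: "norm v \<le> N v" for v
  proof -
    obtain h where "\<And>v. R h (R undefined v) = v" using inv by blast
    moreover obtain k where "\<And>v. R k v = R h (R undefined v)" using mult by blast
    ultimately show ?thesis using N_ge[of k v] by simp
  qed
  have N_add: "N (v + w) \<le> N v + N w" for v w
  proof -
    have "N (v + w) = norm (R (m (v + w)) v + R (m (v + w)) w)"
      by (simp add: N_def linear_add[OF lin])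
    also have "\<dots> \<le> N v + N w"
      using N_ge norm_triangle_ineq by (meson add_mono order_trans)
    finally show ?thesis .
  qed
  define C where "C = (\<Sum>b\<in>B. norm b) * (\<Sum>b\<in>B. N b)"
  have N_bound: "N v \<le> C * norm v" for v
    unfolding C_def N_eq[of v]
  proof (rule frame_linear_bound[OF B lin])
    have nn: "0 \<le> N b" for b by (simp add: N_def)
    show "0 \<le> (\<Sum>b\<in>B. N b)" using nn by (intro sum_nonneg)
    fix b assume "b \<in> B"
    then have "N b \<le> (\<Sum>b\<in>B. N b)"
      using frame_finite[OF B] nn by (intro member_le_sum) auto
    then show "norm (R (m v) b) \<le> (\<Sum>b\<in>B. N b)" using N_ge order_trans by blast
  qed
  \<comment> \<open>A supremum of continuous functions need not be continuous; here continuity comes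
    from subadditivity together with the linear bound \<open>N_bound\<close>.\<close>
  have "C-lipschitz_on UNIV N"
  proof (rule lipschitz_onI)
    show "0 \<le> C" unfolding C_def by (intro mult_nonneg_nonneg sum_nonneg) (auto simp: N_def)
    fix v w
    have "N v - N w \<le> C * norm (v - w)" "N w - N v \<le> C * norm (v - w)"
      using N_add[of "v - w" w] N_add[of "w - v" v] N_bound[of "v - w"] N_bound[of "w - v"]
      by (auto simp: norm_minus_commute)
    then show "dist (N v) (N w) \<le> C * dist v w" by (simp add: dist_norm abs_le_iff)
  qed
  then have contN: "continuous_on S N" for S
    using lipschitz_on_continuous_on continuous_on_subset by blast
  obtain x0 where x0: "x0 \<in> K" using K(3) by blast
  \<comment> \<open>\<open>K\<close> may be unbounded, but \<open>norm v \<le> N v\<close> makes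
    \<open>N\<close> exceed \<open>N x0\<close> outside this ball, so the minimum over the compact
    part is the minimum over \<open>K\<close>.\<close>
  have "compact (K \<inter> cball 0 (N x0))"
    by (intro frame_compact[OF B] closed_Int K(1) closed_cball bounded_Int) simp
  moreover have "x0 \<in> K \<inter> cball 0 (N x0)" using x0 norm_le by simp
  ultimately obtain x where x: "x \<in> K" "\<And>y. y \<in> K \<inter> cball 0 (N x0) \<Longrightarrow> N x \<le> N y"
    using continuous_attains_inf[of "K \<inter> cball 0 (N x0)" N] contN by blast
  have min: "N x \<le> N y" if "y \<in> K" for y
  proof (cases "norm y \<le> N x0")
    case True
    then show ?thesis using x(2) that by simp
  next
    case False
    have "N x \<le> N x0" using x(2)[of x0] x0 norm_le by simp
    then show ?thesis using False norm_le[of y] by linarith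
  qed
  have "R h x = x" for h
  proof -
    \<comment> \<open>The midpoint of \<open>x\<close> and \<open>R h x\<close> lies in
      \<open>K\<close>. With \<open>g\<close> attaining the supremum there, minimality gives
      \<open>2 * N x \<le> norm (a + b)\<close>, while \<open>norm a\<close> and
      \<open>norm b\<close> are at most \<open>N x\<close>. The parallelogram law leaves only
      \<open>a = b\<close>, and \<open>R g\<close> is injective.\<close>
    let ?y = "R h x" and ?z = "(1/2) *\<^sub>R x + (1/2) *\<^sub>R R h x"
    have "?z \<in> K" using convexD[OF K(2) x(1) K(4)[OF x(1), of h], of "1/2" "1/2"] by simp
    then have "N x \<le> N ?z" by (rule min)
    define g where "g = m ?z"
    define a b where "a = R g x" and "b = R g ?y"
    have ab: "norm a \<le> N x" "norm b \<le> N x"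
      using N_ge[of g x] N_ge[of g ?y] N_inv[of h x] by (auto simp: a_def b_def)
    have "N ?z = norm ((1/2) *\<^sub>R (a + b))"
      by (simp add: N_def g_def a_def b_def linear_add[OF lin] linear_scale[OF lin] scaleR_add_right)
    then have "2 * N x \<le> norm (a + b)" using \<open>N x \<le> N ?z\<close> by simp
    moreover have "0 \<le> N x" by (simp add: N_def)
    ultimately have "(2 * N x)\<^sup>2 \<le> (norm (a + b))\<^sup>2" by (intro power_mono) auto
    moreover have "(norm a)\<^sup>2 \<le> (N x)\<^sup>2" "(norm b)\<^sup>2 \<le> (N x)\<^sup>2"
      using ab by (auto intro: power_mono)
    moreover have "(norm (a - b))\<^sup>2 + (norm (a + b))\<^sup>2 = 2 * (norm a)\<^sup>2 + 2 * (norm b)\<^sup>2"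
      by (simp add: power2_norm_eq_inner inner_add_left inner_add_right inner_diff_left inner_diff_right)
    moreover have "(2 * N x)\<^sup>2 = 4 * (N x)\<^sup>2" by (simp add: power_mult_distrib)
    ultimately have "(norm (a - b))\<^sup>2 \<le> 0" by linarith
    then have "R g x = R g ?y" by (simp add: a_def b_def)
    then show ?thesis using inv[of g] by metis
  qed
  then show ?thesis using x(1) by blast
qed

section \<open>Bi-invariant forms and the compact case\<close>

lemma coset_mem: "subspace N \<Longrightarrow> y \<in> coset N x \<longleftrightarrow> y - x \<in> N"
  by (auto simp: coset_def intro: exI[of _ "y - x"])

lemma coset_eq_iff:
  assumes "subspace N"
  shows "coset N x = coset N y \<longleftrightarrow> x - y \<in> N"
proof
  assume "coset N x = coset N y"
  then have "x \<in> coset N y" using coset_mem[OF assms, of x x] subspace_0[OF assms] by simp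
  then show "x - y \<in> N" using coset_mem[OF assms] by blast
next
  assume xy: "x - y \<in> N"
  have "z - x \<in> N \<longleftrightarrow> z - y \<in> N" for z
    using subspace_add[OF assms, of "z - x" "x - y"] subspace_diff[OF assms, of "z - y" "x - y"] xy
    by auto
  then show "coset N x = coset N y" using coset_mem[OF assms] by blast
qed

lemma coset_add:
  assumes "subspace N"
  shows "{a + b | a b. a \<in> coset N x \<and> b \<in> coset N y} = coset N (x + y)"
proof (intro subset_antisym subsetI)
  fix z assume "z \<in> {a + b | a b. a \<in> coset N x \<and> b \<in> coset N y}"
  then obtain a b where "z = a + b" "a - x \<in> N" "b - y \<in> N" using coset_mem[OF assms] by blast
  then show "z \<in> coset N (x + y)"
    using subspace_add[OF assms, of "a - x" "b - y"] by (simp add: coset_mem[OF assms] algebra_simps)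
next
  fix z assume "z \<in> coset N (x + y)"
  then have "z = (z - y) + y" "z - y \<in> coset N x" "y \<in> coset N y"
    using subspace_0[OF assms] by (auto simp: coset_mem[OF assms] algebra_simps)
  then show "z \<in> {a + b | a b. a \<in> coset N x \<and> b \<in> coset N y}" by blast
qed

lemma coset_scale:
  assumes "subspace N"
  shows "{c *\<^sub>R a + n | a n. a \<in> coset N x \<and> n \<in> N} = coset N (c *\<^sub>R x)"
proof (intro subset_antisym subsetI)
  fix z assume "z \<in> {c *\<^sub>R a + n | a n. a \<in> coset N x \<and> n \<in> N}"
  then obtain a n where "z = c *\<^sub>R a + n" "a - x \<in> N" "n \<in> N" using coset_mem[OF assms] by blast
  then show "z \<in> coset N (c *\<^sub>R x)"
    using subspace_add[OF assms subspace_scale[OF assms, of "a - x" c], of n]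
    by (simp add: coset_mem[OF assms] algebra_simps)
next
  fix z assume "z \<in> coset N (c *\<^sub>R x)"
  then have "z = c *\<^sub>R x + (z - c *\<^sub>R x)" "x \<in> coset N x" "z - c *\<^sub>R x \<in> N"
    using subspace_0[OF assms] by (auto simp: coset_mem[OF assms])
  then show "z \<in> {c *\<^sub>R a + n | a n. a \<in> coset N x \<and> n \<in> N}" by blast
qed

lemma (in manifold) vf_bracket_linear_left:
  assumes X: "smooth_vector_field_on A UNIV X" and X': "smooth_vector_field_on A UNIV X'"
    and Y: "smooth_vector_field_on A UNIV Y"
  shows "vf_bracket A (a *\<^sub>R X + b *\<^sub>R X') Y = a *\<^sub>R vf_bracket A X Y + b *\<^sub>R vf_bracket A X' Y"
proof (intro ext)
  fix p f
  have "Y p (\<lambda>q. a * X q f + b * X' q f) = a * Y p (\<lambda>q. X q f) + b * Y p (\<lambda>q. X' q f)" if "smooth_near A p f"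
    using that
    by (intro tangent_combine[OF smooth_vector_field_mem[OF Y UNIV_I]]
        smooth_vector_field_near[OF X open_UNIV UNIV_I] smooth_vector_field_near[OF X' open_UNIV UNIV_I])
  then show "vf_bracket A (a *\<^sub>R X + b *\<^sub>R X') Y p f = (a *\<^sub>R vf_bracket A X Y + b *\<^sub>R vf_bracket A X' Y) p f"
    by (simp add: vf_bracket_def scaleR_fun_def algebra_simps)
qed

section \<open>The commutator subspace and invariant forms\<close>

context lie_group_chart
begin

lemma linear_brk_left: "linear (\<lambda>v. brk v w)"
proof -
  have *: "brk (a *\<^sub>R v + b *\<^sub>R v') w = a *\<^sub>R brk v w + b *\<^sub>R brk v' w" for a b v v'
    unfolding brk_def linear_add[OF linear_field] linear_scale[OF linear_field]
      vf_bracket_linear_left[OF LF_smooth LF_smooth LF_smooth, OF field_mem field_mem field_mem]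
    by (simp add: linear_add[OF linear_coords, symmetric] linear_scale[OF linear_coords, symmetric]
        scaleR_fun_def[where 'a='g and 'b="'g tangent"])
  show ?thesis
    using *[of 1 _ 1] *[of _ _ 0] by (intro linearI) auto
qed

lemma linear_brk_right: "linear (brk v)"
proof -
  have "brk v = (\<lambda>w. - brk w v)" by (rule ext) (rule brk_antisym)
  then show ?thesis using linear_compose_neg[OF linear_brk_left[of v]] by simp
qed

definition comm :: "'e set" where "comm = span {brk v w | v w. True}"

lemma subspace_comm: "subspace comm"
  by (simp add: comm_def)

lemma brk_comm: "brk v w \<in> comm"
  unfolding comm_def by (intro span_base) blast

abbreviation "DF \<equiv> derived_algebra (vf_bracket A) LF"

lemma derived_eq: "DF = field ` comm"
proof -
  have "{vf_bracket A x y | x y. x \<in> LF \<and> y \<in> LF} = field ` {brk v w | v w. True}"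
  proof (intro subset_antisym subsetI)
    fix Z assume "Z \<in> {vf_bracket A x y | x y. x \<in> LF \<and> y \<in> LF}"
    then obtain x y where "Z = vf_bracket A x y" "x \<in> LF" "y \<in> LF" by blast
    moreover obtain v w where "x = field v" "y = field w"
      using calculation(2,3) unfolding range_field[symmetric] by blast
    ultimately have "Z = field (brk v w)" by (simp add: field_brk)
    then show "Z \<in> field ` {brk v w | v w. True}" by blast
  next
    fix Z assume "Z \<in> field ` {brk v w | v w. True}"
    then obtain v w where "Z = vf_bracket A (field v) (field w)" using field_brk by blast
    then show "Z \<in> {vf_bracket A x y | x y. x \<in> LF \<and> y \<in> LF}" using field_mem by blast
  qed
  then show ?thesis
    unfolding derived_algebra_def comm_def by (simp add: linear_span_image[OF linear_field])
qed

lemma subspace_DF: "subspace DF"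
  by (simp add: derived_algebra_def)

lemma field_DF_iff: "field v \<in> DF \<longleftrightarrow> v \<in> comm"
  unfolding derived_eq using inj_field by (auto dest: injD)

lemma comm_inner_zero:
  assumes "d \<in> comm" "\<And>x y. brk x y \<bullet> l = 0"
  shows "d \<bullet> l = 0"
  using assms(1) unfolding comm_def
  by (induction rule: span_induct_alt) (auto simp: inner_add_left assms(2))

lemma rho_diff_comm:
  assumes "connected (UNIV :: 'g set)"
  shows "rho g v - v \<in> comm"
proof (rule frame_subspace_double_orthogonal[OF frame subspace_comm])
  fix l assume "\<And>d. d \<in> comm \<Longrightarrow> d \<bullet> l = 0"
  then show "(rho g v - v) \<bullet> l = 0"
    using rho_inner_const[OF assms, of l g v] brk_comm by (simp add: inner_diff_left)
qed

lemma invariant_form_zero: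
  assumes bil: "bilinear \<beta>" and alt: "\<And>v. \<beta> v v = (0::real)"
    and inv: "\<And>g v w. \<beta> (rho g v) (rho g w) = \<beta> v w" and d: "d \<in> comm"
  shows "\<beta> d z = 0"
proof -
  have L: "linear (\<lambda>x. \<beta> x y)" and R: "linear (\<beta> y)" for y using bil by (auto simp: bilinear_def)
  have anti: "\<beta> x y = - \<beta> y x" for x y
  proof -
    have "\<beta> (x + y) (x + y) = \<beta> x x + \<beta> x y + (\<beta> y x + \<beta> y y)"
      by (simp add: linear_add[OF L] linear_add[OF R])
    then show ?thesis by (simp add: alt)
  qed
  have 1: "\<beta> (brk w v) z = \<beta> (brk w z) v" for w v z
    using invariant_form_derivative[OF bil inv, of w v z] anti[of v "brk w z"] by simp
  have 2: "\<beta> (brk v w) z = - \<beta> (brk w v) z" for w v z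
    using brk_antisym[of v w] linear_neg[OF L, of "brk w v" z] by simp
  \<comment> \<open>Symmetry in the last two arguments (1) and antisymmetry in the first two (2) are
    alternated around all six orders of \<open>x\<close>, \<open>y\<close>, \<open>z\<close>. The
    round trip contains three sign changes, so the value equals its own negative.\<close>
  have 3: "\<beta> (brk x y) z = 0" for x y z
    using 1[of x y z] 2[of x z y] 1[of z x y] 2[of z y x] 1[of y z x] 2[of y x z] by simp
  show ?thesis
    using d unfolding comm_def
    by (induction rule: span_induct_alt) (auto simp: linear_0[OF L] linear_add[OF L] linear_scale[OF L] 3)
qed

section \<open>The Maurer-Cartan form\<close>

text \<open>The left Maurer-Cartan form, with values written in the model space.\<close>

definition mc :: "'g \<Rightarrow> 'g tangent \<Rightarrow> 'e" where
  "mc p u = coords (differential A (\<lambda>q. inv p \<otimes> q) p u)"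

lemma linear_mc: "linear (mc p)"
  using linear_compose[OF linear_differential linear_coords] by (simp add: mc_def[abs_def] o_def)

lemma differential_inv_left_tangent:
  "u \<in> tangent_space A p \<Longrightarrow> differential A (\<lambda>q. inv p \<otimes> q) p u \<in> tangent_space A \<one>"
  using differential_tangent[OF manifold_axioms manifold_axioms smooth_pull_left, of u p "inv p"] by simp

lemma vec_mc: "u \<in> tangent_space A p \<Longrightarrow> vec (mc p u) = differential A (\<lambda>q. inv p \<otimes> q) p u"
  unfolding mc_def by (rule vec_coords[OF differential_inv_left_tangent])

lemma mc_one: "u \<in> tangent_space A \<one> \<Longrightarrow> mc \<one> u = coords u"
  using differential_id[of u A \<one>] by (simp add: mc_def mult_one_eta)

lemma mc_left: "mc (g \<otimes> p) (differential A (\<lambda>q. g \<otimes> q) p u) = mc p u"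
proof -
  have "inv (g \<otimes> p) \<otimes> (g \<otimes> q) = inv p \<otimes> q" for q
    by (simp add: inv_mult_group m_assoc[symmetric]) (simp add: m_assoc)
  then show ?thesis
    using differential_compose[OF smooth_pull_left, of "inv (g \<otimes> p)" "\<lambda>q. g \<otimes> q" p u]
    by (simp add: mc_def)
qed

text \<open>Since \<open>inv (p \<otimes> g) \<otimes> (q \<otimes> g)\<close> is the conjugate of
  \<open>inv p \<otimes> q\<close> by \<open>inv g\<close>, a right translation is felt only through
  the adjoint representation.\<close>

lemma mc_right:
  assumes u: "u \<in> tangent_space A p"
  shows "mc (p \<otimes> g) (differential A (\<lambda>q. q \<otimes> g) p u) = rho (inv g) (mc p u)"
proof -
  have "differential A (\<lambda>q. inv (p \<otimes> g) \<otimes> q) (p \<otimes> g) (differential A (\<lambda>q. q \<otimes> g) p u) =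
    differential A (\<lambda>q. inv (p \<otimes> g) \<otimes> (q \<otimes> g)) p u"
    using differential_compose[OF smooth_pull_left, of "inv (p \<otimes> g)" "\<lambda>q. q \<otimes> g" p u] by simp
  also have "(\<lambda>q. inv (p \<otimes> g) \<otimes> (q \<otimes> g)) = (\<lambda>q. inv g \<otimes> (inv p \<otimes> q) \<otimes> inv (inv g))"
    by (simp add: inv_mult_group m_assoc)
  also have "differential A (\<lambda>q. inv g \<otimes> (inv p \<otimes> q) \<otimes> inv (inv g)) p u =
    Ad (inv g) (differential A (\<lambda>q. inv p \<otimes> q) p u)"
    using differential_compose[OF smooth_pull_conj, of "inv g" "\<lambda>q. inv p \<otimes> q" p u] by (simp add: Ad_def)
  finally show ?thesis
    by (simp add: mc_def[of "p \<otimes> g"] rho_def vec_mc[OF u])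
qed

lemma mc_inner: "mc p u \<bullet> c = u (\<lambda>q. \<phi> (inv p \<otimes> q) \<bullet> c)" if "u \<in> tangent_space A p"
  using vec_coord[of "mc p u" c] vec_mc[OF that] differential_near[of A "\<lambda>q. inv p \<otimes> q" p "\<lambda>q. \<phi> q \<bullet> c" u]
  by (simp add: smooth_near_coord_one)

text \<open>The base point and the vector vary together. The function
  \<open>inv q \<otimes> q'\<close> of two variables is therefore differentiated in
  \<open>q'\<close> along coordinate directions, restricted to the diagonal, and weighted with the
  chart components of \<open>X\<close>, each of which is smooth.\<close>

lemma smooth_mc:
  assumes X: "smooth_vector_field_on A W X" and W: "open W" "p \<in> W"
  shows "smooth_near A p (\<lambda>q. mc q (X q) \<bullet> c)"
proof -
  obtain V \<kappa> where V: "(V, \<kappa>) \<in> A" "p \<in> V" by (rule chart_at)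
  have "smooth_pull AA A (\<lambda>z. inv (fst z) \<otimes> snd z)"
    by (intro smooth_pull_mult[OF manifold_AA] smooth_pull_snd_AA
        smooth_pull_compose[OF smooth_pull_fst_AA smooth_pull_inv])
  from smooth_pull_near[OF this, of "(p, p)" "\<lambda>q. \<phi> q \<bullet> c"]
  have F: "smooth_near AA (p, p) (\<lambda>z. \<phi> (inv (fst z) \<otimes> snd z) \<bullet> c)"
    by (simp add: smooth_near_coord_one)
  have "smooth_pull A AA (\<lambda>q. (q, q))"
    by (intro two_manifolds.smooth_pull_Pair[OF two manifold_axioms] smooth_pull_id)
  from smooth_pull_near[OF this two_manifolds.smooth_near_coord_slice2[OF two V F]]
  have s: "smooth_near A p (\<lambda>q. coord_vector A V \<kappa> q b (\<lambda>q'. \<phi> (inv q \<otimes> q') \<bullet> c))" for b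
    by simp
  have "smooth_near A p (\<lambda>q. \<Sum>b\<in>B. X q (\<lambda>q. \<kappa> q \<bullet> b) * coord_vector A V \<kappa> q b (\<lambda>q'. \<phi> (inv q \<otimes> q') \<bullet> c))"
    by (intro smooth_near_sum smooth_near_mult s smooth_vector_field_near[OF X W] smooth_near_coord[OF V])
  then show ?thesis
  proof (rule smooth_near_cong[rotated 3])
    show "open (V \<inter> W)" "p \<in> V \<inter> W" using V W open_chart_domain[OF V(1)] by auto
    fix q assume q: "q \<in> V \<inter> W"
    have XT: "X q \<in> tangent_space A q" using q X by (auto intro: smooth_vector_field_mem)
    have "X q (\<lambda>q'. \<phi> (inv q \<otimes> q') \<bullet> c) =
      coord_vector A V \<kappa> q (\<Sum>b\<in>B. X q (\<lambda>q. \<kappa> q \<bullet> b) *\<^sub>R b) (\<lambda>q'. \<phi> (inv q \<otimes> q') \<bullet> c)"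
      using q by (intro fun_cong[OF tangent_eq_coord_vector[OF V(1) _ XT]]) blast
    also have "\<dots> = (\<Sum>b\<in>B. X q (\<lambda>q. \<kappa> q \<bullet> b) * coord_vector A V \<kappa> q b (\<lambda>q'. \<phi> (inv q \<otimes> q') \<bullet> c))"
    proof -
      have L: "linear (\<lambda>v. coord_vector A V \<kappa> q v f)" for f
        using linear_add[OF linear_coord_vector[OF V(1)], of q] linear_scale[OF linear_coord_vector[OF V(1)], of q] q
        by (intro linearI) (auto simp: scaleR_fun_def)
      show ?thesis by (simp add: linear_sum[OF L] linear_scale[OF L])
    qed
    finally show "(\<Sum>b\<in>B. X q (\<lambda>q. \<kappa> q \<bullet> b) * coord_vector A V \<kappa> q b (\<lambda>q'. \<phi> (inv q \<otimes> q') \<bullet> c)) = mc q (X q) \<bullet> c"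
      using mc_inner[OF XT] by simp
  qed
qed

section \<open>Bi-invariant forms against forms on the abelianisation\<close>

abbreviation "QA \<equiv> abelianisation (vf_bracket A) LF"

lemma QA_simps:
  "vcarrier QA = coset DF ` LF"
  "vadd QA (coset DF X) (coset DF Y) = coset DF (X + Y)"
  "vscale QA c (coset DF X) = coset DF (c *\<^sub>R X)"
  by (simp_all add: abelianisation_def lie_quotient_def coset_add[OF subspace_DF] coset_scale[OF subspace_DF])

lemma QA_carrier: "vcarrier QA = range (\<lambda>v. coset DF (field v))"
proof -
  have "coset DF ` LF = coset DF ` range field" by (simp only: range_field)
  then show ?thesis by (simp add: QA_simps(1) image_image)
qed

lemma QA_field_simps:
  "vadd QA (coset DF (field v)) (coset DF (field w)) = coset DF (field (v + w))"
  "vscale QA c (coset DF (field v)) = coset DF (field (c *\<^sub>R v))"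
  by (simp_all add: QA_simps linear_add[OF linear_field] linear_scale[OF linear_field])

lemma coset_field_eq_iff: "coset DF (field v) = coset DF (field w) \<longleftrightarrow> v - w \<in> comm"
  by (simp add: coset_eq_iff[OF subspace_DF] linear_diff[OF linear_field, symmetric] field_DF_iff)

lemma coset_field_rho:
  assumes "connected (UNIV :: 'g set)"
  shows "coset DF (field (rho g v)) = coset DF (field v)"
  by (simp add: coset_field_eq_iff rho_diff_comm[OF assms])

text \<open>The form on the quotient, pulled back along the Maurer-Cartan form; left invariance is
  thereby built in.\<close>

definition form_of :: "('g vector_field set \<Rightarrow> 'g vector_field set \<Rightarrow> real) \<Rightarrow> 'g two_form" where
  "form_of \<gamma> = (\<lambda>p u w. if u \<in> tangent_space A p \<and> w \<in> tangent_space A p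
     then \<gamma> (coset DF (field (mc p u))) (coset DF (field (mc p w))) else 0)"

text \<open>Evaluation at \<open>\<one>\<close> on chosen representatives. For bi-invariant forms
  the choice is immaterial by \<open>alt_of_coset\<close>; since it does not depend on
  \<open>\<eta>\<close>, linearity in \<open>\<eta>\<close> is immediate.\<close>

definition alt_of :: "'g two_form \<Rightarrow> 'g vector_field set \<Rightarrow> 'g vector_field set \<Rightarrow> real" where
  "alt_of \<eta> = (\<lambda>S T. if S \<in> vcarrier QA \<and> T \<in> vcarrier QA
     then \<eta> \<one> (vec (SOME v. coset DF (field v) = S)) (vec (SOME v. coset DF (field v) = T)) else 0)"

lemma alt_forms_bilinear:
  assumes "\<gamma> \<in> alt_forms2 QA"
  shows "bilinear (\<lambda>v w. \<gamma> (coset DF (field v)) (coset DF (field w)))"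
    and "\<gamma> (coset DF (field v)) (coset DF (field v)) = 0"
proof -
  have c: "coset DF (field v) \<in> vcarrier QA" for v by (simp add: QA_carrier)
  show "bilinear (\<lambda>v w. \<gamma> (coset DF (field v)) (coset DF (field w)))"
    using assms c unfolding bilinear_def alt_forms2_def
    by (auto intro!: linearI simp: QA_field_simps[symmetric])
  show "\<gamma> (coset DF (field v)) (coset DF (field v)) = 0"
    using assms c unfolding alt_forms2_def by auto
qed

lemma biinvariant_left:
  assumes "\<eta> \<in> biinvariant_two_forms G A" "u \<in> tangent_space A p" "w \<in> tangent_space A p"
  shows "\<eta> (g \<otimes> p) (differential A (\<lambda>q. g \<otimes> q) p u) (differential A (\<lambda>q. g \<otimes> q) p w) = \<eta> p u w"
proof -
  have "pullback2 A A (left_translation G g) \<eta> = \<eta>"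
    using assms(1) by (simp add: biinvariant_two_forms_def)
  then have "pullback2 A A (left_translation G g) \<eta> p u w = \<eta> p u w" by simp
  then show ?thesis using assms(2,3) by (simp add: pullback2_def left_translation_def)
qed

lemma biinvariant_right:
  assumes "\<eta> \<in> biinvariant_two_forms G A" "u \<in> tangent_space A p" "w \<in> tangent_space A p"
  shows "\<eta> (p \<otimes> g) (differential A (\<lambda>q. q \<otimes> g) p u) (differential A (\<lambda>q. q \<otimes> g) p w) = \<eta> p u w"
proof -
  have "pullback2 A A (right_translation G g) \<eta> = \<eta>"
    using assms(1) by (simp add: biinvariant_two_forms_def)
  then have "pullback2 A A (right_translation G g) \<eta> p u w = \<eta> p u w" by simp
  then show ?thesis using assms(2,3) by (simp add: pullback2_def right_translation_def)
qed

lemma biinvariant_at_one: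
  assumes "\<eta> \<in> biinvariant_two_forms G A"
  shows "bilinear (\<lambda>v w. \<eta> \<one> (vec v) (vec w))" and "\<eta> \<one> (vec v) (vec v) = 0"
    and "\<eta> \<one> (vec (rho g v)) (vec (rho g w)) = \<eta> \<one> (vec v) (vec w)"
proof -
  have "\<eta> \<one> \<in> alt_forms2 (sub_vspace (tangent_space A \<one>))"
    using assms by (simp add: biinvariant_two_forms_def two_forms_def)
  then show "bilinear (\<lambda>v w. \<eta> \<one> (vec v) (vec w))" "\<eta> \<one> (vec v) (vec v) = 0"
    using vec_tangent unfolding bilinear_def alt_forms2_def sub_vspace_def
    by (auto intro!: linearI simp: linear_add[OF linear_vec] linear_scale[OF linear_vec])
  have T: "differential A (\<lambda>q. g \<otimes> q) \<one> (vec v) \<in> tangent_space A g" for v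
    using differential_tangent[OF manifold_axioms manifold_axioms smooth_pull_left vec_tangent, of g] by simp
  \<comment> \<open>Conjugation is left translation from \<open>\<one>\<close> to \<open>g\<close>
    followed by right translation back to \<open>\<one>\<close>; bi-invariance covers both
    halves.\<close>
  have "differential A (\<lambda>q. q \<otimes> inv g) g (differential A (\<lambda>q. g \<otimes> q) \<one> (vec v)) = vec (rho g v)" for v
    using differential_compose[OF smooth_pull_right, of "inv g" "\<lambda>q. g \<otimes> q" \<one> "vec v"]
    by (simp add: vec_rho Ad_def)
  then show "\<eta> \<one> (vec (rho g v)) (vec (rho g w)) = \<eta> \<one> (vec v) (vec w)"
    using biinvariant_right[OF assms T T, of "inv g" v w]
      biinvariant_left[OF assms vec_tangent vec_tangent, of g v w] by simp
qed

lemma alt_of_coset: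
  assumes \<eta>: "\<eta> \<in> biinvariant_two_forms G A"
  shows "alt_of \<eta> (coset DF (field v)) (coset DF (field w)) = \<eta> \<one> (vec v) (vec w)"
proof -
  let ?\<beta> = "\<lambda>v w. \<eta> \<one> (vec v) (vec w)"
  note bil = biinvariant_at_one(1)[OF \<eta>]
  have L: "linear (\<lambda>x. ?\<beta> x y)" and R: "linear (?\<beta> y)" for y using bil by (auto simp: bilinear_def)
  have anti: "?\<beta> x y = - ?\<beta> y x" for x y
    using biinvariant_at_one(2)[OF \<eta>, of "x + y"] biinvariant_at_one(2)[OF \<eta>, of x] biinvariant_at_one(2)[OF \<eta>, of y]
      linear_add[OF L, of x y "x + y"] linear_add[OF R, of x x y] linear_add[OF R, of y x y] by linarith
  have zero: "?\<beta> d z = 0" if "d \<in> comm" for d z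
    by (rule invariant_form_zero[OF bil biinvariant_at_one(2,3)[OF \<eta>] that])
  define v' where "v' = (SOME x. coset DF (field x) = coset DF (field v))"
  define w' where "w' = (SOME x. coset DF (field x) = coset DF (field w))"
  have "coset DF (field v') = coset DF (field v)" "coset DF (field w') = coset DF (field w)"
    unfolding v'_def w'_def by (rule someI[of _ v], simp, rule someI[of _ w], simp)
  then have "v' - v \<in> comm" "w' - w \<in> comm" by (simp_all add: coset_field_eq_iff)
  \<comment> \<open>Vanishing is known in the first argument, so the representatives are exchanged
    one at a time: \<open>w\<close> is moved into first position, and \<open>anti\<close> moves it
    back.\<close>
  then have "?\<beta> (v' - v) w' = 0" "?\<beta> (w' - w) v = 0" using zero by blast+
  then have "?\<beta> v' w' = ?\<beta> v w'" "?\<beta> w' v = ?\<beta> w v"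
    using linear_diff[OF L, of v' v w'] linear_diff[OF L, of w' w v] by linarith+
  then have "?\<beta> v' w' = ?\<beta> v w" using anti[of v w'] anti[of v w] by linarith
  then show ?thesis by (simp add: alt_of_def QA_carrier v'_def w'_def)
qed

lemma alt_of_mem:
  assumes \<eta>: "\<eta> \<in> biinvariant_two_forms G A"
  shows "alt_of \<eta> \<in> alt_forms2 QA"
proof -
  note bil = biinvariant_at_one(1)[OF \<eta>]
  have L: "linear (\<lambda>x. \<eta> \<one> (vec x) (vec y))" and R: "linear (\<lambda>x. \<eta> \<one> (vec y) (vec x))" for y
    using bil by (auto simp: bilinear_def)
  have "alt_of \<eta> x y = 0" if "x \<notin> vcarrier QA \<or> y \<notin> vcarrier QA" for x y
    using that by (auto simp: alt_of_def)
  then show ?thesis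
    unfolding alt_forms2_def QA_carrier
    by (auto simp: QA_field_simps alt_of_coset[OF \<eta>] linear_add[OF L] linear_scale[OF L]
        linear_add[OF R] linear_scale[OF R] biinvariant_at_one(2)[OF \<eta>])
qed

text \<open>Left invariance comes from \<open>mc_left\<close>. A right translation replaces both
  arguments by their images under \<open>rho (inv g)\<close>, which lie in the same cosets because
  the group is connected. Smoothness follows by expanding the form in the components of
  \<open>mc\<close>.\<close>

lemma form_of_mem:
  assumes conn: "connected (UNIV :: 'g set)" and \<gamma>: "\<gamma> \<in> alt_forms2 QA"
  shows "form_of \<gamma> \<in> biinvariant_two_forms G A"
proof -
  define \<delta> where "\<delta> = (\<lambda>v w. \<gamma> (coset DF (field v)) (coset DF (field w)))"
  have bil: "bilinear \<delta>" and alt: "\<delta> v v = 0" for v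
    unfolding \<delta>_def using alt_forms_bilinear[OF \<gamma>] by auto
  have L: "linear (\<lambda>x. \<delta> x y)" and R: "linear (\<delta> y)" for y using bil by (auto simp: bilinear_def)
  have rho_inv: "\<delta> (rho g v) (rho g w) = \<delta> v w" for g v w
    by (simp add: \<delta>_def coset_field_rho[OF conn])
  have f: "form_of \<gamma> p u w = (if u \<in> tangent_space A p \<and> w \<in> tangent_space A p then \<delta> (mc p u) (mc p w) else 0)" for p u w
    by (simp add: form_of_def \<delta>_def)
  note sub = subspace_add[OF subspace_tangent] subspace_scale[OF subspace_tangent]
  have "form_of \<gamma> p \<in> alt_forms2 (sub_vspace (tangent_space A p))" for p
    unfolding alt_forms2_def sub_vspace_def
    by (auto simp: f sub alt linear_add[OF linear_mc] linear_scale[OF linear_mc]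
        linear_add[OF L] linear_scale[OF L] linear_add[OF R] linear_scale[OF R])
  moreover have "smooth_fun_on A W (\<lambda>p. form_of \<gamma> p (X p) (Y p))"
    if "open W" "smooth_vector_field_on A W X" "smooth_vector_field_on A W Y" for W X Y
    unfolding smooth_fun_on_iff[OF that(1)]
  proof
    fix p assume p: "p \<in> W"
    have ex: "\<delta> x y = (\<Sum>b\<in>B. \<Sum>c\<in>B. (x \<bullet> b) * (y \<bullet> c) * \<delta> b c)" for x y
    proof -
      have "\<delta> x y = (\<Sum>b\<in>B. (x \<bullet> b) *\<^sub>R \<delta> b y)" by (rule frame_linear[OF frame L])
      also have "\<dots> = (\<Sum>b\<in>B. (x \<bullet> b) *\<^sub>R (\<Sum>c\<in>B. (y \<bullet> c) *\<^sub>R \<delta> b c))"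
        by (simp only: frame_linear[OF frame R, of _ y, symmetric])
      finally show ?thesis by (simp add: sum_distrib_left mult.assoc)
    qed
    have "smooth_near A p (\<lambda>q. \<Sum>b\<in>B. \<Sum>c\<in>B. (mc q (X q) \<bullet> b) * (mc q (Y q) \<bullet> c) * \<delta> b c)"
      by (intro smooth_near_sum smooth_near_mult smooth_near_const smooth_mc[OF that(2,1) p] smooth_mc[OF that(3,1) p])
    then show "smooth_near A p (\<lambda>p. form_of \<gamma> p (X p) (Y p))"
    proof (rule smooth_near_cong[OF that(1) p, rotated])
      fix q assume q: "q \<in> W"
      then have "X q \<in> tangent_space A q" "Y q \<in> tangent_space A q"
        using that by (auto intro: smooth_vector_field_mem)
      then show "(\<Sum>b\<in>B. \<Sum>c\<in>B. (mc q (X q) \<bullet> b) * (mc q (Y q) \<bullet> c) * \<delta> b c) = form_of \<gamma> q (X q) (Y q)"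
        using ex[of "mc q (X q)" "mc q (Y q)"] by (simp add: f)
    qed
  qed
  moreover have "pullback2 A A (left_translation G g) (form_of \<gamma>) = form_of \<gamma>" for g
  proof (intro ext)
    fix p u w
    show "pullback2 A A (left_translation G g) (form_of \<gamma>) p u w = form_of \<gamma> p u w"
      using differential_tangent[OF manifold_axioms manifold_axioms smooth_pull_left, of _ p g]
      by (auto simp: pullback2_def left_translation_def f mc_left)
  qed
  moreover have "pullback2 A A (right_translation G g) (form_of \<gamma>) = form_of \<gamma>" for g
  proof (intro ext)
    fix p u w
    show "pullback2 A A (right_translation G g) (form_of \<gamma>) p u w = form_of \<gamma> p u w"
      using differential_tangent[OF manifold_axioms manifold_axioms smooth_pull_right, of _ p g]
      by (auto simp: pullback2_def right_translation_def f mc_right rho_inv)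
  qed
  ultimately show ?thesis
    by (simp add: biinvariant_two_forms_def two_forms_def)
qed

lemma alt_of_form_of:
  assumes conn: "connected (UNIV :: 'g set)" and \<gamma>: "\<gamma> \<in> alt_forms2 QA"
  shows "alt_of (form_of \<gamma>) = \<gamma>"
proof (intro ext)
  fix S T
  show "alt_of (form_of \<gamma>) S T = \<gamma> S T"
  proof (cases "S \<in> vcarrier QA \<and> T \<in> vcarrier QA")
    case True
    then obtain v w where vw: "S = coset DF (field v)" "T = coset DF (field w)"
      unfolding QA_carrier by blast
    show ?thesis
      unfolding vw alt_of_coset[OF form_of_mem[OF conn \<gamma>]]
      by (simp add: form_of_def vec_tangent mc_one coords_vec)
  next
    case False
    then have "\<gamma> S T = 0" using \<gamma> unfolding alt_forms2_def by blast
    then show ?thesis using False by (auto simp: alt_of_def)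
  qed
qed

text \<open>Left translation by \<open>inv p\<close> carries both arguments to
  \<open>\<one>\<close>, exactly as in \<open>mc\<close>, so a left invariant form is recovered from
  its value there.\<close>

lemma form_of_alt_of:
  assumes \<eta>: "\<eta> \<in> biinvariant_two_forms G A"
  shows "form_of (alt_of \<eta>) = \<eta>"
proof (intro ext)
  fix p u w
  show "form_of (alt_of \<eta>) p u w = \<eta> p u w"
  proof (cases "u \<in> tangent_space A p \<and> w \<in> tangent_space A p")
    case True
    then show ?thesis
      using biinvariant_left[OF \<eta>, of u p w "inv p"]
      by (simp add: form_of_def alt_of_coset[OF \<eta>] vec_mc)
  next
    case False
    have "\<eta> p \<in> alt_forms2 (sub_vspace (tangent_space A p))"
      using \<eta> by (simp add: biinvariant_two_forms_def two_forms_def)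
    then have "\<eta> p u w = 0" using False unfolding alt_forms2_def sub_vspace_def by auto
    then show ?thesis using False by (auto simp: form_of_def)
  qed
qed

lemma alt_of_linear_iso:
  assumes "connected (UNIV :: 'g set)"
  shows "alt_of \<in> linear_isos (sub_vspace (biinvariant_two_forms G A)) (sub_vspace (alt_forms2 QA))"
proof -
  have "bij_betw alt_of (biinvariant_two_forms G A) (alt_forms2 QA)"
    by (rule bij_betw_byWitness[of _ form_of])
      (auto simp: alt_of_form_of[OF assms] form_of_alt_of alt_of_mem form_of_mem[OF assms])
  moreover have "alt_of (\<eta> + \<eta>') = alt_of \<eta> + alt_of \<eta>'" for \<eta> \<eta>'
    by (intro ext) (simp add: alt_of_def)
  moreover have "alt_of (c *\<^sub>R \<eta>) = c *\<^sub>R alt_of \<eta>" for c \<eta>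
    by (intro ext) (simp add: alt_of_def scaleR_fun_def)
  ultimately show ?thesis
    by (simp add: linear_isos_def sub_vspace_def)
qed

section \<open>Compact groups: the center as a complement\<close>

lemma continuous_rho: "continuous_on UNIV (\<lambda>g. rho g v \<bullet> c)"
  by (rule smooth_near_continuous_on[OF smooth_rho])

lemma center_complement:
  assumes conn: "connected (UNIV :: 'g set)" and cpt: "compact (UNIV :: 'g set)"
  shows "\<exists>z. (\<forall>w. brk w z = 0) \<and> v - z \<in> comm"
proof -
  \<comment> \<open>This is the affine subspace \<open>v + comm\<close>, described by functionals:
    as an intersection of hyperplanes it is visibly closed and convex, and its invariance is
    \<open>rho_inner_const\<close>.\<close>
  define K where "K = {x. \<forall>l\<in>{l. \<forall>x y. brk x y \<bullet> l = 0}. x \<bullet> l = v \<bullet> l}"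
  have cont: "continuous_on UNIV (\<lambda>g. rho g v)" for v
  proof -
    have "continuous_on UNIV (\<lambda>g. \<Sum>b\<in>B. (rho g v \<bullet> b) *\<^sub>R b)"
      by (intro continuous_on_sum continuous_on_scaleR continuous_rho continuous_on_const)
    then show ?thesis by (simp add: frame_expand[OF frame])
  qed
  have "closed K"
  proof -
    have "K = (\<Inter>l\<in>{l. \<forall>x y. brk x y \<bullet> l = 0}. {x. x \<bullet> l = v \<bullet> l})" by (auto simp: K_def)
    then show ?thesis by (auto intro!: closed_INT closed_Collect_eq continuous_intros)
  qed
  moreover have "convex K"
    unfolding K_def convex_def
    by (auto simp: inner_add_left) (metis distrib_right mult_1)
  moreover have "v \<in> K" by (simp add: K_def)
  moreover have "rho g x \<in> K" if "x \<in> K" for g x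
    using that rho_inner_const[OF conn] by (simp add: K_def)
  moreover have "\<exists>k. \<forall>v. rho k v = rho g (rho h v)" for g h
    using rho_mult by blast
  moreover have "\<exists>h. \<forall>v. rho h (rho g v) = v" for g
    by (intro exI[of _ "inv g"]) (simp add: rho_mult[symmetric] rho_one)
  ultimately obtain z where z: "z \<in> K" "\<And>g. rho g z = z"
    using compact_group_fixed_point[OF frame cpt cont linear_rho, of K] by blast
  have "brk w z = 0" for w
    by (rule frame_eqI[OF frame]) (simp add: brk_inner_zero z(2))
  moreover have "v - z \<in> comm"
  proof (rule frame_subspace_double_orthogonal[OF frame subspace_comm])
    fix l assume "\<And>d. d \<in> comm \<Longrightarrow> d \<bullet> l = 0"
    then show "(v - z) \<bullet> l = 0" using z(1) brk_comm by (simp add: K_def inner_diff_left)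
  qed
  ultimately show ?thesis by blast
qed

text \<open>The fixed point theorem is applied to the dual representation on \<open>{l. z \<bullet> l = 1}\<close>.\<close>

lemma center_comm_trivial:
  assumes conn: "connected (UNIV :: 'g set)" and cpt: "compact (UNIV :: 'g set)"
    and z: "\<And>w. brk w z = 0" "z \<in> comm"
  shows "z = 0"
proof (rule ccontr)
  assume nz: "z \<noteq> 0"
  \<comment> \<open>The dual representation, with functionals represented by vectors:
    \<open>R g\<close> is the adjoint map of \<open>rho (inv g)\<close>, and the inverse makes it
    multiplicative in \<open>g\<close>.\<close>
  define R where "R = (\<lambda>g l. \<Sum>b\<in>B. (rho (inv g) b \<bullet> l) *\<^sub>R b)"
  have R: "x \<bullet> R g l = rho (inv g) x \<bullet> l" for x g l
  proof -
    have "rho (inv g) x \<bullet> l = (\<Sum>b\<in>B. (x \<bullet> b) *\<^sub>R rho (inv g) b) \<bullet> l"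
      by (simp only: frame_linear[OF frame linear_rho, of "inv g" x, symmetric])
    then show ?thesis by (simp add: R_def inner_sum_right inner_sum_left mult.commute)
  qed
  have R_eqI: "a = b" if "\<And>x. x \<bullet> a = x \<bullet> b" for a b :: 'e
    using that frame_eqI[OF frame, of a b] by (simp add: inner_commute)
  have "continuous_on UNIV (\<lambda>g. R g l)" for l
  proof -
    have "continuous_on UNIV (\<lambda>g. rho (inv g) b \<bullet> l)" for b
      using smooth_pull_inv continuous_on_compose2[OF continuous_rho, of UNIV "\<lambda>g. inv g"]
      by (simp add: smooth_pull_def)
    then show ?thesis
      unfolding R_def by (intro continuous_on_sum continuous_on_scaleR continuous_on_const)
  qed
  moreover have "linear (R g)" for g
    by (rule linearI; rule R_eqI) (simp_all add: R inner_add_right)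
  moreover have "\<exists>k. \<forall>l. R k l = R g (R h l)" for g h
    by (intro exI[of _ "g \<otimes> h"] allI R_eqI) (simp add: R inv_mult_group rho_mult)
  moreover have "\<exists>h. \<forall>l. R h (R g l) = l" for g
    by (intro exI[of _ "inv g"] allI R_eqI) (simp add: R rho_mult[symmetric] rho_one)
  moreover have "closed {l. z \<bullet> l = 1}" by (intro closed_Collect_eq continuous_intros)
  moreover have "convex {l. z \<bullet> l = 1}" by (rule convex_hyperplane)
  moreover have "{l. z \<bullet> l = 1} \<noteq> {}"
    using nz by (auto intro!: exI[of _ "z /\<^sub>R (z \<bullet> z)"])
  moreover have "R g l \<in> {l. z \<bullet> l = 1}" if "l \<in> {l. z \<bullet> l = 1}" for g l
    using that rho_fixes_central[OF conn z(1)] by (simp add: R)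
  ultimately obtain l where l: "z \<bullet> l = 1" "\<And>g. R g l = l"
    using compact_group_fixed_point[OF frame cpt, of R "{l. z \<bullet> l = 1}"] by blast
  \<comment> \<open>A fixed vector of the dual representation is an invariant functional. It kills
    all brackets, hence all of \<open>comm\<close>, in contradiction to the value 1 at
    \<open>z\<close>.\<close>
  have "rho g v \<bullet> l = v \<bullet> l" for g v
    using R[of v "inv g" l] by (simp add: l(2))
  then have "z \<bullet> l = 0"
    using comm_inner_zero[OF z(2)] brk_inner_zero by blast
  then show False using l(1) by simp
qed

definition center :: "'e set" where "center = {z. \<forall>w. brk w z = 0}"

lemma subspace_center: "subspace center"
  by (rule subspaceI)
    (auto simp: center_def linear_0[OF linear_brk_right] linear_add[OF linear_brk_right] linear_scale[OF linear_brk_right])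

lemma field_0: "field 0 = 0"
  by (rule linear_0[OF linear_field])

lemma compact_summand:
  assumes conn: "connected (UNIV :: 'g set)" and cpt: "compact (UNIV :: 'g set)"
  shows "largest_abelian_summand (vf_bracket A) LF (field ` center)"
    and "coset DF \<in> lie_isos (sub_lie (vf_bracket A) (field ` center)) QA"
proof -
  let ?S = "field ` center"
  have S_sub: "?S \<subseteq> LF" using field_mem by blast
  have subS: "subspace ?S" by (rule linear_subspace_image[OF linear_field subspace_center])
  have DF_sub: "DF \<subseteq> LF" using field_mem by (auto simp: derived_eq)
  have br_center: "vf_bracket A X Y = 0" if "X \<in> LF" "Y \<in> ?S" for X Y
    using that field_0 unfolding range_field[symmetric] center_def
    by (auto simp: field_brk[symmetric])
  have S_ideal: "lie_ideal (vf_bracket A) LF ?S"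
    using S_sub subS br_center subspace_0[OF subS] by (simp add: lie_ideal_def)
  have br_DF: "vf_bracket A X Y \<in> DF" if "X \<in> LF" "Y \<in> LF" for X Y
    using that unfolding derived_algebra_def by (intro span_base) blast
  have DF_ideal: "lie_ideal (vf_bracket A) LF DF"
    using DF_sub subspace_DF br_DF unfolding lie_ideal_def by blast
  have int: "?S \<inter> DF = {0}"
  proof -
    have "X = 0" if X: "X \<in> ?S" "X \<in> DF" for X
    proof -
      obtain z where z: "X = field z" "z \<in> center" using X(1) by blast
      then have "z \<in> comm" using X(2) field_DF_iff by simp
      then have "z = 0" using center_comm_trivial[OF conn cpt] z(2) by (simp add: center_def)
      then show ?thesis using z(1) field_0 by simp
    qed
    then show ?thesis using subspace_0[OF subS] subspace_0[OF subspace_DF] by blast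
  qed
  have split: "\<exists>s\<in>?S. X - s \<in> DF" if X: "X \<in> LF" for X
  proof -
    obtain v where v: "X = field v" using X range_field by blast
    obtain z where "z \<in> center" "v - z \<in> comm"
      using center_complement[OF conn cpt, of v] by (auto simp: center_def)
    then show ?thesis
      using field_DF_iff[of "v - z"] by (auto simp: v linear_diff[OF linear_field])
  qed
  have sum: "LF = {s + t | s t. s \<in> ?S \<and> t \<in> DF}"
  proof (intro subset_antisym subsetI)
    fix X assume "X \<in> LF"
    then obtain s where "s \<in> ?S" "X - s \<in> DF" using split by blast
    then show "X \<in> {s + t | s t. s \<in> ?S \<and> t \<in> DF}"
      by (intro CollectI exI[of _ s] exI[of _ "X - s"]) auto
  next
    fix X assume "X \<in> {s + t | s t. s \<in> ?S \<and> t \<in> DF}"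
    then obtain v w where "X = field v + field w" by (auto simp: derived_eq)
    then show "X \<in> LF" using field_mem[of "v + w"] by (simp add: linear_add[OF linear_field])
  qed
  have "abelian_summand (vf_bracket A) LF ?S"
    unfolding abelian_summand_def direct_summand_def
  proof (intro conjI exI[of _ DF] ballI)
    show "vf_bracket A X Y = 0" if "X \<in> ?S" "Y \<in> ?S" for X Y
      using br_center[OF subsetD[OF S_sub that(1)] that(2)] .
  qed (fact S_ideal DF_ideal int sum)+
  moreover have "S' \<subseteq> ?S" if S': "abelian_summand (vf_bracket A) LF S'" for S'
  proof
    fix Y assume Y: "Y \<in> S'"
    have ex: "\<exists>T. lie_ideal (vf_bracket A) LF T \<and> S' \<inter> T = {0} \<and> LF = {s + t | s t. s \<in> S' \<and> t \<in> T}"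
      and T1: "lie_ideal (vf_bracket A) LF S'" and T5: "\<And>x y. x \<in> S' \<Longrightarrow> y \<in> S' \<Longrightarrow> vf_bracket A x y = 0"
      using S' by (simp_all add: abelian_summand_def direct_summand_def)
    from ex obtain T where ex': "lie_ideal (vf_bracket A) LF T \<and> S' \<inter> T = {0} \<and>
      LF = {s + t | s t. s \<in> S' \<and> t \<in> T}" by (rule exE)
    note T = T1 conjunct1[OF ex'] conjunct1[OF conjunct2[OF ex']] conjunct2[OF conjunct2[OF ex']] T5
    have Y_LF: "Y \<in> LF" using Y T(1) by (auto simp: lie_ideal_def)
    then obtain y where y: "Y = field y" using range_field by blast
    \<comment> \<open>Split \<open>field w\<close> along \<open>S'\<close> and \<open>T\<close>: the
      part in \<open>S'\<close> commutes with \<open>Y\<close> because \<open>S'\<close> is abelian,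
      and the bracket of \<open>Y\<close> with the part in \<open>T\<close> lies in both ideals,
      hence in their intersection \<open>{0}\<close>.\<close>
    have "brk w y = 0" for w
    proof -
      have "field w \<in> {s + t | s t. s \<in> S' \<and> t \<in> T}" using field_mem[of w] T(4) by simp
      then obtain s t where st: "field w = s + t" "s \<in> S'" "t \<in> T" by blast
      have "s \<in> LF" "t \<in> LF" using st T(1,2) by (auto simp: lie_ideal_def)
      then obtain a b where ab: "s = field a" "t = field b" using range_field by blast
      have "w = a + b" using st(1) inj_field by (auto simp: ab linear_add[OF linear_field, symmetric] dest: injD)
      then have "brk w y = brk a y + brk b y" by (simp add: linear_add[OF linear_brk_left])
      moreover have "field (brk a y) = 0" using T(5)[OF st(2) Y] by (simp add: field_brk ab y)
      moreover have "field (brk b y) \<in> S'"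
        using T(1) \<open>t \<in> LF\<close> Y by (auto simp: lie_ideal_def field_brk ab y)
      moreover have "field (brk y b) \<in> T"
        using T(2) Y_LF st(3) by (auto simp: lie_ideal_def field_brk ab y)
      then have "field (brk b y) \<in> T"
        using T(2) subspace_neg[of T "field (brk y b)"]
        by (simp add: lie_ideal_def brk_antisym[of b y] linear_neg[OF linear_field])
      ultimately have "field (brk w y) = field 0"
        using T(3) field_0 by (auto simp: linear_add[OF linear_field])
      then show ?thesis using inj_field by (auto dest: injD)
    qed
    then show "Y \<in> ?S" by (auto simp: y center_def)
  qed
  ultimately show "largest_abelian_summand (vf_bracket A) LF ?S"
    by (simp add: largest_abelian_summand_def)
  have "inj_on (coset DF) ?S"
  proof (rule inj_onI)
    fix x y assume xy: "x \<in> ?S" "y \<in> ?S" "coset DF x = coset DF y"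
    then have "x - y \<in> ?S \<inter> DF"
      using subspace_diff[OF subS] by (simp add: coset_eq_iff[OF subspace_DF])
    then show "x = y" using int by auto
  qed
  moreover have "coset DF ` ?S = coset DF ` LF"
  proof (rule subset_antisym[OF image_mono[OF S_sub] subsetI])
    fix C assume "C \<in> coset DF ` LF"
    then obtain X where X: "X \<in> LF" "C = coset DF X" by blast
    obtain s where "s \<in> ?S" "X - s \<in> DF" using split[OF X(1)] by blast
    then show "C \<in> coset DF ` ?S" using X(2) coset_eq_iff[OF subspace_DF] by blast
  qed
  ultimately have "bij_betw (coset DF) ?S (vcarrier QA)" by (simp add: bij_betw_def QA_simps)
  moreover have "coset DF (vf_bracket A x y) = lbracket QA (coset DF x) (coset DF y)"
    if "x \<in> ?S" "y \<in> ?S" for x y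
  proof -
    \<comment> \<open>The bracket of two cosets ranges over all representatives. This set turns out
      to be \<open>DF\<close> itself, the zero coset, and on the other side the bracket of
      \<open>x\<close> and \<open>y\<close> vanishes because \<open>y\<close> comes from the
      center.\<close>
    have *: "z \<in> coset DF 0 \<longleftrightarrow> z \<in> DF" for z using coset_mem[OF subspace_DF, of z 0] by simp
    have mem: "x \<in> coset DF x" for x using coset_mem[OF subspace_DF, of x x] subspace_0[OF subspace_DF] by simp
    have "a \<in> LF" if "a \<in> coset DF x" "x \<in> ?S" for a x
      using that sum by (auto simp: coset_def)
    then have "{vf_bracket A a b + n | a b n. a \<in> coset DF x \<and> b \<in> coset DF y \<and> n \<in> DF} \<subseteq> DF"
      using that br_DF subspace_add[OF subspace_DF] by blast
    moreover have "n \<in> {vf_bracket A a b + n | a b n. a \<in> coset DF x \<and> b \<in> coset DF y \<and> n \<in> DF}" if "n \<in> DF" for n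
    proof -
      have "n = vf_bracket A x y + n" using br_center S_sub \<open>x \<in> ?S\<close> \<open>y \<in> ?S\<close> by auto
      then show ?thesis using mem that by blast
    qed
    ultimately have "{vf_bracket A a b + n | a b n. a \<in> coset DF x \<and> b \<in> coset DF y \<and> n \<in> DF} = coset DF 0"
      using * by blast
    moreover have "vf_bracket A x y = 0" using br_center S_sub that by blast
    ultimately show ?thesis by (simp add: abelianisation_def lie_quotient_def)
  qed
  ultimately show "coset DF \<in> lie_isos (sub_lie (vf_bracket A) ?S) QA"
    by (simp add: lie_isos_def linear_isos_def sub_lie_def QA_simps)
qed

end

theorem theorem1:
  fixes G :: "('g::{t2_space, second_countable_topology}, 'm) monoid_scheme"
    and A :: "('g, 'e::real_inner) chart set"
  assumes "lie_group G A"
    and "connected (UNIV :: 'g set)"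
  shows "(\<exists>\<Phi>. \<Phi> \<in> linear_isos
            (sub_vspace (biinvariant_two_forms G A))
            (sub_vspace (alt_forms2 (abelianisation (vf_bracket A) (left_invariant_fields G A))))) \<and>
         (compact (UNIV :: 'g set) \<longrightarrow>
           (\<exists>S. largest_abelian_summand (vf_bracket A) (left_invariant_fields G A) S \<and>
              coset (derived_algebra (vf_bracket A) (left_invariant_fields G A))
                \<in> lie_isos (sub_lie (vf_bracket A) S)
                    (abelianisation (vf_bracket A) (left_invariant_fields G A))))"
proof -
  interpret lie_group G A by fact
  obtain B :: "'e set" where B: "frame B" using finite_dim frame_exists by blast
  have "manifold A B" using atlas B by unfold_locales
  then obtain U \<phi> where "(U, \<phi>) \<in> A" "\<one>\<^bsub>G\<^esub> \<in> U" by (rule manifold.chart_at)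
  with B interpret lie_group_chart G A B U \<phi> by unfold_locales
  show ?thesis using alt_of_linear_iso[OF assms(2)] compact_summand[OF assms(2)] by blast
qed

end
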